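(* Let $P\colon \mathsf{X}\to\mathsf{B}$ be a cartesian monoidal opfibration whose fibres are groupoids, and $F\colon \mathsf{B}\to\mathbb{C}\mathsf{at}$ its associated pseudofunctor. Then $F$ lifts to pseudofunctors from $\mathsf{Gp}(\mathsf{B})$ to $2\mathbb{G}\mathsf{p}$ and from $\mathsf{Ab}(\mathsf{B})$ to $\mathbb{S}\mathsf{ym}2\mathbb{G}\mathsf{p}$.
   Context: A cartesian monoidal opfibration is a (cloven) opfibration $P\colon\mathsf X\to\mathsf B$ such that $\mathsf X$ and $\mathsf B$ have finite products, $P$ strictly preserves them (as a strict monoidal functor), and products of cocartesian arrows are cocartesian. The associated pseudofunctor $F$ sends $A$ to the fibre $F(A)$ of $P$ over $A$ and $f$ to the change-of-base functor $f_*$ determined by cocartesian liftings. $F$ is lax symmetric monoidal $(\mathsf B,\times,I_{\mathsf B})\to(\mathbb{C}\mathsf{at},\times,\mathsf I)$ via $R^{A,B}(X,Y)=X\times Y$ (product in $\mathsf X$) and $R^1(\star)=I_{\mathsf X}$ (terminal object), where $\mathsf I$ is the terminal category with object $\star$. Hence, for a (commutative) monoid $(M,m,e)$ in $\mathsf B$, $F(M)$ is a (symmetric) monoidal category with tensor $\otimes=F(m)\circ R^{M,M}$ and unit $(F(e)\circ R^1)(\star)$, and (commutative) monoid morphisms are sent to strong (symmetric) monoidal functors. $\mathsf{Gp}(\mathsf B)$ and $\mathsf{Ab}(\mathsf B)$ are the categories of internal groups and internal abelian groups in $\mathsf B$. A (symmetric) 2-group is a (symmetric) monoidal groupoid in which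 every object is weakly invertible with respect to the tensor product; $2\mathbb{G}\mathsf p$ and $\mathbb{S}\mathsf{ym}2\mathbb{G}\mathsf p$ are the 2-categories of 2-groups and symmetric 2-groups. "Lifts" means that, when for each internal group (resp. internal abelian group) with multiplication $m\colon A\times A\to A$ and identity $e\colon I_{\mathsf B}\to A$ the fibre $F(A)$ is given the monoidal (resp. symmetric monoidal) structure with tensor $\otimes=F(m)\circ R^{A,A}$ and unit $(F(e)\circ R^1)(\star)$, $F$ determines pseudofunctors on internal groups (resp. internal abelian groups) that commute with the forgetful functors to $\mathsf B$ and to $\mathbb{C}\mathsf{at}$ (the 2-category of categories). *)

theory Defs
  imports Main "HOL-Library.FuncSet"
begin

section \<open>Categories and functors\<close>

text \<open>
  A category is given by a set of objects and a set of arrows inside two types; the operations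
  are only meaningful on these carriers.  Composition is in applicative order.
\<close>

record ('o, 'a) cat =
  Obj :: "'o set"
  Arr :: "'a set"
  Dom :: "'a \<Rightarrow> 'o"
  Cod :: "'a \<Rightarrow> 'o"
  Idn :: "'o \<Rightarrow> 'a"
  Cmp :: "'a \<Rightarrow> 'a \<Rightarrow> 'a"

abbreviation cmp_syntax :: "'a \<Rightarrow> ('o, 'a) cat \<Rightarrow> 'a \<Rightarrow> 'a"
    (\<open>(_ \<cdot>\<^bsub>_\<^esub>/ _)\<close> [56, 0, 55] 55) where
  "g \<cdot>\<^bsub>C\<^esub> f \<equiv> Cmp C g f"

definition hom :: "('o, 'a) cat \<Rightarrow> 'o \<Rightarrow> 'o \<Rightarrow> 'a set" where
  "hom C A B = {f \<in> Arr C. Dom C f = A \<and> Cod C f = B}"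

definition category :: "('o, 'a) cat \<Rightarrow> bool" where
  "category C \<longleftrightarrow>
     (\<forall>f \<in> Arr C. Dom C f \<in> Obj C \<and> Cod C f \<in> Obj C) \<and>
     (\<forall>A \<in> Obj C. Idn C A \<in> hom C A A) \<and>
     (\<forall>f \<in> Arr C. \<forall>g \<in> Arr C. Cod C f = Dom C g \<longrightarrow> g \<cdot>\<^bsub>C\<^esub> f \<in> hom C (Dom C f) (Cod C g)) \<and>
     (\<forall>f \<in> Arr C. f \<cdot>\<^bsub>C\<^esub> Idn C (Dom C f) = f \<and> Idn C (Cod C f) \<cdot>\<^bsub>C\<^esub> f = f) \<and>
     (\<forall>f \<in> Arr C. \<forall>g \<in> Arr C. \<forall>h \<in> Arr C. Cod C f = Dom C g \<longrightarrow> Cod C g = Dom C h \<longrightarrow>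
        h \<cdot>\<^bsub>C\<^esub> (g \<cdot>\<^bsub>C\<^esub> f) = (h \<cdot>\<^bsub>C\<^esub> g) \<cdot>\<^bsub>C\<^esub> f)"

definition iso :: "('o, 'a) cat \<Rightarrow> 'a \<Rightarrow> bool" where
  "iso C f \<longleftrightarrow> f \<in> Arr C \<and>
     (\<exists>g \<in> hom C (Cod C f) (Dom C f).
        g \<cdot>\<^bsub>C\<^esub> f = Idn C (Dom C f) \<and> f \<cdot>\<^bsub>C\<^esub> g = Idn C (Cod C f))"

definition isomorphic :: "('o, 'a) cat \<Rightarrow> 'o \<Rightarrow> 'o \<Rightarrow> bool" where
  "isomorphic C A B \<longleftrightarrow> (\<exists>f \<in> hom C A B. iso C f)"

definition groupoid :: "('o, 'a) cat \<Rightarrow> bool" where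
  "groupoid C \<longleftrightarrow> category C \<and> (\<forall>f \<in> Arr C. iso C f)"

definition prod_cat :: "('o, 'a) cat \<Rightarrow> ('p, 'b) cat \<Rightarrow> ('o \<times> 'p, 'a \<times> 'b) cat" where
  "prod_cat C D = \<lparr>Obj = Obj C \<times> Obj D, Arr = Arr C \<times> Arr D,
     Dom = map_prod (Dom C) (Dom D), Cod = map_prod (Cod C) (Cod D),
     Idn = map_prod (Idn C) (Idn D),
     Cmp = (\<lambda>g f. (fst g \<cdot>\<^bsub>C\<^esub> fst f, snd g \<cdot>\<^bsub>D\<^esub> snd f))\<rparr>"

definition terminal_cat :: "(unit, unit) cat" where
  "terminal_cat = \<lparr>Obj = {()}, Arr = {()}, Dom = (\<lambda>_. ()), Cod = (\<lambda>_. ()),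
     Idn = (\<lambda>_. ()), Cmp = (\<lambda>_ _. ())\<rparr>"

text \<open>
  Functors carry their source and target.  Their object and arrow maps are required to be
  \<^const>\<open>undefined\<close> outside the carriers of the source, so that equality of functors is equality
  of records; the same convention is used for all structured maps below.
\<close>

record ('o, 'a, 'p, 'b) func =
  Fdom :: "('o, 'a) cat"
  Fcod :: "('p, 'b) cat"
  Fob :: "'o \<Rightarrow> 'p"
  Far :: "'a \<Rightarrow> 'b"

definition is_functor :: "('o, 'a, 'p, 'b) func \<Rightarrow> bool" where
  "is_functor F \<longleftrightarrow>
     category (Fdom F) \<and> category (Fcod F) \<and>
     Fob F \<in> extensional (Obj (Fdom F)) \<and> Far F \<in> extensional (Arr (Fdom F)) \<and>
     (\<forall>A \<in> Obj (Fdom F). Fob F A \<in> Obj (Fcod F)) \<and>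
     (\<forall>f \<in> Arr (Fdom F).
        Far F f \<in> hom (Fcod F) (Fob F (Dom (Fdom F) f)) (Fob F (Cod (Fdom F) f))) \<and>
     (\<forall>A \<in> Obj (Fdom F). Far F (Idn (Fdom F) A) = Idn (Fcod F) (Fob F A)) \<and>
     (\<forall>f \<in> Arr (Fdom F). \<forall>g \<in> Arr (Fdom F). Cod (Fdom F) f = Dom (Fdom F) g \<longrightarrow>
        Far F (g \<cdot>\<^bsub>Fdom F\<^esub> f) = Far F g \<cdot>\<^bsub>Fcod F\<^esub> Far F f)"

definition id_func :: "('o, 'a) cat \<Rightarrow> ('o, 'a, 'o, 'a) func" where
  "id_func C = \<lparr>Fdom = C, Fcod = C, Fob = (\<lambda>A \<in> Obj C. A), Far = (\<lambda>f \<in> Arr C. f)\<rparr>"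

definition comp_func ::
    "('p, 'b, 'q, 'c) func \<Rightarrow> ('o, 'a, 'p, 'b) func \<Rightarrow> ('o, 'a, 'q, 'c) func" where
  "comp_func G F = \<lparr>Fdom = Fdom F, Fcod = Fcod G,
     Fob = (\<lambda>A \<in> Obj (Fdom F). Fob G (Fob F A)),
     Far = (\<lambda>f \<in> Arr (Fdom F). Far G (Far F f))\<rparr>"

definition is_natural ::
    "('o, 'a, 'p, 'b) func \<Rightarrow> ('o, 'a, 'p, 'b) func \<Rightarrow> ('o \<Rightarrow> 'b) \<Rightarrow> bool" where
  "is_natural F G t \<longleftrightarrow>
     is_functor F \<and> is_functor G \<and> Fdom F = Fdom G \<and> Fcod F = Fcod G \<and>
     t \<in> extensional (Obj (Fdom F)) \<and>
     (\<forall>A \<in> Obj (Fdom F). t A \<in> hom (Fcod F) (Fob F A) (Fob G A)) \<and>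
     (\<forall>f \<in> Arr (Fdom F).
        t (Cod (Fdom F) f) \<cdot>\<^bsub>Fcod F\<^esub> Far F f = Far G f \<cdot>\<^bsub>Fcod F\<^esub> t (Dom (Fdom F) f))"


section \<open>Strict 2-categories and pseudofunctors\<close>

record ('o, 'm, 'c) twocat =
  Cells0 :: "'o set"
  Cells1 :: "'m set"
  Cells2 :: "'c set"
  Src1 :: "'m \<Rightarrow> 'o"
  Tgt1 :: "'m \<Rightarrow> 'o"
  Id1 :: "'o \<Rightarrow> 'm"
  Comp1 :: "'m \<Rightarrow> 'm \<Rightarrow> 'm"
  Src2 :: "'c \<Rightarrow> 'm"
  Tgt2 :: "'c \<Rightarrow> 'm"
  Id2 :: "'m \<Rightarrow> 'c"
  VComp :: "'c \<Rightarrow> 'c \<Rightarrow> 'c"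
  HComp :: "'c \<Rightarrow> 'c \<Rightarrow> 'c"

definition cat1 :: "('o, 'm, 'c) twocat \<Rightarrow> ('o, 'm) cat" where
  "cat1 K = \<lparr>Obj = Cells0 K, Arr = Cells1 K, Dom = Src1 K, Cod = Tgt1 K,
     Idn = Id1 K, Cmp = Comp1 K\<rparr>"

definition vcat :: "('o, 'm, 'c) twocat \<Rightarrow> ('m, 'c) cat" where
  "vcat K = \<lparr>Obj = Cells1 K, Arr = Cells2 K, Dom = Src2 K, Cod = Tgt2 K,
     Idn = Id2 K, Cmp = VComp K\<rparr>"

definition hcat :: "('o, 'm, 'c) twocat \<Rightarrow> ('o, 'c) cat" where
  "hcat K = \<lparr>Obj = Cells0 K, Arr = Cells2 K,
     Dom = (\<lambda>c. Src1 K (Src2 K c)), Cod = (\<lambda>c. Tgt1 K (Tgt2 K c)),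
     Idn = (\<lambda>A. Id2 K (Id1 K A)), Cmp = HComp K\<rparr>"

definition two_category :: "('o, 'm, 'c) twocat \<Rightarrow> bool" where
  "two_category K \<longleftrightarrow>
     category (cat1 K) \<and> category (vcat K) \<and> category (hcat K) \<and>
     (\<forall>c \<in> Cells2 K. Src1 K (Src2 K c) = Src1 K (Tgt2 K c) \<and>
                     Tgt1 K (Src2 K c) = Tgt1 K (Tgt2 K c)) \<and>
     (\<forall>c \<in> Cells2 K. \<forall>d \<in> Cells2 K. Tgt1 K (Tgt2 K c) = Src1 K (Src2 K d) \<longrightarrow>
        Src2 K (HComp K d c) = Comp1 K (Src2 K d) (Src2 K c) \<and>
        Tgt2 K (HComp K d c) = Comp1 K (Tgt2 K d) (Tgt2 K c)) \<and>
     (\<forall>f \<in> Cells1 K. \<forall>g \<in> Cells1 K. Tgt1 K f = Src1 K g \<longrightarrow>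
        HComp K (Id2 K g) (Id2 K f) = Id2 K (Comp1 K g f)) \<and>
     (\<forall>c \<in> Cells2 K. \<forall>c' \<in> Cells2 K. \<forall>d \<in> Cells2 K. \<forall>d' \<in> Cells2 K.
        Tgt2 K c = Src2 K c' \<longrightarrow> Tgt2 K d = Src2 K d' \<longrightarrow> Tgt1 K (Tgt2 K c) = Src1 K (Src2 K d) \<longrightarrow>
        HComp K (VComp K d' d) (VComp K c' c) = VComp K (HComp K d' c') (HComp K d c))"

text \<open>
  Pseudofunctors from a category, regarded as a locally discrete 2-category, to a strict
  2-category; \<open>PComp g f\<close> is the invertible 2-cell from the composite of the images of \<open>g\<close> and \<open>f\<close>
  to the image of the composite, and \<open>PUnit A\<close> the one from the identity on the image of \<open>A\<close> to
  the image of the identity.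
\<close>

record ('bo, 'ba, 'o, 'm, 'c) pfunc =
  PObj :: "'bo \<Rightarrow> 'o"
  PArr :: "'ba \<Rightarrow> 'm"
  PComp :: "'ba \<Rightarrow> 'ba \<Rightarrow> 'c"
  PUnit :: "'bo \<Rightarrow> 'c"

definition pseudofunctor ::
    "('bo, 'ba) cat \<Rightarrow> ('o, 'm, 'c) twocat \<Rightarrow> ('bo, 'ba, 'o, 'm, 'c) pfunc \<Rightarrow> bool" where
  "pseudofunctor C K F \<longleftrightarrow>
     category C \<and> two_category K \<and>
     (\<forall>A \<in> Obj C. PObj F A \<in> Cells0 K) \<and>
     (\<forall>f \<in> Arr C. PArr F f \<in> hom (cat1 K) (PObj F (Dom C f)) (PObj F (Cod C f))) \<and>
     (\<forall>f \<in> Arr C. \<forall>g \<in> Arr C. Cod C f = Dom C g \<longrightarrow>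
        PComp F g f \<in> hom (vcat K) (Comp1 K (PArr F g) (PArr F f)) (PArr F (g \<cdot>\<^bsub>C\<^esub> f)) \<and>
        iso (vcat K) (PComp F g f)) \<and>
     (\<forall>A \<in> Obj C.
        PUnit F A \<in> hom (vcat K) (Id1 K (PObj F A)) (PArr F (Idn C A)) \<and>
        iso (vcat K) (PUnit F A)) \<and>
     (\<forall>f \<in> Arr C. \<forall>g \<in> Arr C. \<forall>h \<in> Arr C. Cod C f = Dom C g \<longrightarrow> Cod C g = Dom C h \<longrightarrow>
        VComp K (PComp F h (g \<cdot>\<^bsub>C\<^esub> f)) (HComp K (Id2 K (PArr F h)) (PComp F g f)) =
        VComp K (PComp F (h \<cdot>\<^bsub>C\<^esub> g) f) (HComp K (PComp F h g) (Id2 K (PArr F f)))) \<and>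
     (\<forall>f \<in> Arr C.
        VComp K (PComp F f (Idn C (Dom C f)))
                (HComp K (Id2 K (PArr F f)) (PUnit F (Dom C f))) = Id2 K (PArr F f) \<and>
        VComp K (PComp F (Idn C (Cod C f)) f)
                (HComp K (PUnit F (Cod C f)) (Id2 K (PArr F f))) = Id2 K (PArr F f))"

text \<open>
  A pseudofunctor \<open>G\<close> from \<open>C'\<close> to \<open>K'\<close> lifts \<open>F\<close> when it commutes strictly with it along a
  functor from \<open>C'\<close> to the domain of \<open>F\<close> (with maps \<open>u0\<close>, \<open>u1\<close>) and a strict 2-functor from \<open>K'\<close>
  to the codomain of \<open>F\<close> (with maps \<open>v0\<close>, \<open>v1\<close>, \<open>v2\<close>): the two composite pseudofunctors have the
  same objects, 1-cells and structural 2-cells.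
\<close>

definition lifts ::
    "('bo, 'ba, 'o, 'm, 'c) pfunc \<Rightarrow>
     ('go, 'ga) cat \<Rightarrow> ('go \<Rightarrow> 'bo) \<Rightarrow> ('ga \<Rightarrow> 'ba) \<Rightarrow>
     ('o', 'm', 'c') twocat \<Rightarrow> ('o' \<Rightarrow> 'o) \<Rightarrow> ('m' \<Rightarrow> 'm) \<Rightarrow> ('c' \<Rightarrow> 'c) \<Rightarrow>
     ('go, 'ga, 'o', 'm', 'c') pfunc \<Rightarrow> bool" where
  "lifts F C' u0 u1 K' v0 v1 v2 G \<longleftrightarrow>
     pseudofunctor C' K' G \<and>
     (\<forall>A \<in> Obj C'. v0 (PObj G A) = PObj F (u0 A)) \<and>
     (\<forall>f \<in> Arr C'. v1 (PArr G f) = PArr F (u1 f)) \<and>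
     (\<forall>f \<in> Arr C'. \<forall>g \<in> Arr C'. Cod C' f = Dom C' g \<longrightarrow>
        v2 (PComp G g f) = PComp F (u1 g) (u1 f)) \<and>
     (\<forall>A \<in> Obj C'. v2 (PUnit G A) = PUnit F (u0 A))"


section \<open>The 2-categories of categories and of (symmetric) 2-groups\<close>

text \<open>
  2-cells record their source and target 1-cells, of type \<open>'f\<close>, which are functors or monoidal
  functors; \<open>u\<close> below extracts the underlying functor.
\<close>

record ('f, 'o, 'a) ntrans =
  Ndom :: 'f
  Ncod :: 'f
  Ncmp :: "'o \<Rightarrow> 'a"

definition id_nt :: "('f \<Rightarrow> ('o, 'a, 'o, 'a) func) \<Rightarrow> 'f \<Rightarrow> ('f, 'o, 'a) ntrans" where
  "id_nt u F = \<lparr>Ndom = F, Ncod = F,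
     Ncmp = (\<lambda>X \<in> Obj (Fdom (u F)). Idn (Fcod (u F)) (Fob (u F) X))\<rparr>"

definition vcomp_nt ::
    "('f \<Rightarrow> ('o, 'a, 'o, 'a) func) \<Rightarrow>
     ('f, 'o, 'a) ntrans \<Rightarrow> ('f, 'o, 'a) ntrans \<Rightarrow> ('f, 'o, 'a) ntrans" where
  "vcomp_nt u t s = \<lparr>Ndom = Ndom s, Ncod = Ncod t,
     Ncmp = (\<lambda>X \<in> Obj (Fdom (u (Ndom s))). Ncmp t X \<cdot>\<^bsub>Fcod (u (Ndom s))\<^esub> Ncmp s X)\<rparr>"

definition hcomp_nt ::
    "('f \<Rightarrow> ('o, 'a, 'o, 'a) func) \<Rightarrow> ('f \<Rightarrow> 'f \<Rightarrow> 'f) \<Rightarrow>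
     ('f, 'o, 'a) ntrans \<Rightarrow> ('f, 'o, 'a) ntrans \<Rightarrow> ('f, 'o, 'a) ntrans" where
  "hcomp_nt u c t s = \<lparr>Ndom = c (Ndom t) (Ndom s), Ncod = c (Ncod t) (Ncod s),
     Ncmp = (\<lambda>X \<in> Obj (Fdom (u (Ndom s))).
       Ncmp t (Fob (u (Ncod s)) X) \<cdot>\<^bsub>Fcod (u (Ndom t))\<^esub> Far (u (Ndom t)) (Ncmp s X))\<rparr>"

definition Cat2 ::
    "(('o, 'a) cat, ('o, 'a, 'o, 'a) func, (('o, 'a, 'o, 'a) func, 'o, 'a) ntrans) twocat" where
  "Cat2 = \<lparr>Cells0 = {C. category C}, Cells1 = {F. is_functor F},
     Cells2 = {t. is_natural (Ndom t) (Ncod t) (Ncmp t)},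
     Src1 = Fdom, Tgt1 = Fcod, Id1 = id_func, Comp1 = comp_func,
     Src2 = Ndom, Tgt2 = Ncod, Id2 = id_nt (\<lambda>F. F),
     VComp = vcomp_nt (\<lambda>F. F), HComp = hcomp_nt (\<lambda>F. F) comp_func\<rparr>"

record ('o, 'a) moncat =
  MCat :: "('o, 'a) cat"
  Tensor :: "('o \<times> 'o, 'a \<times> 'a, 'o, 'a) func"
  TUnit :: 'o
  Assoc :: "'o \<Rightarrow> 'o \<Rightarrow> 'o \<Rightarrow> 'a"
  Lunit :: "'o \<Rightarrow> 'a"
  Runit :: "'o \<Rightarrow> 'a"

record ('o, 'a) smoncat = "('o, 'a) moncat" +
  Braid :: "'o \<Rightarrow> 'o \<Rightarrow> 'a"

abbreviation tobj :: "('o, 'a, 'z) moncat_scheme \<Rightarrow> 'o \<Rightarrow> 'o \<Rightarrow> 'o" where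
  "tobj M X Y \<equiv> Fob (Tensor M) (X, Y)"

abbreviation tarr :: "('o, 'a, 'z) moncat_scheme \<Rightarrow> 'a \<Rightarrow> 'a \<Rightarrow> 'a" where
  "tarr M f g \<equiv> Far (Tensor M) (f, g)"

definition monoidal_category :: "('o, 'a, 'z) moncat_scheme \<Rightarrow> bool" where
  "monoidal_category M \<longleftrightarrow>
     (let C = MCat M; I = TUnit M; a = Assoc M; l = Lunit M; r = Runit M in
       category C \<and> is_functor (Tensor M) \<and>
       Fdom (Tensor M) = prod_cat C C \<and> Fcod (Tensor M) = C \<and> I \<in> Obj C \<and>
       (\<forall>X \<in> Obj C. \<forall>Y \<in> Obj C. \<forall>Z \<in> Obj C.
          a X Y Z \<in> hom C (tobj M (tobj M X Y) Z) (tobj M X (tobj M Y Z)) \<and> iso C (a X Y Z)) \<and>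
       (\<forall>X \<in> Obj C. l X \<in> hom C (tobj M I X) X \<and> iso C (l X)) \<and>
       (\<forall>X \<in> Obj C. r X \<in> hom C (tobj M X I) X \<and> iso C (r X)) \<and>
       (\<forall>f \<in> Arr C. \<forall>g \<in> Arr C. \<forall>h \<in> Arr C.
          a (Cod C f) (Cod C g) (Cod C h) \<cdot>\<^bsub>C\<^esub> tarr M (tarr M f g) h =
          tarr M f (tarr M g h) \<cdot>\<^bsub>C\<^esub> a (Dom C f) (Dom C g) (Dom C h)) \<and>
       (\<forall>f \<in> Arr C. l (Cod C f) \<cdot>\<^bsub>C\<^esub> tarr M (Idn C I) f = f \<cdot>\<^bsub>C\<^esub> l (Dom C f)) \<and>
       (\<forall>f \<in> Arr C. r (Cod C f) \<cdot>\<^bsub>C\<^esub> tarr M f (Idn C I) = f \<cdot>\<^bsub>C\<^esub> r (Dom C f)) \<and>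
       (\<forall>W \<in> Obj C. \<forall>X \<in> Obj C. \<forall>Y \<in> Obj C. \<forall>Z \<in> Obj C.
          a W X (tobj M Y Z) \<cdot>\<^bsub>C\<^esub> a (tobj M W X) Y Z =
          tarr M (Idn C W) (a X Y Z) \<cdot>\<^bsub>C\<^esub> (a W (tobj M X Y) Z \<cdot>\<^bsub>C\<^esub> tarr M (a W X Y) (Idn C Z))) \<and>
       (\<forall>X \<in> Obj C. \<forall>Y \<in> Obj C.
          tarr M (Idn C X) (l Y) \<cdot>\<^bsub>C\<^esub> a X I Y = tarr M (r X) (Idn C Y)))"

definition symmetric_monoidal_category :: "('o, 'a, 'z) smoncat_scheme \<Rightarrow> bool" where
  "symmetric_monoidal_category M \<longleftrightarrow>
     monoidal_category M \<and>
     (let C = MCat M; a = Assoc M; s = Braid M in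
       (\<forall>X \<in> Obj C. \<forall>Y \<in> Obj C. s X Y \<in> hom C (tobj M X Y) (tobj M Y X)) \<and>
       (\<forall>f \<in> Arr C. \<forall>g \<in> Arr C.
          s (Cod C f) (Cod C g) \<cdot>\<^bsub>C\<^esub> tarr M f g = tarr M g f \<cdot>\<^bsub>C\<^esub> s (Dom C f) (Dom C g)) \<and>
       (\<forall>X \<in> Obj C. \<forall>Y \<in> Obj C. s Y X \<cdot>\<^bsub>C\<^esub> s X Y = Idn C (tobj M X Y)) \<and>
       (\<forall>X \<in> Obj C. Lunit M X \<cdot>\<^bsub>C\<^esub> s X (TUnit M) = Runit M X) \<and>
       (\<forall>X \<in> Obj C. \<forall>Y \<in> Obj C. \<forall>Z \<in> Obj C.
          a Y Z X \<cdot>\<^bsub>C\<^esub> (s X (tobj M Y Z) \<cdot>\<^bsub>C\<^esub> a X Y Z) =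
          tarr M (Idn C Y) (s X Z) \<cdot>\<^bsub>C\<^esub> (a Y X Z \<cdot>\<^bsub>C\<^esub> tarr M (s X Y) (Idn C Z))))"

text \<open>
  Monoidal functors are strong: \<open>MPhi (X, Y)\<close> goes from the tensor of the images of \<open>X\<close> and \<open>Y\<close> to
  the image of the tensor, \<open>MPhi0\<close> from the unit to the image of the unit, and both are invertible.
\<close>

record ('o, 'a, 'z) monfunc =
  MDom :: "('o, 'a, 'z) moncat_scheme"
  MCod :: "('o, 'a, 'z) moncat_scheme"
  MFun :: "('o, 'a, 'o, 'a) func"
  MPhi :: "'o \<times> 'o \<Rightarrow> 'a"
  MPhi0 :: 'a

definition monoidal_functor :: "('o, 'a, 'z) monfunc \<Rightarrow> bool" where
  "monoidal_functor H \<longleftrightarrow>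
     (let M = MDom H; N = MCod H; C = MCat M; D = MCat N; F = MFun H; p = MPhi H; p0 = MPhi0 H in
       monoidal_category M \<and> monoidal_category N \<and>
       is_functor F \<and> Fdom F = C \<and> Fcod F = D \<and>
       p \<in> extensional (Obj C \<times> Obj C) \<and>
       (\<forall>X \<in> Obj C. \<forall>Y \<in> Obj C.
          p (X, Y) \<in> hom D (tobj N (Fob F X) (Fob F Y)) (Fob F (tobj M X Y)) \<and> iso D (p (X, Y))) \<and>
       (\<forall>f \<in> Arr C. \<forall>g \<in> Arr C.
          p (Cod C f, Cod C g) \<cdot>\<^bsub>D\<^esub> tarr N (Far F f) (Far F g) =
          Far F (tarr M f g) \<cdot>\<^bsub>D\<^esub> p (Dom C f, Dom C g)) \<and>
       p0 \<in> hom D (TUnit N) (Fob F (TUnit M)) \<and> iso D p0 \<and>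
       (\<forall>X \<in> Obj C. \<forall>Y \<in> Obj C. \<forall>Z \<in> Obj C.
          Far F (Assoc M X Y Z) \<cdot>\<^bsub>D\<^esub>
            (p (tobj M X Y, Z) \<cdot>\<^bsub>D\<^esub> tarr N (p (X, Y)) (Idn D (Fob F Z))) =
          p (X, tobj M Y Z) \<cdot>\<^bsub>D\<^esub>
            (tarr N (Idn D (Fob F X)) (p (Y, Z)) \<cdot>\<^bsub>D\<^esub> Assoc N (Fob F X) (Fob F Y) (Fob F Z))) \<and>
       (\<forall>X \<in> Obj C.
          Far F (Lunit M X) \<cdot>\<^bsub>D\<^esub> (p (TUnit M, X) \<cdot>\<^bsub>D\<^esub> tarr N p0 (Idn D (Fob F X))) =
          Lunit N (Fob F X)) \<and>
       (\<forall>X \<in> Obj C.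
          Far F (Runit M X) \<cdot>\<^bsub>D\<^esub> (p (X, TUnit M) \<cdot>\<^bsub>D\<^esub> tarr N (Idn D (Fob F X)) p0) =
          Runit N (Fob F X)))"

definition symmetric_monoidal_functor :: "('o, 'a, ('o, 'a, 'z) smoncat_ext) monfunc \<Rightarrow> bool" where
  "symmetric_monoidal_functor H \<longleftrightarrow>
     monoidal_functor H \<and>
     symmetric_monoidal_category (MDom H) \<and> symmetric_monoidal_category (MCod H) \<and>
     (\<forall>X \<in> Obj (MCat (MDom H)). \<forall>Y \<in> Obj (MCat (MDom H)).
        Far (MFun H) (Braid (MDom H) X Y) \<cdot>\<^bsub>MCat (MCod H)\<^esub> MPhi H (X, Y) =
        MPhi H (Y, X) \<cdot>\<^bsub>MCat (MCod H)\<^esub> Braid (MCod H) (Fob (MFun H) X) (Fob (MFun H) Y))"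

definition id_monfunc :: "('o, 'a, 'z) moncat_scheme \<Rightarrow> ('o, 'a, 'z) monfunc" where
  "id_monfunc M = \<lparr>MDom = M, MCod = M, MFun = id_func (MCat M),
     MPhi = (\<lambda>(X, Y) \<in> Obj (MCat M) \<times> Obj (MCat M). Idn (MCat M) (tobj M X Y)),
     MPhi0 = Idn (MCat M) (TUnit M)\<rparr>"

definition comp_monfunc ::
    "('o, 'a, 'z) monfunc \<Rightarrow> ('o, 'a, 'z) monfunc \<Rightarrow> ('o, 'a, 'z) monfunc" where
  "comp_monfunc K H = \<lparr>MDom = MDom H, MCod = MCod K, MFun = comp_func (MFun K) (MFun H),
     MPhi = (\<lambda>(X, Y) \<in> Obj (MCat (MDom H)) \<times> Obj (MCat (MDom H)).
       Far (MFun K) (MPhi H (X, Y)) \<cdot>\<^bsub>MCat (MCod K)\<^esub> MPhi K (Fob (MFun H) X, Fob (MFun H) Y)),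
     MPhi0 = Far (MFun K) (MPhi0 H) \<cdot>\<^bsub>MCat (MCod K)\<^esub> MPhi0 K\<rparr>"

definition monoidal_natural ::
    "('o, 'a, 'z) monfunc \<Rightarrow> ('o, 'a, 'z) monfunc \<Rightarrow> ('o \<Rightarrow> 'a) \<Rightarrow> bool" where
  "monoidal_natural H K t \<longleftrightarrow>
     MDom H = MDom K \<and> MCod H = MCod K \<and> is_natural (MFun H) (MFun K) t \<and>
     (let M = MDom H; N = MCod H; D = MCat N in
       (\<forall>X \<in> Obj (MCat M). \<forall>Y \<in> Obj (MCat M).
          t (tobj M X Y) \<cdot>\<^bsub>D\<^esub> MPhi H (X, Y) = MPhi K (X, Y) \<cdot>\<^bsub>D\<^esub> tarr N (t X) (t Y)) \<and>
       t (TUnit M) \<cdot>\<^bsub>D\<^esub> MPhi0 H = MPhi0 K)"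

definition two_group :: "('o, 'a, 'z) moncat_scheme \<Rightarrow> bool" where
  "two_group M \<longleftrightarrow>
     monoidal_category M \<and> groupoid (MCat M) \<and>
     (\<forall>X \<in> Obj (MCat M). \<exists>Y \<in> Obj (MCat M).
        isomorphic (MCat M) (tobj M X Y) (TUnit M) \<and>
        isomorphic (MCat M) (tobj M Y X) (TUnit M))"

definition symmetric_two_group :: "('o, 'a, 'z) smoncat_scheme \<Rightarrow> bool" where
  "symmetric_two_group M \<longleftrightarrow> symmetric_monoidal_category M \<and> two_group M"

text \<open>
  The 2-category of the monoidal categories satisfying \<open>S\<close>, the monoidal functors between them
  satisfying \<open>Q\<close>, and all monoidal natural transformations between these; it is used only with
  predicates that imply being a monoidal category and being a monoidal functor.
\<close>

definition mon2 ::
    "(('o, 'a, 'z) moncat_scheme \<Rightarrow> bool) \<Rightarrow> (('o, 'a, 'z) monfunc \<Rightarrow> bool) \<Rightarrow>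
     (('o, 'a, 'z) moncat_scheme, ('o, 'a, 'z) monfunc,
      (('o, 'a, 'z) monfunc, 'o, 'a) ntrans) twocat" where
  "mon2 S Q = \<lparr>Cells0 = {M. S M},
     Cells1 = {H. S (MDom H) \<and> S (MCod H) \<and> Q H},
     Cells2 = {t. S (MDom (Ndom t)) \<and> S (MCod (Ndom t)) \<and> Q (Ndom t) \<and> Q (Ncod t) \<and>
                  monoidal_natural (Ndom t) (Ncod t) (Ncmp t)},
     Src1 = MDom, Tgt1 = MCod, Id1 = id_monfunc, Comp1 = comp_monfunc,
     Src2 = Ndom, Tgt2 = Ncod, Id2 = id_nt MFun,
     VComp = vcomp_nt MFun, HComp = hcomp_nt MFun comp_monfunc\<rparr>"

definition TwoGp ::
    "(('o, 'a) moncat, ('o, 'a, unit) monfunc, (('o, 'a, unit) monfunc, 'o, 'a) ntrans) twocat" where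
  "TwoGp = mon2 two_group monoidal_functor"

definition SymTwoGp ::
    "(('o, 'a) smoncat, ('o, 'a, ('o, 'a, unit) smoncat_ext) monfunc,
      (('o, 'a, ('o, 'a, unit) smoncat_ext) monfunc, 'o, 'a) ntrans) twocat" where
  "SymTwoGp = mon2 symmetric_two_group symmetric_monoidal_functor"

definition forget_ntrans ::
    "(('o, 'a, 'z) monfunc, 'o, 'a) ntrans \<Rightarrow> (('o, 'a, 'o, 'a) func, 'o, 'a) ntrans" where
  "forget_ntrans t = \<lparr>Ndom = MFun (Ndom t), Ncod = MFun (Ncod t), Ncmp = Ncmp t\<rparr>"


section \<open>Finite products and internal groups\<close>

record ('o, 'a) prods =
  One :: 'o
  Prd :: "'o \<Rightarrow> 'o \<Rightarrow> 'o"
  Pr1 :: "'o \<Rightarrow> 'o \<Rightarrow> 'a"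
  Pr2 :: "'o \<Rightarrow> 'o \<Rightarrow> 'a"

definition finite_products :: "('o, 'a) cat \<Rightarrow> ('o, 'a) prods \<Rightarrow> bool" where
  "finite_products C S \<longleftrightarrow>
     category C \<and>
     One S \<in> Obj C \<and> (\<forall>A \<in> Obj C. \<exists>!f. f \<in> hom C A (One S)) \<and>
     (\<forall>A \<in> Obj C. \<forall>B \<in> Obj C.
        Prd S A B \<in> Obj C \<and> Pr1 S A B \<in> hom C (Prd S A B) A \<and> Pr2 S A B \<in> hom C (Prd S A B) B \<and>
        (\<forall>Z \<in> Obj C. \<forall>f \<in> hom C Z A. \<forall>g \<in> hom C Z B.
           \<exists>!h. h \<in> hom C Z (Prd S A B) \<and> Pr1 S A B \<cdot>\<^bsub>C\<^esub> h = f \<and> Pr2 S A B \<cdot>\<^bsub>C\<^esub> h = g))"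

definition bang :: "('o, 'a) cat \<Rightarrow> ('o, 'a) prods \<Rightarrow> 'o \<Rightarrow> 'a" where
  "bang C S A = (THE f. f \<in> hom C A (One S))"

definition pairing :: "('o, 'a) cat \<Rightarrow> ('o, 'a) prods \<Rightarrow> 'a \<Rightarrow> 'a \<Rightarrow> 'a" where
  "pairing C S f g = (THE h. h \<in> hom C (Dom C f) (Prd S (Cod C f) (Cod C g)) \<and>
     Pr1 S (Cod C f) (Cod C g) \<cdot>\<^bsub>C\<^esub> h = f \<and> Pr2 S (Cod C f) (Cod C g) \<cdot>\<^bsub>C\<^esub> h = g)"

definition prod_arr :: "('o, 'a) cat \<Rightarrow> ('o, 'a) prods \<Rightarrow> 'a \<Rightarrow> 'a \<Rightarrow> 'a" where
  "prod_arr C S f g = pairing C S (f \<cdot>\<^bsub>C\<^esub> Pr1 S (Dom C f) (Dom C g)) (g \<cdot>\<^bsub>C\<^esub> Pr2 S (Dom C f) (Dom C g))"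

definition prod_assoc :: "('o, 'a) cat \<Rightarrow> ('o, 'a) prods \<Rightarrow> 'o \<Rightarrow> 'o \<Rightarrow> 'o \<Rightarrow> 'a" where
  "prod_assoc C S X Y Z =
     pairing C S (Pr1 S X Y \<cdot>\<^bsub>C\<^esub> Pr1 S (Prd S X Y) Z)
       (pairing C S (Pr2 S X Y \<cdot>\<^bsub>C\<^esub> Pr1 S (Prd S X Y) Z) (Pr2 S (Prd S X Y) Z))"

definition prod_swap :: "('o, 'a) cat \<Rightarrow> ('o, 'a) prods \<Rightarrow> 'o \<Rightarrow> 'o \<Rightarrow> 'a" where
  "prod_swap C S X Y = pairing C S (Pr2 S X Y) (Pr1 S X Y)"

record ('o, 'a) igroup =
  Carr :: 'o
  Mul :: 'a
  Neu :: 'a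
  Inv :: 'a

definition internal_group :: "('o, 'a) cat \<Rightarrow> ('o, 'a) prods \<Rightarrow> ('o, 'a) igroup \<Rightarrow> bool" where
  "internal_group C S G \<longleftrightarrow>
     (let A = Carr G; m = Mul G; e = Neu G; i = Inv G; one = Idn C A in
       A \<in> Obj C \<and> m \<in> hom C (Prd S A A) A \<and> e \<in> hom C (One S) A \<and> i \<in> hom C A A \<and>
       m \<cdot>\<^bsub>C\<^esub> prod_arr C S m one = m \<cdot>\<^bsub>C\<^esub> (prod_arr C S one m \<cdot>\<^bsub>C\<^esub> prod_assoc C S A A A) \<and>
       m \<cdot>\<^bsub>C\<^esub> prod_arr C S e one = Pr2 S (One S) A \<and>
       m \<cdot>\<^bsub>C\<^esub> prod_arr C S one e = Pr1 S A (One S) \<and>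
       m \<cdot>\<^bsub>C\<^esub> pairing C S i one = e \<cdot>\<^bsub>C\<^esub> bang C S A \<and>
       m \<cdot>\<^bsub>C\<^esub> pairing C S one i = e \<cdot>\<^bsub>C\<^esub> bang C S A)"

definition internal_abelian_group ::
    "('o, 'a) cat \<Rightarrow> ('o, 'a) prods \<Rightarrow> ('o, 'a) igroup \<Rightarrow> bool" where
  "internal_abelian_group C S G \<longleftrightarrow>
     internal_group C S G \<and> Mul G \<cdot>\<^bsub>C\<^esub> prod_swap C S (Carr G) (Carr G) = Mul G"

record ('o, 'a) ghom =
  Gdom :: "('o, 'a) igroup"
  Gcod :: "('o, 'a) igroup"
  Gmap :: 'a

definition internal_group_hom :: "('o, 'a) cat \<Rightarrow> ('o, 'a) prods \<Rightarrow> ('o, 'a) ghom \<Rightarrow> bool" where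
  "internal_group_hom C S h \<longleftrightarrow>
     internal_group C S (Gdom h) \<and> internal_group C S (Gcod h) \<and>
     Gmap h \<in> hom C (Carr (Gdom h)) (Carr (Gcod h)) \<and>
     Gmap h \<cdot>\<^bsub>C\<^esub> Mul (Gdom h) = Mul (Gcod h) \<cdot>\<^bsub>C\<^esub> prod_arr C S (Gmap h) (Gmap h) \<and>
     Gmap h \<cdot>\<^bsub>C\<^esub> Neu (Gdom h) = Neu (Gcod h)"

definition Gp :: "('o, 'a) cat \<Rightarrow> ('o, 'a) prods \<Rightarrow> (('o, 'a) igroup, ('o, 'a) ghom) cat" where
  "Gp C S = \<lparr>Obj = {G. internal_group C S G}, Arr = {h. internal_group_hom C S h},
     Dom = Gdom, Cod = Gcod,
     Idn = (\<lambda>G. \<lparr>Gdom = G, Gcod = G, Gmap = Idn C (Carr G)\<rparr>),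
     Cmp = (\<lambda>k h. \<lparr>Gdom = Gdom h, Gcod = Gcod k, Gmap = Gmap k \<cdot>\<^bsub>C\<^esub> Gmap h\<rparr>)\<rparr>"

definition Ab :: "('o, 'a) cat \<Rightarrow> ('o, 'a) prods \<Rightarrow> (('o, 'a) igroup, ('o, 'a) ghom) cat" where
  "Ab C S = (Gp C S)\<lparr>Obj := {G. internal_abelian_group C S G},
     Arr := {h. internal_group_hom C S h \<and> internal_abelian_group C S (Gdom h) \<and>
                internal_abelian_group C S (Gcod h)}\<rparr>"


section \<open>Cartesian monoidal opfibrations\<close>

text \<open>
  A functor \<open>Proj\<close> together with a cleavage (\<open>Lift f X\<close> is the chosen cocartesian lifting of \<open>f\<close>
  starting at \<open>X\<close>) and chosen finite products in its source and its target.
\<close>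

record ('xo, 'xa, 'bo, 'ba) opfib =
  Proj :: "('xo, 'xa, 'bo, 'ba) func"
  Lift :: "'ba \<Rightarrow> 'xo \<Rightarrow> 'xa"
  TProd :: "('xo, 'xa) prods"
  BProd :: "('bo, 'ba) prods"

abbreviation Tot :: "('xo, 'xa, 'bo, 'ba) opfib \<Rightarrow> ('xo, 'xa) cat" where
  "Tot E \<equiv> Fdom (Proj E)"

abbreviation Bas :: "('xo, 'xa, 'bo, 'ba) opfib \<Rightarrow> ('bo, 'ba) cat" where
  "Bas E \<equiv> Fcod (Proj E)"

definition cocartesian :: "('xo, 'xa, 'bo, 'ba) func \<Rightarrow> 'xa \<Rightarrow> bool" where
  "cocartesian P \<phi> \<longleftrightarrow>
     \<phi> \<in> Arr (Fdom P) \<and>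
     (\<forall>\<psi> \<in> Arr (Fdom P). \<forall>h \<in> Arr (Fcod P).
        Dom (Fdom P) \<psi> = Dom (Fdom P) \<phi> \<longrightarrow>
        Dom (Fcod P) h = Fob P (Cod (Fdom P) \<phi>) \<longrightarrow>
        Cod (Fcod P) h = Fob P (Cod (Fdom P) \<psi>) \<longrightarrow>
        h \<cdot>\<^bsub>Fcod P\<^esub> Far P \<phi> = Far P \<psi> \<longrightarrow>
        (\<exists>!\<chi>. \<chi> \<in> hom (Fdom P) (Cod (Fdom P) \<phi>) (Cod (Fdom P) \<psi>) \<and>
               Far P \<chi> = h \<and> \<chi> \<cdot>\<^bsub>Fdom P\<^esub> \<phi> = \<psi>))"

definition cloven_opfibration :: "('xo, 'xa, 'bo, 'ba) opfib \<Rightarrow> bool" where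
  "cloven_opfibration E \<longleftrightarrow>
     is_functor (Proj E) \<and>
     (\<forall>f \<in> Arr (Bas E). \<forall>X \<in> Obj (Tot E). Fob (Proj E) X = Dom (Bas E) f \<longrightarrow>
        cocartesian (Proj E) (Lift E f X) \<and> Dom (Tot E) (Lift E f X) = X \<and>
        Far (Proj E) (Lift E f X) = f)"

definition cartesian_monoidal_opfibration :: "('xo, 'xa, 'bo, 'ba) opfib \<Rightarrow> bool" where
  "cartesian_monoidal_opfibration E \<longleftrightarrow>
     cloven_opfibration E \<and>
     finite_products (Tot E) (TProd E) \<and> finite_products (Bas E) (BProd E) \<and>
     Fob (Proj E) (One (TProd E)) = One (BProd E) \<and>
     (\<forall>X \<in> Obj (Tot E). \<forall>Y \<in> Obj (Tot E).
        Fob (Proj E) (Prd (TProd E) X Y) = Prd (BProd E) (Fob (Proj E) X) (Fob (Proj E) Y) \<and>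
        Far (Proj E) (Pr1 (TProd E) X Y) = Pr1 (BProd E) (Fob (Proj E) X) (Fob (Proj E) Y) \<and>
        Far (Proj E) (Pr2 (TProd E) X Y) = Pr2 (BProd E) (Fob (Proj E) X) (Fob (Proj E) Y)) \<and>
     (\<forall>\<phi> \<psi>. cocartesian (Proj E) \<phi> \<longrightarrow> cocartesian (Proj E) \<psi> \<longrightarrow>
        cocartesian (Proj E) (prod_arr (Tot E) (TProd E) \<phi> \<psi>))"

definition fibre :: "('xo, 'xa, 'bo, 'ba) opfib \<Rightarrow> 'bo \<Rightarrow> ('xo, 'xa) cat" where
  "fibre E A = (Tot E)\<lparr>Obj := {X \<in> Obj (Tot E). Fob (Proj E) X = A},
     Arr := {x \<in> Arr (Tot E). Far (Proj E) x = Idn (Bas E) A}\<rparr>"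


section \<open>The associated pseudofunctor and its lax monoidal structure\<close>

text \<open>
  For \<open>\<phi>\<close> cocartesian and \<open>\<psi>\<close> an arrow with the same domain and the same image in the base,
  the unique arrow over an identity through which \<open>\<psi>\<close> factors along \<open>\<phi>\<close>.
\<close>

definition vfact :: "('xo, 'xa, 'bo, 'ba) opfib \<Rightarrow> 'xa \<Rightarrow> 'xa \<Rightarrow> 'xa" where
  "vfact E \<phi> \<psi> = (THE \<chi>. \<chi> \<in> hom (Tot E) (Cod (Tot E) \<phi>) (Cod (Tot E) \<psi>) \<and>
     Far (Proj E) \<chi> = Idn (Bas E) (Fob (Proj E) (Cod (Tot E) \<phi>)) \<and> \<chi> \<cdot>\<^bsub>Tot E\<^esub> \<phi> = \<psi>)"

definition push :: "('xo, 'xa, 'bo, 'ba) opfib \<Rightarrow> 'ba \<Rightarrow> ('xo, 'xa, 'xo, 'xa) func" where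
  "push E f = \<lparr>Fdom = fibre E (Dom (Bas E) f), Fcod = fibre E (Cod (Bas E) f),
     Fob = (\<lambda>X \<in> Obj (fibre E (Dom (Bas E) f)). Cod (Tot E) (Lift E f X)),
     Far = (\<lambda>x \<in> Arr (fibre E (Dom (Bas E) f)).
       vfact E (Lift E f (Dom (Tot E) x)) (Lift E f (Cod (Tot E) x) \<cdot>\<^bsub>Tot E\<^esub> x))\<rparr>"

definition push_comp :: "('xo, 'xa, 'bo, 'ba) opfib \<Rightarrow> 'ba \<Rightarrow> 'ba \<Rightarrow> 'xo \<Rightarrow> 'xa" where
  "push_comp E g f = (\<lambda>X \<in> Obj (fibre E (Dom (Bas E) f)).
     vfact E (Lift E g (Fob (push E f) X) \<cdot>\<^bsub>Tot E\<^esub> Lift E f X) (Lift E (g \<cdot>\<^bsub>Bas E\<^esub> f) X))"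

definition push_unit :: "('xo, 'xa, 'bo, 'ba) opfib \<Rightarrow> 'bo \<Rightarrow> 'xo \<Rightarrow> 'xa" where
  "push_unit E A = (\<lambda>X \<in> Obj (fibre E A). Lift E (Idn (Bas E) A) X)"

definition assoc_pseudofunctor ::
    "('xo, 'xa, 'bo, 'ba) opfib \<Rightarrow>
     ('bo, 'ba, ('xo, 'xa) cat, ('xo, 'xa, 'xo, 'xa) func,
      (('xo, 'xa, 'xo, 'xa) func, 'xo, 'xa) ntrans) pfunc" where
  "assoc_pseudofunctor E = \<lparr>PObj = fibre E, PArr = push E,
     PComp = (\<lambda>g f. \<lparr>Ndom = comp_func (push E g) (push E f), Ncod = push E (g \<cdot>\<^bsub>Bas E\<^esub> f),
                     Ncmp = push_comp E g f\<rparr>),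
     PUnit = (\<lambda>A. \<lparr>Ndom = id_func (fibre E A), Ncod = push E (Idn (Bas E) A),
                   Ncmp = push_unit E A\<rparr>)\<rparr>"

definition lax_R :: "('xo, 'xa, 'bo, 'ba) opfib \<Rightarrow> 'bo \<Rightarrow> 'bo \<Rightarrow>
    ('xo \<times> 'xo, 'xa \<times> 'xa, 'xo, 'xa) func" where
  "lax_R E A B = \<lparr>Fdom = prod_cat (fibre E A) (fibre E B), Fcod = fibre E (Prd (BProd E) A B),
     Fob = (\<lambda>(X, Y) \<in> Obj (fibre E A) \<times> Obj (fibre E B). Prd (TProd E) X Y),
     Far = (\<lambda>(x, y) \<in> Arr (fibre E A) \<times> Arr (fibre E B). prod_arr (Tot E) (TProd E) x y)\<rparr>"

definition lax_R1 :: "('xo, 'xa, 'bo, 'ba) opfib \<Rightarrow> (unit, unit, 'xo, 'xa) func" where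
  "lax_R1 E = \<lparr>Fdom = terminal_cat, Fcod = fibre E (One (BProd E)),
     Fob = (\<lambda>_. One (TProd E)), Far = (\<lambda>_. Idn (Tot E) (One (TProd E)))\<rparr>"

text \<open>
  The monoidal structure on the fibre over (the carrier of) an internal group \<open>G\<close>.  The arrow
  \<open>fib_c E G X Y\<close> from the product of \<open>X\<close> and \<open>Y\<close> to their tensor, and \<open>fib_u E G\<close> from the
  terminal object to the unit, are cocartesian over the multiplication and the neutral element.
  The constraints are induced from the associativity, unit and symmetry isomorphisms
  of the products in the total category: each is the unique vertical arrow that is compatible with
  these cocartesian arrows.
\<close>

definition fib_tensor :: "('xo, 'xa, 'bo, 'ba) opfib \<Rightarrow> ('bo, 'ba) igroup \<Rightarrow>
    ('xo \<times> 'xo, 'xa \<times> 'xa, 'xo, 'xa) func" where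
  "fib_tensor E G = comp_func (push E (Mul G)) (lax_R E (Carr G) (Carr G))"

definition fib_unit :: "('xo, 'xa, 'bo, 'ba) opfib \<Rightarrow> ('bo, 'ba) igroup \<Rightarrow> 'xo" where
  "fib_unit E G = Fob (comp_func (push E (Neu G)) (lax_R1 E)) ()"

definition fib_c :: "('xo, 'xa, 'bo, 'ba) opfib \<Rightarrow> ('bo, 'ba) igroup \<Rightarrow> 'xo \<Rightarrow> 'xo \<Rightarrow> 'xa" where
  "fib_c E G X Y = Lift E (Mul G) (Prd (TProd E) X Y)"

definition fib_u :: "('xo, 'xa, 'bo, 'ba) opfib \<Rightarrow> ('bo, 'ba) igroup \<Rightarrow> 'xa" where
  "fib_u E G = Lift E (Neu G) (One (TProd E))"

definition fib_assoc ::
    "('xo, 'xa, 'bo, 'ba) opfib \<Rightarrow> ('bo, 'ba) igroup \<Rightarrow> 'xo \<Rightarrow> 'xo \<Rightarrow> 'xo \<Rightarrow> 'xa" where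
  "fib_assoc E G X Y Z =
     (let T = Tot E; S = TProd E; ten = (\<lambda>U V. Fob (fib_tensor E G) (U, V)) in
       vfact E (fib_c E G (ten X Y) Z \<cdot>\<^bsub>T\<^esub> prod_arr T S (fib_c E G X Y) (Idn T Z))
         ((fib_c E G X (ten Y Z) \<cdot>\<^bsub>T\<^esub> prod_arr T S (Idn T X) (fib_c E G Y Z)) \<cdot>\<^bsub>T\<^esub>
            prod_assoc T S X Y Z))"

definition fib_lunit :: "('xo, 'xa, 'bo, 'ba) opfib \<Rightarrow> ('bo, 'ba) igroup \<Rightarrow> 'xo \<Rightarrow> 'xa" where
  "fib_lunit E G X =
     vfact E (fib_c E G (fib_unit E G) X \<cdot>\<^bsub>Tot E\<^esub>
                prod_arr (Tot E) (TProd E) (fib_u E G) (Idn (Tot E) X))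
       (Pr2 (TProd E) (One (TProd E)) X)"

definition fib_runit :: "('xo, 'xa, 'bo, 'ba) opfib \<Rightarrow> ('bo, 'ba) igroup \<Rightarrow> 'xo \<Rightarrow> 'xa" where
  "fib_runit E G X =
     vfact E (fib_c E G X (fib_unit E G) \<cdot>\<^bsub>Tot E\<^esub>
                prod_arr (Tot E) (TProd E) (Idn (Tot E) X) (fib_u E G))
       (Pr1 (TProd E) X (One (TProd E)))"

definition fib_braid :: "('xo, 'xa, 'bo, 'ba) opfib \<Rightarrow> ('bo, 'ba) igroup \<Rightarrow> 'xo \<Rightarrow> 'xo \<Rightarrow> 'xa" where
  "fib_braid E G X Y =
     vfact E (fib_c E G X Y) (fib_c E G Y X \<cdot>\<^bsub>Tot E\<^esub> prod_swap (Tot E) (TProd E) X Y)"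

definition fib_moncat ::
    "('xo, 'xa, 'bo, 'ba) opfib \<Rightarrow> ('bo, 'ba) igroup \<Rightarrow> ('xo, 'xa) moncat" where
  "fib_moncat E G = \<lparr>MCat = fibre E (Carr G), Tensor = fib_tensor E G, TUnit = fib_unit E G,
     Assoc = fib_assoc E G, Lunit = fib_lunit E G, Runit = fib_runit E G\<rparr>"

definition fib_smoncat ::
    "('xo, 'xa, 'bo, 'ba) opfib \<Rightarrow> ('bo, 'ba) igroup \<Rightarrow> ('xo, 'xa) smoncat" where
  "fib_smoncat E G = \<lparr>MCat = fibre E (Carr G), Tensor = fib_tensor E G, TUnit = fib_unit E G,
     Assoc = fib_assoc E G, Lunit = fib_lunit E G, Runit = fib_runit E G, Braid = fib_braid E G\<rparr>"

text \<open>
  The monoidal structure on change of base along a group morphism, for a choice \<open>M\<close> of one of the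
  two structures above on the fibres, and the resulting data of a pseudofunctor.
\<close>

definition fib_phi :: "('xo, 'xa, 'bo, 'ba) opfib \<Rightarrow> ('bo, 'ba) ghom \<Rightarrow> 'xo \<times> 'xo \<Rightarrow> 'xa" where
  "fib_phi E h = (\<lambda>(X, Y) \<in> Obj (fibre E (Carr (Gdom h))) \<times> Obj (fibre E (Carr (Gdom h))).
     vfact E
       (fib_c E (Gcod h) (Fob (push E (Gmap h)) X) (Fob (push E (Gmap h)) Y) \<cdot>\<^bsub>Tot E\<^esub>
          prod_arr (Tot E) (TProd E) (Lift E (Gmap h) X) (Lift E (Gmap h) Y))
       (Lift E (Gmap h) (Fob (fib_tensor E (Gdom h)) (X, Y)) \<cdot>\<^bsub>Tot E\<^esub> fib_c E (Gdom h) X Y))"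

definition fib_phi0 :: "('xo, 'xa, 'bo, 'ba) opfib \<Rightarrow> ('bo, 'ba) ghom \<Rightarrow> 'xa" where
  "fib_phi0 E h =
     vfact E (fib_u E (Gcod h))
       (Lift E (Gmap h) (fib_unit E (Gdom h)) \<cdot>\<^bsub>Tot E\<^esub> fib_u E (Gdom h))"

definition fib_monfunc ::
    "('xo, 'xa, 'bo, 'ba) opfib \<Rightarrow> (('bo, 'ba) igroup \<Rightarrow> ('xo, 'xa, 'z) moncat_scheme) \<Rightarrow>
     ('bo, 'ba) ghom \<Rightarrow> ('xo, 'xa, 'z) monfunc" where
  "fib_monfunc E M h = \<lparr>MDom = M (Gdom h), MCod = M (Gcod h), MFun = push E (Gmap h),
     MPhi = fib_phi E h, MPhi0 = fib_phi0 E h\<rparr>"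

definition lifted_pseudofunctor ::
    "('xo, 'xa, 'bo, 'ba) opfib \<Rightarrow> (('bo, 'ba) igroup \<Rightarrow> ('xo, 'xa, 'z) moncat_scheme) \<Rightarrow>
     (('bo, 'ba) igroup, ('bo, 'ba) ghom, ('xo, 'xa, 'z) moncat_scheme, ('xo, 'xa, 'z) monfunc,
      (('xo, 'xa, 'z) monfunc, 'xo, 'xa) ntrans) pfunc" where
  "lifted_pseudofunctor E M = \<lparr>PObj = M, PArr = fib_monfunc E M,
     PComp = (\<lambda>k h. \<lparr>Ndom = comp_monfunc (fib_monfunc E M k) (fib_monfunc E M h),
                     Ncod = fib_monfunc E M (k \<cdot>\<^bsub>Gp (Bas E) (BProd E)\<^esub> h),
                     Ncmp = push_comp E (Gmap k) (Gmap h)\<rparr>),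
     PUnit = (\<lambda>G. \<lparr>Ndom = id_monfunc (M G),
                   Ncod = fib_monfunc E M (Idn (Gp (Bas E) (BProd E)) G),
                   Ncmp = push_unit E (Carr G)\<rparr>)\<rparr>"

end

(*
  When the fibres are groupoids, every arrow of the total category is cocartesian: it factors as a
  chosen lifting followed by a vertical isomorphism.  Hence two vertical arrows agree as soon as
  they agree after precomposition with one single arrow.  All coherence laws are therefore checked on
  generalized elements: writing f x for the composite of x : W -> X with the lifting of f at X, and
  x * y = m <x, y>, the structure maps send (x * y) * z to x * (y * z), e * x to x, and h x * h y to
  h (x * y).  A weak inverse of X is its image under the inversion i, because x * i x and the unit are
  both codomains of arrows out of X over the same arrow of the base, so they are connected by a
  vertical arrow, which is invertible.
*)

theory Submission
  imports Defs
begin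

section \<open>Categories, functors and monoidal functors\<close>

text \<open>The group laws act only in the base. Associativity, the unit laws, commutativity and
  compatibility with a homomorphism each say that two arrows of the total category with a common
  domain lie over the same base arrow, and then \<open>vfact\<close> supplies the constraint. Once a
  constraint exists, its coherence uses no further law of the group, and it is invertible because it
  lies in a fibre.

  Every structure map gets one rule giving its value on an element. Composites are nested to the
  right with the test element innermost, so simp evaluates both sides of a coherence law from the
  inside outwards until they become the same term. Finite products in the total category provide
  elements of several objects at once over a common domain \<open>W\<close>.

  The target 2-categories are strict, so unit and associativity laws of 1-cells have to hold as
  equations of records; this is why every map is extensional on its carrier. They are built once,
  for predicates \<open>S\<close> and \<open>Q\<close> closed under identities and composition, and
  the lifting argument likewise treats both pairs of source and target together.\<close>

lemma hom_iff [simp]: "f \<in> hom C A B \<longleftrightarrow> f \<in> Arr C \<and> Dom C f = A \<and> Cod C f = B"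
  by (auto simp: hom_def)

lemma category_simps [simp]:
  assumes "category C"
  shows "f \<in> Arr C \<Longrightarrow> Dom C f \<in> Obj C"
    and "f \<in> Arr C \<Longrightarrow> Cod C f \<in> Obj C"
    and "A \<in> Obj C \<Longrightarrow> Idn C A \<in> Arr C"
    and "A \<in> Obj C \<Longrightarrow> Dom C (Idn C A) = A"
    and "A \<in> Obj C \<Longrightarrow> Cod C (Idn C A) = A"
    and "\<lbrakk>f \<in> Arr C; g \<in> Arr C; Cod C f = Dom C g\<rbrakk> \<Longrightarrow> g \<cdot>\<^bsub>C\<^esub> f \<in> Arr C"
    and "\<lbrakk>f \<in> Arr C; g \<in> Arr C; Cod C f = Dom C g\<rbrakk> \<Longrightarrow> Dom C (g \<cdot>\<^bsub>C\<^esub> f) = Dom C f"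
    and "\<lbrakk>f \<in> Arr C; g \<in> Arr C; Cod C f = Dom C g\<rbrakk> \<Longrightarrow> Cod C (g \<cdot>\<^bsub>C\<^esub> f) = Cod C g"
    and "\<lbrakk>f \<in> Arr C; Dom C f = A\<rbrakk> \<Longrightarrow> f \<cdot>\<^bsub>C\<^esub> Idn C A = f"
    and "\<lbrakk>f \<in> Arr C; Cod C f = A\<rbrakk> \<Longrightarrow> Idn C A \<cdot>\<^bsub>C\<^esub> f = f"
    and "\<lbrakk>f \<in> Arr C; g \<in> Arr C; h \<in> Arr C; Cod C f = Dom C g; Cod C g = Dom C h\<rbrakk> \<Longrightarrow>
      (h \<cdot>\<^bsub>C\<^esub> g) \<cdot>\<^bsub>C\<^esub> f = h \<cdot>\<^bsub>C\<^esub> (g \<cdot>\<^bsub>C\<^esub> f)"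
  using assms by (auto simp: category_def)

lemma categoryI:
  assumes "\<And>f. f \<in> Arr C \<Longrightarrow> Dom C f \<in> Obj C \<and> Cod C f \<in> Obj C"
    and "\<And>A. A \<in> Obj C \<Longrightarrow> Idn C A \<in> Arr C \<and> Dom C (Idn C A) = A \<and> Cod C (Idn C A) = A"
    and "\<And>f g. \<lbrakk>f \<in> Arr C; g \<in> Arr C; Cod C f = Dom C g\<rbrakk> \<Longrightarrow>
      g \<cdot>\<^bsub>C\<^esub> f \<in> Arr C \<and> Dom C (g \<cdot>\<^bsub>C\<^esub> f) = Dom C f \<and> Cod C (g \<cdot>\<^bsub>C\<^esub> f) = Cod C g"
    and "\<And>f. f \<in> Arr C \<Longrightarrow> f \<cdot>\<^bsub>C\<^esub> Idn C (Dom C f) = f \<and> Idn C (Cod C f) \<cdot>\<^bsub>C\<^esub> f = f"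
    and "\<And>f g h. \<lbrakk>f \<in> Arr C; g \<in> Arr C; h \<in> Arr C; Cod C f = Dom C g; Cod C g = Dom C h\<rbrakk> \<Longrightarrow>
      h \<cdot>\<^bsub>C\<^esub> (g \<cdot>\<^bsub>C\<^esub> f) = (h \<cdot>\<^bsub>C\<^esub> g) \<cdot>\<^bsub>C\<^esub> f"
  shows "category C"
  unfolding category_def hom_iff using assms by blast

text \<open>Composites are normalized by simp to right-nested form, where \<open>h\<close> and
  \<open>g\<close> need not form a subterm of their own. This makes an equation for a binary
  composite usable at the head of a longer one.\<close>

lemma comp_prefix:
  assumes "category C" "f \<in> Arr C" "g \<in> Arr C" "h \<in> Arr C"
    and "Cod C f = Dom C g" "Cod C g = Dom C h" "h \<cdot>\<^bsub>C\<^esub> g = k"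
  shows "h \<cdot>\<^bsub>C\<^esub> (g \<cdot>\<^bsub>C\<^esub> f) = k \<cdot>\<^bsub>C\<^esub> f"
  using assms category_simps(11)[of C f g h] by simp

lemma prod_cat_sel [simp]:
  "Obj (prod_cat C D) = Obj C \<times> Obj D"
  "Arr (prod_cat C D) = Arr C \<times> Arr D"
  "Dom (prod_cat C D) (f, g) = (Dom C f, Dom D g)"
  "Cod (prod_cat C D) (f, g) = (Cod C f, Cod D g)"
  "Idn (prod_cat C D) (A, B) = (Idn C A, Idn D B)"
  "(f', g') \<cdot>\<^bsub>prod_cat C D\<^esub> (f, g) = (f' \<cdot>\<^bsub>C\<^esub> f, g' \<cdot>\<^bsub>D\<^esub> g)"
  by (auto simp: prod_cat_def)

lemma category_prod_cat [simp]:
  assumes "category C" "category D"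
  shows "category (prod_cat C D)"
  by (rule categoryI) (use assms in auto)

section \<open>Functors\<close>

lemma functor_simps [simp]:
  assumes "is_functor F"
  shows "category (Fdom F)"
    and "category (Fcod F)"
    and "Fdom F = C \<Longrightarrow> Fob F \<in> extensional (Obj C)"
    and "Fdom F = C \<Longrightarrow> Far F \<in> extensional (Arr C)"
    and "\<lbrakk>Fcod F = D; A \<in> Obj (Fdom F)\<rbrakk> \<Longrightarrow> Fob F A \<in> Obj D"
    and "\<lbrakk>Fcod F = D; f \<in> Arr (Fdom F)\<rbrakk> \<Longrightarrow> Far F f \<in> Arr D"
    and "\<lbrakk>Fcod F = D; f \<in> Arr (Fdom F)\<rbrakk> \<Longrightarrow> Dom D (Far F f) = Fob F (Dom (Fdom F) f)"
    and "\<lbrakk>Fcod F = D; f \<in> Arr (Fdom F)\<rbrakk> \<Longrightarrow> Cod D (Far F f) = Fob F (Cod (Fdom F) f)"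
    and "\<lbrakk>Fdom F = C; A \<in> Obj C\<rbrakk> \<Longrightarrow> Far F (Idn C A) = Idn (Fcod F) (Fob F A)"
    and "\<lbrakk>Fdom F = C; f \<in> Arr C; g \<in> Arr C; Cod C f = Dom C g\<rbrakk> \<Longrightarrow>
      Far F (g \<cdot>\<^bsub>C\<^esub> f) = Far F g \<cdot>\<^bsub>Fcod F\<^esub> Far F f"
  using assms by (auto simp: is_functor_def)

lemma functorI:
  assumes "category (Fdom F)" "category (Fcod F)"
    and "Fob F \<in> extensional (Obj (Fdom F))" "Far F \<in> extensional (Arr (Fdom F))"
    and "\<And>A. A \<in> Obj (Fdom F) \<Longrightarrow> Fob F A \<in> Obj (Fcod F)"
    and "\<And>f. f \<in> Arr (Fdom F) \<Longrightarrow> Far F f \<in> Arr (Fcod F) \<and>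
       Dom (Fcod F) (Far F f) = Fob F (Dom (Fdom F) f) \<and>
       Cod (Fcod F) (Far F f) = Fob F (Cod (Fdom F) f)"
    and "\<And>A. A \<in> Obj (Fdom F) \<Longrightarrow> Far F (Idn (Fdom F) A) = Idn (Fcod F) (Fob F A)"
    and "\<And>f g. \<lbrakk>f \<in> Arr (Fdom F); g \<in> Arr (Fdom F); Cod (Fdom F) f = Dom (Fdom F) g\<rbrakk> \<Longrightarrow>
      Far F (g \<cdot>\<^bsub>Fdom F\<^esub> f) = Far F g \<cdot>\<^bsub>Fcod F\<^esub> Far F f"
  shows "is_functor F"
  unfolding is_functor_def hom_iff using assms by blast

lemma id_func_sel [simp]:
  "Fdom (id_func C) = C" "Fcod (id_func C) = C"
  "A \<in> Obj C \<Longrightarrow> Fob (id_func C) A = A" "f \<in> Arr C \<Longrightarrow> Far (id_func C) f = f"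
  by (auto simp: id_func_def)

lemma comp_func_sel [simp]:
  "Fdom (comp_func G F) = Fdom F" "Fcod (comp_func G F) = Fcod G"
  "A \<in> Obj (Fdom F) \<Longrightarrow> Fob (comp_func G F) A = Fob G (Fob F A)"
  "f \<in> Arr (Fdom F) \<Longrightarrow> Far (comp_func G F) f = Far G (Far F f)"
  by (auto simp: comp_func_def)

lemma functor_id [simp]: "category C \<Longrightarrow> is_functor (id_func C)"
  by (rule functorI) (auto simp: id_func_def)

lemma functor_comp [simp]:
  assumes "is_functor F" "is_functor G" "Fcod F = Fdom G"
  shows "is_functor (comp_func G F)"
  by (rule functorI) (use assms in \<open>auto simp: comp_func_def restrict_def extensional_def\<close>)

text \<open>Extensionality fixes the values outside the carriers, so agreement on objects and arrows
  is equality of records. The strict laws for composition of functors rest on this.\<close>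

lemma func_eqI:
  fixes F G :: "('o, 'a, 'p, 'b) func"
  assumes "is_functor F" "is_functor G" "Fdom F = Fdom G" "Fcod F = Fcod G"
    and "\<And>A. A \<in> Obj (Fdom F) \<Longrightarrow> Fob F A = Fob G A"
    and "\<And>f. f \<in> Arr (Fdom F) \<Longrightarrow> Far F f = Far G f"
  shows "F = G"
proof -
  have "Fob F = Fob G" "Far F = Far G"
    using assms by (auto intro!: extensionalityI[of _ "Obj (Fdom F)"]
        extensionalityI[of _ "Arr (Fdom F)"])
  then show ?thesis using assms(3,4) by (cases F; cases G) simp
qed

lemma comp_func_id [simp]:
  "is_functor F \<Longrightarrow> Fdom F = C \<Longrightarrow> comp_func F (id_func C) = F"
  "is_functor F \<Longrightarrow> Fcod F = C \<Longrightarrow> comp_func (id_func C) F = F"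
  by (auto intro!: func_eqI)

lemma comp_func_assoc:
  assumes "is_functor F" "is_functor G" "is_functor H" "Fcod F = Fdom G" "Fcod G = Fdom H"
  shows "comp_func H (comp_func G F) = comp_func (comp_func H G) F"
  by (rule func_eqI) (use assms in auto)

section \<open>Natural transformations\<close>

lemma natural_simps:
  assumes "is_natural F G t"
  shows "is_functor F" "is_functor G" "Fdom G = Fdom F" "Fcod G = Fcod F"
    and "t \<in> extensional (Obj (Fdom F))"
    and "A \<in> Obj (Fdom F) \<Longrightarrow> t A \<in> Arr (Fcod F)"
    and "A \<in> Obj (Fdom F) \<Longrightarrow> Dom (Fcod F) (t A) = Fob F A"
    and "A \<in> Obj (Fdom F) \<Longrightarrow> Cod (Fcod F) (t A) = Fob G A"
    and "f \<in> Arr (Fdom F) \<Longrightarrow>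
      t (Cod (Fdom F) f) \<cdot>\<^bsub>Fcod F\<^esub> Far F f = Far G f \<cdot>\<^bsub>Fcod F\<^esub> t (Dom (Fdom F) f)"
  using assms by (auto simp: is_natural_def)

lemma naturalI:
  assumes "is_functor F" "is_functor G" "Fdom F = Fdom G" "Fcod F = Fcod G"
    and "t \<in> extensional (Obj (Fdom F))"
    and "\<And>A. A \<in> Obj (Fdom F) \<Longrightarrow> t A \<in> Arr (Fcod F) \<and> Dom (Fcod F) (t A) = Fob F A \<and>
      Cod (Fcod F) (t A) = Fob G A"
    and "\<And>f. f \<in> Arr (Fdom F) \<Longrightarrow>
      t (Cod (Fdom F) f) \<cdot>\<^bsub>Fcod F\<^esub> Far F f = Far G f \<cdot>\<^bsub>Fcod F\<^esub> t (Dom (Fdom F) f)"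
  shows "is_natural F G t"
  using assms unfolding is_natural_def hom_iff by blast

section \<open>Monoidal categories and strong monoidal functors\<close>

lemma monoidal_category_simps [simp]:
  assumes "monoidal_category M" "MCat M = C"
  shows "category (MCat M)"
    and "is_functor (Tensor M)"
    and "Fdom (Tensor M) = prod_cat C C"
    and "Fcod (Tensor M) = C"
    and "TUnit M \<in> Obj C"
    and "\<lbrakk>X \<in> Obj C; Y \<in> Obj C\<rbrakk> \<Longrightarrow> tobj M X Y \<in> Obj C"
    and "\<lbrakk>f \<in> Arr C; g \<in> Arr C\<rbrakk> \<Longrightarrow> tarr M f g \<in> Arr C"
    and "\<lbrakk>f \<in> Arr C; g \<in> Arr C\<rbrakk> \<Longrightarrow> Dom C (tarr M f g) = tobj M (Dom C f) (Dom C g)"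
    and "\<lbrakk>f \<in> Arr C; g \<in> Arr C\<rbrakk> \<Longrightarrow> Cod C (tarr M f g) = tobj M (Cod C f) (Cod C g)"
    and "\<lbrakk>X \<in> Obj C; Y \<in> Obj C\<rbrakk> \<Longrightarrow> tarr M (Idn C X) (Idn C Y) = Idn C (tobj M X Y)"
    and "\<lbrakk>X \<in> Obj C; Y \<in> Obj C; Z \<in> Obj C\<rbrakk> \<Longrightarrow> Assoc M X Y Z \<in> Arr C"
    and "\<lbrakk>X \<in> Obj C; Y \<in> Obj C; Z \<in> Obj C\<rbrakk> \<Longrightarrow> Dom C (Assoc M X Y Z) = tobj M (tobj M X Y) Z"
    and "\<lbrakk>X \<in> Obj C; Y \<in> Obj C; Z \<in> Obj C\<rbrakk> \<Longrightarrow> Cod C (Assoc M X Y Z) = tobj M X (tobj M Y Z)"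
    and "X \<in> Obj C \<Longrightarrow> Lunit M X \<in> Arr C"
    and "X \<in> Obj C \<Longrightarrow> Dom C (Lunit M X) = tobj M (TUnit M) X"
    and "X \<in> Obj C \<Longrightarrow> Cod C (Lunit M X) = X"
    and "X \<in> Obj C \<Longrightarrow> Runit M X \<in> Arr C"
    and "X \<in> Obj C \<Longrightarrow> Dom C (Runit M X) = tobj M X (TUnit M)"
    and "X \<in> Obj C \<Longrightarrow> Cod C (Runit M X) = X"
proof -
  note laws = assms(1)[unfolded monoidal_category_def Let_def assms(2) hom_iff]
  show F: "is_functor (Tensor M)" "Fdom (Tensor M) = prod_cat C C" "Fcod (Tensor M) = C"
    using laws by blast+
  show "\<lbrakk>X \<in> Obj C; Y \<in> Obj C\<rbrakk> \<Longrightarrow> tobj M X Y \<in> Obj C"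
    "\<lbrakk>f \<in> Arr C; g \<in> Arr C\<rbrakk> \<Longrightarrow> tarr M f g \<in> Arr C"
    "\<lbrakk>f \<in> Arr C; g \<in> Arr C\<rbrakk> \<Longrightarrow> Dom C (tarr M f g) = tobj M (Dom C f) (Dom C g)"
    "\<lbrakk>f \<in> Arr C; g \<in> Arr C\<rbrakk> \<Longrightarrow> Cod C (tarr M f g) = tobj M (Cod C f) (Cod C g)"
    using F by simp_all
  show "\<lbrakk>X \<in> Obj C; Y \<in> Obj C\<rbrakk> \<Longrightarrow> tarr M (Idn C X) (Idn C Y) = Idn C (tobj M X Y)"
    using functor_simps(9)[OF F(1,2), of "(X, Y)"] F by simp
  show "category (MCat M)" unfolding assms(2) using laws by blast
qed (use assms(1)[unfolded monoidal_category_def Let_def assms(2) hom_iff] in blast)+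

lemma tarr_comp:
  assumes "monoidal_category M" "MCat M = C"
    and "f \<in> Arr C" "g \<in> Arr C" "Cod C f = Dom C g"
    and "f' \<in> Arr C" "g' \<in> Arr C" "Cod C f' = Dom C g'"
  shows "tarr M (g \<cdot>\<^bsub>C\<^esub> f) (g' \<cdot>\<^bsub>C\<^esub> f') = tarr M g g' \<cdot>\<^bsub>C\<^esub> tarr M f f'"
  using assms functor_simps(10)[of "Tensor M" "prod_cat C C" "(f, f')" "(g, g')"] by simp

lemma monoidal_functor_simps [simp]:
  assumes "monoidal_functor H"
  shows "monoidal_category (MDom H)"
    and "monoidal_category (MCod H)"
    and "is_functor (MFun H)"
    and "Fdom (MFun H) = MCat (MDom H)"
    and "Fcod (MFun H) = MCat (MCod H)"
    and "MCat (MDom H) = C \<Longrightarrow> MPhi H \<in> extensional (Obj C \<times> Obj C)"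
    and "\<lbrakk>MCat (MCod H) = D; X \<in> Obj (MCat (MDom H)); Y \<in> Obj (MCat (MDom H))\<rbrakk> \<Longrightarrow>
      MPhi H (X, Y) \<in> Arr D"
    and "\<lbrakk>MCat (MCod H) = D; X \<in> Obj (MCat (MDom H)); Y \<in> Obj (MCat (MDom H))\<rbrakk> \<Longrightarrow>
      Dom D (MPhi H (X, Y)) = tobj (MCod H) (Fob (MFun H) X) (Fob (MFun H) Y)"
    and "\<lbrakk>MCat (MCod H) = D; X \<in> Obj (MCat (MDom H)); Y \<in> Obj (MCat (MDom H))\<rbrakk> \<Longrightarrow>
      Cod D (MPhi H (X, Y)) = Fob (MFun H) (tobj (MDom H) X Y)"
    and "\<lbrakk>MCat (MCod H) = D; X \<in> Obj (MCat (MDom H)); Y \<in> Obj (MCat (MDom H))\<rbrakk> \<Longrightarrow>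
      iso D (MPhi H (X, Y))"
    and "MCat (MCod H) = D \<Longrightarrow> MPhi0 H \<in> Arr D"
    and "MCat (MCod H) = D \<Longrightarrow> Dom D (MPhi0 H) = TUnit (MCod H)"
    and "MCat (MCod H) = D \<Longrightarrow> Cod D (MPhi0 H) = Fob (MFun H) (TUnit (MDom H))"
    and "MCat (MCod H) = D \<Longrightarrow> iso D (MPhi0 H)"
  using assms[unfolded monoidal_functor_def Let_def hom_iff] by blast+

text \<open>The equations naming \<open>M\<close>, \<open>N\<close>, \<open>C\<close>,
  \<open>D\<close>, \<open>F\<close> replace nested selectors by variables, which keeps the
  coherence laws short and gives them one normal form.\<close>

lemma monoidal_functor_laws:
  assumes "monoidal_functor H"
    and "MDom H = M" "MCod H = N" "MCat M = C" "MCat N = D" "MFun H = F"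
  shows "\<lbrakk>f \<in> Arr C; g \<in> Arr C\<rbrakk> \<Longrightarrow>
       MPhi H (Cod C f, Cod C g) \<cdot>\<^bsub>D\<^esub> tarr N (Far F f) (Far F g) =
       Far F (tarr M f g) \<cdot>\<^bsub>D\<^esub> MPhi H (Dom C f, Dom C g)"
    and "\<lbrakk>X \<in> Obj C; Y \<in> Obj C; Z \<in> Obj C\<rbrakk> \<Longrightarrow>
       Far F (Assoc M X Y Z) \<cdot>\<^bsub>D\<^esub> MPhi H (tobj M X Y, Z) \<cdot>\<^bsub>D\<^esub> tarr N (MPhi H (X, Y)) (Idn D (Fob F Z)) =
       MPhi H (X, tobj M Y Z) \<cdot>\<^bsub>D\<^esub>
         tarr N (Idn D (Fob F X)) (MPhi H (Y, Z)) \<cdot>\<^bsub>D\<^esub> Assoc N (Fob F X) (Fob F Y) (Fob F Z)"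
    and "X \<in> Obj C \<Longrightarrow>
       Far F (Lunit M X) \<cdot>\<^bsub>D\<^esub> MPhi H (TUnit M, X) \<cdot>\<^bsub>D\<^esub> tarr N (MPhi0 H) (Idn D (Fob F X)) =
       Lunit N (Fob F X)"
    and "X \<in> Obj C \<Longrightarrow>
       Far F (Runit M X) \<cdot>\<^bsub>D\<^esub> MPhi H (X, TUnit M) \<cdot>\<^bsub>D\<^esub> tarr N (Idn D (Fob F X)) (MPhi0 H) =
       Runit N (Fob F X)"
  using assms(1)[unfolded monoidal_functor_def Let_def assms(2-) ] by blast+

lemma monoidal_functorI:
  assumes "monoidal_category (MDom H)" "monoidal_category (MCod H)" "is_functor (MFun H)"
    and "Fdom (MFun H) = MCat (MDom H)" "Fcod (MFun H) = MCat (MCod H)"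
    and "MPhi H \<in> extensional (Obj (MCat (MDom H)) \<times> Obj (MCat (MDom H)))"
    and "MDom H = M" "MCod H = N" "MCat M = C" "MCat N = D" "MFun H = F"
    and "\<And>X Y. \<lbrakk>X \<in> Obj C; Y \<in> Obj C\<rbrakk> \<Longrightarrow>
          MPhi H (X, Y) \<in> hom D (tobj N (Fob F X) (Fob F Y)) (Fob F (tobj M X Y)) \<and>
          iso D (MPhi H (X, Y))"
    and "\<And>f g. \<lbrakk>f \<in> Arr C; g \<in> Arr C\<rbrakk> \<Longrightarrow>
       MPhi H (Cod C f, Cod C g) \<cdot>\<^bsub>D\<^esub> tarr N (Far F f) (Far F g) =
       Far F (tarr M f g) \<cdot>\<^bsub>D\<^esub> MPhi H (Dom C f, Dom C g)"
    and "MPhi0 H \<in> hom D (TUnit N) (Fob F (TUnit M)) \<and> iso D (MPhi0 H)"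
    and "\<And>X Y Z. \<lbrakk>X \<in> Obj C; Y \<in> Obj C; Z \<in> Obj C\<rbrakk> \<Longrightarrow>
       Far F (Assoc M X Y Z) \<cdot>\<^bsub>D\<^esub> MPhi H (tobj M X Y, Z) \<cdot>\<^bsub>D\<^esub> tarr N (MPhi H (X, Y)) (Idn D (Fob F Z)) =
       MPhi H (X, tobj M Y Z) \<cdot>\<^bsub>D\<^esub>
         tarr N (Idn D (Fob F X)) (MPhi H (Y, Z)) \<cdot>\<^bsub>D\<^esub> Assoc N (Fob F X) (Fob F Y) (Fob F Z)"
    and "\<And>X. X \<in> Obj C \<Longrightarrow>
       Far F (Lunit M X) \<cdot>\<^bsub>D\<^esub> MPhi H (TUnit M, X) \<cdot>\<^bsub>D\<^esub> tarr N (MPhi0 H) (Idn D (Fob F X)) =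
       Lunit N (Fob F X)"
    and "\<And>X. X \<in> Obj C \<Longrightarrow>
       Far F (Runit M X) \<cdot>\<^bsub>D\<^esub> MPhi H (X, TUnit M) \<cdot>\<^bsub>D\<^esub> tarr N (Idn D (Fob F X)) (MPhi0 H) =
       Runit N (Fob F X)"
  shows "monoidal_functor H"
  using assms(1-6,12-) unfolding monoidal_functor_def Let_def assms(7-11) by blast

section \<open>Isomorphisms\<close>

lemma iso_Idn [simp]: "category C \<Longrightarrow> A \<in> Obj C \<Longrightarrow> iso C (Idn C A)"
  by (auto simp: iso_def intro!: bexI[of _ "Idn C A"])

lemma iso_comp [simp]:
  assumes C: "category C" and "iso C f" "iso C g" "Cod C f = Dom C g"
  shows "iso C (g \<cdot>\<^bsub>C\<^esub> f)"
proof -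
  have f: "f \<in> Arr C" and g: "g \<in> Arr C" using assms by (auto simp: iso_def)
  obtain f' where f': "f' \<in> Arr C" "Dom C f' = Cod C f" "Cod C f' = Dom C f"
    "f' \<cdot>\<^bsub>C\<^esub> f = Idn C (Dom C f)" "f \<cdot>\<^bsub>C\<^esub> f' = Idn C (Cod C f)"
    using assms(2) by (auto simp: iso_def)
  obtain g' where g': "g' \<in> Arr C" "Dom C g' = Cod C g" "Cod C g' = Dom C g"
    "g' \<cdot>\<^bsub>C\<^esub> g = Idn C (Dom C g)" "g \<cdot>\<^bsub>C\<^esub> g' = Idn C (Cod C g)"
    using assms(3) by (auto simp: iso_def)
  have "g' \<cdot>\<^bsub>C\<^esub> g \<cdot>\<^bsub>C\<^esub> f = f" "f \<cdot>\<^bsub>C\<^esub> f' \<cdot>\<^bsub>C\<^esub> g' = g'"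
    using f g f' g' assms by (simp_all add: comp_prefix[of C, OF C _ _ _ _ _ g'(4)]
        comp_prefix[of C, OF C _ _ _ _ _ f'(5)])
  then show ?thesis
    using f g f' g' C assms(4) by (auto simp: iso_def intro!: bexI[of _ "f' \<cdot>\<^bsub>C\<^esub> g'"])
qed

lemma iso_functor [simp]:
  assumes "is_functor F" "Fcod F = D" "iso (Fdom F) f"
  shows "iso D (Far F f)"
proof -
  let ?C = "Fdom F"
  have f: "f \<in> Arr ?C" using assms by (auto simp: iso_def)
  obtain g where g: "g \<in> Arr ?C" "Dom ?C g = Cod ?C f" "Cod ?C g = Dom ?C f"
    "g \<cdot>\<^bsub>?C\<^esub> f = Idn ?C (Dom ?C f)" "f \<cdot>\<^bsub>?C\<^esub> g = Idn ?C (Cod ?C f)"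
    using assms by (auto simp: iso_def)
  have "Far F g \<cdot>\<^bsub>D\<^esub> Far F f = Idn D (Fob F (Dom ?C f))"
    "Far F f \<cdot>\<^bsub>D\<^esub> Far F g = Idn D (Fob F (Cod ?C f))"
    using functor_simps(10)[OF assms(1) refl, of f g] functor_simps(10)[OF assms(1) refl, of g f]
      f g assms(1,2) by auto
  then show ?thesis
    using assms f g by (auto simp: iso_def intro!: bexI[of _ "Far F g"])
qed

text \<open>The analogue of \<open>comp_prefix\<close> for composites of three arrows, the shape of
  the left-hand sides in the associativity and unit laws of a monoidal functor.\<close>

lemma comp_prefix3:
  assumes "category C" "f \<in> Arr C" "g \<in> Arr C" "h \<in> Arr C" "k \<in> Arr C"
    and "Cod C f = Dom C g" "Cod C g = Dom C h" "Cod C h = Dom C k"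
    and "k \<cdot>\<^bsub>C\<^esub> h \<cdot>\<^bsub>C\<^esub> g = l"
  shows "k \<cdot>\<^bsub>C\<^esub> h \<cdot>\<^bsub>C\<^esub> g \<cdot>\<^bsub>C\<^esub> f = l \<cdot>\<^bsub>C\<^esub> f"
  unfolding assms(9)[symmetric] using assms(1-8) by simp

section \<open>Identity and composite monoidal functors\<close>

lemma id_monfunc_sel [simp]:
  "MDom (id_monfunc M) = M" "MCod (id_monfunc M) = M" "MFun (id_monfunc M) = id_func (MCat M)"
  "\<lbrakk>X \<in> Obj (MCat M); Y \<in> Obj (MCat M)\<rbrakk> \<Longrightarrow> MPhi (id_monfunc M) (X, Y) = Idn (MCat M) (tobj M X Y)"
  "MPhi0 (id_monfunc M) = Idn (MCat M) (TUnit M)"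
  by (auto simp: id_monfunc_def)

lemma comp_monfunc_sel [simp]:
  "MDom (comp_monfunc K H) = MDom H" "MCod (comp_monfunc K H) = MCod K"
  "MFun (comp_monfunc K H) = comp_func (MFun K) (MFun H)"
  "\<lbrakk>X \<in> Obj (MCat (MDom H)); Y \<in> Obj (MCat (MDom H))\<rbrakk> \<Longrightarrow> MPhi (comp_monfunc K H) (X, Y) =
    Far (MFun K) (MPhi H (X, Y)) \<cdot>\<^bsub>MCat (MCod K)\<^esub> MPhi K (Fob (MFun H) X, Fob (MFun H) Y)"
  "MPhi0 (comp_monfunc K H) = Far (MFun K) (MPhi0 H) \<cdot>\<^bsub>MCat (MCod K)\<^esub> MPhi0 K"
  by (auto simp: comp_monfunc_def)

lemma monoidal_functor_id:
  assumes "monoidal_category M"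
  shows "monoidal_functor (id_monfunc M)"
proof (rule monoidal_functorI[where C = "MCat M" and D = "MCat M" and M = M and N = M
      and F = "id_func (MCat M)"])
  show "MPhi (id_monfunc M) \<in> extensional (Obj (MCat (MDom (id_monfunc M))) \<times>
    Obj (MCat (MDom (id_monfunc M))))"
    by (simp add: id_monfunc_def)
qed (use assms in simp_all)

text \<open>Each law is a pasting of the \<open>G\<close>-image of the law for \<open>H\<close> with
  the law for \<open>K\<close>; the two are joined by naturality of the structure map
  \<open>q\<close> of \<open>K\<close>.\<close>

lemma monoidal_functor_comp:
  assumes H: "monoidal_functor H" and K: "monoidal_functor K" and HK: "MCod H = MDom K"
  shows "monoidal_functor (comp_monfunc K H)"
proof -
  obtain M N R C D E F G p q where
    H': "MDom H = M" "MCod H = N" "MCat M = C" "MCat N = D" "MFun H = F" and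
    K': "MDom K = N" "MCod K = R" "MCat N = D" "MCat R = E" "MFun K = G" and
    pq [simp]: "MPhi H = p" "MPhi K = q"
    using HK by blast
  note [simp] = H K H'[simp] K'[simp]
  have [simp]: "monoidal_category M" "monoidal_category N" "monoidal_category R"
    "is_functor F" "is_functor G" "Fdom F = C" "Fcod F = D" "Fdom G = D" "Fcod G = E"
    using monoidal_functor_simps(1-5)[OF H] monoidal_functor_simps(1-5)[OF K] by simp_all
  then have [simp]: "category C" "category D" "category E"
    by (metis H'(3) K'(3,4) monoidal_category_simps(1))+
  note p = monoidal_functor_simps[OF H, unfolded H' pq] monoidal_functor_laws[OF H H', unfolded pq]
  note q = monoidal_functor_simps[OF K, unfolded K' pq] monoidal_functor_laws[OF K K', unfolded pq]
  note [simp] = p(7-14)[OF refl] q(7-14)[OF refl]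
  \<comment> \<open>End points are variables constrained by equations, so that the rule matches
    objects in whatever form simp has brought them to.\<close>
  have q_nat: "q (B, B') \<cdot>\<^bsub>E\<^esub> tarr R (Far G f) (Far G g) = Far G (tarr N f g) \<cdot>\<^bsub>E\<^esub> q (A, A')"
    if "f \<in> Arr D" "g \<in> Arr D" "Dom D f = A" "Cod D f = B" "Dom D g = A'" "Cod D g = B'"
    for f g A B A' B' using q(15) that by blast
  show ?thesis
  proof (rule monoidal_functorI[where C = C and D = E and M = M and N = R])
    show "MPhi (comp_monfunc K H) \<in> extensional (Obj (MCat (MDom (comp_monfunc K H))) \<times>
      Obj (MCat (MDom (comp_monfunc K H))))"
      by (simp add: comp_monfunc_def)
  next
    fix f g assume [simp]: "f \<in> Arr C" "g \<in> Arr C"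
    have "Far G (p (Cod C f, Cod C g)) \<cdot>\<^bsub>E\<^esub> Far G (tarr N (Far F f) (Far F g)) =
      Far G (Far F (tarr M f g)) \<cdot>\<^bsub>E\<^esub> Far G (p (Dom C f, Dom C g))"
      using arg_cong[OF p(15), of f g "Far G"] by simp
    note * = comp_prefix[of E, OF _ _ _ _ _ _ this]
    show "MPhi (comp_monfunc K H) (Cod C f, Cod C g) \<cdot>\<^bsub>E\<^esub>
        tarr R (Far (MFun (comp_monfunc K H)) f) (Far (MFun (comp_monfunc K H)) g) =
      Far (MFun (comp_monfunc K H)) (tarr M f g) \<cdot>\<^bsub>E\<^esub> MPhi (comp_monfunc K H) (Dom C f, Dom C g)"
      by (simp add: q_nat *)
  next
    fix X Y Z assume [simp]: "X \<in> Obj C" "Y \<in> Obj C" "Z \<in> Obj C"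
    \<comment> \<open>The identity is split off as the \<open>G\<close>-image of an identity,
      because \<open>q_nat\<close> only moves images under \<open>G\<close>. For the same reason
      \<open>functor_simps(9)\<close> is switched off at the end: it would turn this image back into
      an identity.\<close>
    have 1: "tarr R (Far G (p (X, Y)) \<cdot>\<^bsub>E\<^esub> q (Fob F X, Fob F Y)) (Idn E (Fob G (Fob F Z))) =
      tarr R (Far G (p (X, Y))) (Far G (Idn D (Fob F Z))) \<cdot>\<^bsub>E\<^esub>
      tarr R (q (Fob F X, Fob F Y)) (Idn E (Fob G (Fob F Z)))"
      by (simp add: tarr_comp[symmetric])
    have 2: "tarr R (Idn E (Fob G (Fob F X))) (Far G (p (Y, Z)) \<cdot>\<^bsub>E\<^esub> q (Fob F Y, Fob F Z)) =
      tarr R (Far G (Idn D (Fob F X))) (Far G (p (Y, Z))) \<cdot>\<^bsub>E\<^esub>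
      tarr R (Idn E (Fob G (Fob F X))) (q (Fob F Y, Fob F Z))"
      by (simp add: tarr_comp[symmetric])
    have 3: "Far G (Far F (Assoc M X Y Z)) \<cdot>\<^bsub>E\<^esub> Far G (p (tobj M X Y, Z)) \<cdot>\<^bsub>E\<^esub>
        Far G (tarr N (p (X, Y)) (Idn D (Fob F Z))) =
      Far G (p (X, tobj M Y Z)) \<cdot>\<^bsub>E\<^esub> Far G (tarr N (Idn D (Fob F X)) (p (Y, Z))) \<cdot>\<^bsub>E\<^esub>
        Far G (Assoc N (Fob F X) (Fob F Y) (Fob F Z))"
      using arg_cong[OF p(16), of X Y Z "Far G"] by simp
    note nat = q_nat[of "p (X, Y)" "Idn D (Fob F Z)"] q_nat[of "Idn D (Fob F X)" "p (Y, Z)"]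
    show "Far (MFun (comp_monfunc K H)) (Assoc M X Y Z) \<cdot>\<^bsub>E\<^esub>
         MPhi (comp_monfunc K H) (tobj M X Y, Z) \<cdot>\<^bsub>E\<^esub>
         tarr R (MPhi (comp_monfunc K H) (X, Y)) (Idn E (Fob (MFun (comp_monfunc K H)) Z)) =
       MPhi (comp_monfunc K H) (X, tobj M Y Z) \<cdot>\<^bsub>E\<^esub>
         tarr R (Idn E (Fob (MFun (comp_monfunc K H)) X)) (MPhi (comp_monfunc K H) (Y, Z)) \<cdot>\<^bsub>E\<^esub>
         Assoc R (Fob (MFun (comp_monfunc K H)) X) (Fob (MFun (comp_monfunc K H)) Y)
           (Fob (MFun (comp_monfunc K H)) Z)"
      by (simp add: 1 2 comp_prefix[of E, OF _ _ _ _ _ _ nat(1)]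
          comp_prefix[of E, OF _ _ _ _ _ _ nat(2)] comp_prefix3[of E, OF _ _ _ _ _ _ _ _ 3] q(16)
          del: functor_simps(9))
  next
    fix X assume [simp]: "X \<in> Obj C"
    have 1: "tarr R (Far G (MPhi0 H) \<cdot>\<^bsub>E\<^esub> MPhi0 K) (Idn E (Fob G (Fob F X))) =
      tarr R (Far G (MPhi0 H)) (Far G (Idn D (Fob F X))) \<cdot>\<^bsub>E\<^esub>
      tarr R (MPhi0 K) (Idn E (Fob G (Fob F X)))"
      by (simp add: tarr_comp[symmetric])
    have 2: "Far G (Far F (Lunit M X)) \<cdot>\<^bsub>E\<^esub> Far G (p (TUnit M, X)) \<cdot>\<^bsub>E\<^esub>
        Far G (tarr N (MPhi0 H) (Idn D (Fob F X))) = Far G (Lunit N (Fob F X))"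
      using arg_cong[OF p(17), of X "Far G"] by simp
    note nat = q_nat[of "MPhi0 H" "Idn D (Fob F X)"]
    show "Far (MFun (comp_monfunc K H)) (Lunit M X) \<cdot>\<^bsub>E\<^esub> MPhi (comp_monfunc K H) (TUnit M, X) \<cdot>\<^bsub>E\<^esub>
         tarr R (MPhi0 (comp_monfunc K H)) (Idn E (Fob (MFun (comp_monfunc K H)) X)) =
       Lunit R (Fob (MFun (comp_monfunc K H)) X)"
      by (simp add: 1 comp_prefix[of E, OF _ _ _ _ _ _ nat]
          comp_prefix3[of E, OF _ _ _ _ _ _ _ _ 2] q(17) del: functor_simps(9))
  next
    fix X assume [simp]: "X \<in> Obj C"
    have 1: "tarr R (Idn E (Fob G (Fob F X))) (Far G (MPhi0 H) \<cdot>\<^bsub>E\<^esub> MPhi0 K) =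
      tarr R (Far G (Idn D (Fob F X))) (Far G (MPhi0 H)) \<cdot>\<^bsub>E\<^esub>
      tarr R (Idn E (Fob G (Fob F X))) (MPhi0 K)"
      by (simp add: tarr_comp[symmetric])
    have 2: "Far G (Far F (Runit M X)) \<cdot>\<^bsub>E\<^esub> Far G (p (X, TUnit M)) \<cdot>\<^bsub>E\<^esub>
        Far G (tarr N (Idn D (Fob F X)) (MPhi0 H)) = Far G (Runit N (Fob F X))"
      using arg_cong[OF p(18), of X "Far G"] by simp
    note nat = q_nat[of "Idn D (Fob F X)" "MPhi0 H"]
    show "Far (MFun (comp_monfunc K H)) (Runit M X) \<cdot>\<^bsub>E\<^esub> MPhi (comp_monfunc K H) (X, TUnit M) \<cdot>\<^bsub>E\<^esub>
         tarr R (Idn E (Fob (MFun (comp_monfunc K H)) X)) (MPhi0 (comp_monfunc K H)) =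
       Runit R (Fob (MFun (comp_monfunc K H)) X)"
      by (simp add: 1 comp_prefix[of E, OF _ _ _ _ _ _ nat]
          comp_prefix3[of E, OF _ _ _ _ _ _ _ _ 2] q(18) del: functor_simps(9))
  qed (simp_all)
qed


section \<open>Monoidal natural transformations\<close>

lemma monoidal_natural_laws:
  assumes "monoidal_natural H K t"
    and "MDom H = M" "MCod H = N" "MCat M = C" "MCat N = D" "MFun H = F" "MFun K = G"
  shows "MDom K = M" "MCod K = N" "is_natural F G t"
    and "\<lbrakk>X \<in> Obj C; Y \<in> Obj C\<rbrakk> \<Longrightarrow>
      t (tobj M X Y) \<cdot>\<^bsub>D\<^esub> MPhi H (X, Y) = MPhi K (X, Y) \<cdot>\<^bsub>D\<^esub> tarr N (t X) (t Y)"
    and "t (TUnit M) \<cdot>\<^bsub>D\<^esub> MPhi0 H = MPhi0 K"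
  using assms by (auto simp: monoidal_natural_def Let_def)

lemma monoidal_naturalI:
  assumes "MDom H = M" "MCod H = N" "MDom K = M" "MCod K = N" "MCat M = C" "MCat N = D"
    and "is_natural (MFun H) (MFun K) t"
    and "\<And>X Y. \<lbrakk>X \<in> Obj C; Y \<in> Obj C\<rbrakk> \<Longrightarrow>
      t (tobj M X Y) \<cdot>\<^bsub>D\<^esub> MPhi H (X, Y) = MPhi K (X, Y) \<cdot>\<^bsub>D\<^esub> tarr N (t X) (t Y)"
    and "t (TUnit M) \<cdot>\<^bsub>D\<^esub> MPhi0 H = MPhi0 K"
  shows "monoidal_natural H K t"
  using assms by (simp add: monoidal_natural_def Let_def)

lemma monoidal_natural_id:
  assumes "monoidal_functor H"
  shows "monoidal_natural H H (Ncmp (id_nt MFun H))"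
proof -
  obtain M N C D F where
    H': "MDom H = M" "MCod H = N" "MCat M = C" "MCat N = D" "MFun H = F" by blast
  note [simp] = assms H'
  have [simp]: "monoidal_category M" "monoidal_category N" "is_functor F" "Fdom F = C" "Fcod F = D"
    using monoidal_functor_simps(1-5)[OF assms] by simp_all
  then have [simp]: "category C" "category D"
    by (metis H'(3,4) monoidal_category_simps(1))+
  note [simp] = monoidal_functor_simps(7-14)[OF assms, unfolded H', OF refl]
  show ?thesis
    by (rule monoidal_naturalI[where M = M and N = N and C = C and D = D])
      (auto intro!: naturalI simp: id_nt_def)
qed

lemma monoidal_natural_vcomp:
  assumes s: "monoidal_natural H K s" and t: "monoidal_natural K L t"
    and mf [simp]: "monoidal_functor H" "monoidal_functor K" "monoidal_functor L"
  shows "monoidal_natural H L (\<lambda>X \<in> Obj (MCat (MDom H)). t X \<cdot>\<^bsub>MCat (MCod H)\<^esub> s X)"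
proof -
  obtain M N C D F G I where
    H': "MDom H = M" "MCod H = N" "MCat M = C" "MCat N = D" "MFun H = F" "MFun K = G" "MFun L = I"
    by blast
  note ls = monoidal_natural_laws[OF s H'(1-6)]
  note lt = monoidal_natural_laws[OF t ls(1,2) H'(3,4,6,7)]
  note K' = ls(1,2) H'(3,4,6) and L' = lt(1,2) H'(3,4,7)
  note ns = natural_simps[OF ls(3)] and nt = natural_simps[OF lt(3)]
  note [simp] = H' ls(1,2) lt(1,2)
  have [simp]: "monoidal_category M" "monoidal_category N" "is_functor F" "Fdom F = C" "Fcod F = D"
    "is_functor G" "Fdom G = C" "Fcod G = D" "is_functor I" "Fdom I = C" "Fcod I = D"
    using monoidal_functor_simps(1-5)[OF mf(1)] monoidal_functor_simps(1-5)[OF mf(2)]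
      monoidal_functor_simps(1-5)[OF mf(3)] by simp_all
  then have [simp]: "category C" "category D"
    by (metis H'(3,4) monoidal_category_simps(1))+
  note [simp] = monoidal_functor_simps(7-14)[OF mf(1), unfolded H', OF refl]
    monoidal_functor_simps(7-14)[OF mf(2), unfolded K', OF refl]
    monoidal_functor_simps(7-14)[OF mf(3), unfolded L', OF refl]
  note [simp] = ns(6-8)[simplified] nt(6-8)[simplified]
  show ?thesis
  proof (rule monoidal_naturalI[where M = M and N = N and C = C and D = D])
    show "is_natural (MFun H) (MFun L) (\<lambda>X \<in> Obj (MCat (MDom H)). t X \<cdot>\<^bsub>MCat (MCod H)\<^esub> s X)"
    proof (rule naturalI)
      fix f assume "f \<in> Arr (Fdom (MFun H))"
      then have [simp]: "f \<in> Arr C" by simp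
      show "(\<lambda>X \<in> Obj (MCat (MDom H)). t X \<cdot>\<^bsub>MCat (MCod H)\<^esub> s X) (Cod (Fdom (MFun H)) f)
          \<cdot>\<^bsub>Fcod (MFun H)\<^esub> Far (MFun H) f =
        Far (MFun L) f \<cdot>\<^bsub>Fcod (MFun H)\<^esub>
          (\<lambda>X \<in> Obj (MCat (MDom H)). t X \<cdot>\<^bsub>MCat (MCod H)\<^esub> s X) (Dom (Fdom (MFun H)) f)"
        by (simp add: ns(9)[simplified] comp_prefix[of D, OF _ _ _ _ _ _ nt(9)[simplified]])
    qed simp_all
  next
    fix X Y assume [simp]: "X \<in> Obj C" "Y \<in> Obj C"
    show "(\<lambda>X \<in> Obj (MCat (MDom H)). t X \<cdot>\<^bsub>MCat (MCod H)\<^esub> s X) (tobj M X Y) \<cdot>\<^bsub>D\<^esub> MPhi H (X, Y) =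
      MPhi L (X, Y) \<cdot>\<^bsub>D\<^esub> tarr N ((\<lambda>X \<in> Obj (MCat (MDom H)). t X \<cdot>\<^bsub>MCat (MCod H)\<^esub> s X) X)
        ((\<lambda>X \<in> Obj (MCat (MDom H)). t X \<cdot>\<^bsub>MCat (MCod H)\<^esub> s X) Y)"
      by (simp add: ls(4) comp_prefix[of D, OF _ _ _ _ _ _ lt(4)] tarr_comp)
  qed (simp_all add: ls(5) lt(5))
qed

text \<open>Monoidality combines four squares: the \<open>G\<close>-image of the law for
  \<open>s\<close>, naturality of \<open>t\<close> at the structure map of \<open>H'\<close>, the
  law for \<open>t\<close>, and naturality of the structure map of \<open>K\<close>.\<close>

lemma monoidal_natural_hcomp:
  assumes s: "monoidal_natural H H' s" and t: "monoidal_natural K K' t"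
    and mf [simp]: "monoidal_functor H" "monoidal_functor H'" "monoidal_functor K"
      "monoidal_functor K'"
    and HK: "MCod H = MDom K"
  shows "monoidal_natural (comp_monfunc K H) (comp_monfunc K' H')
    (\<lambda>X \<in> Obj (MCat (MDom H)). t (Fob (MFun H') X) \<cdot>\<^bsub>MCat (MCod K)\<^esub> Far (MFun K) (s X))"
proof -
  obtain M N R C D E F F' G G' where
    H: "MDom H = M" "MCod H = N" "MCat M = C" "MCat N = D" "MFun H = F" "MFun H' = F'" and
    K: "MDom K = N" "MCod K = R" "MCat N = D" "MCat R = E" "MFun K = G" "MFun K' = G'"
    using HK by blast
  note ls = monoidal_natural_laws[OF s H]
  note lt = monoidal_natural_laws[OF t K]
  note H' = ls(1,2) H(3,4,6) and K' = lt(1,2) K(3,4,6)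
  note ns = natural_simps[OF ls(3)] and nt = natural_simps[OF lt(3)]
  note [simp] = H K ls(1,2) lt(1,2)
  have [simp]: "monoidal_category M" "monoidal_category N" "monoidal_category R"
    "is_functor F" "Fdom F = C" "Fcod F = D" "is_functor F'" "Fdom F' = C" "Fcod F' = D"
    "is_functor G" "Fdom G = D" "Fcod G = E" "is_functor G'" "Fdom G' = D" "Fcod G' = E"
    using monoidal_functor_simps(1-5)[OF mf(1)] monoidal_functor_simps(1-5)[OF mf(2)]
      monoidal_functor_simps(1-5)[OF mf(3)] monoidal_functor_simps(1-5)[OF mf(4)] by simp_all
  then have [simp]: "category C" "category D" "category E"
    by (metis H(3) K(3,4) monoidal_category_simps(1))+
  note [simp] = monoidal_functor_simps(7-14)[OF mf(1), unfolded H, OF refl]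
    monoidal_functor_simps(7-14)[OF mf(2), unfolded H', OF refl]
    monoidal_functor_simps(7-14)[OF mf(3), unfolded K, OF refl]
    monoidal_functor_simps(7-14)[OF mf(4), unfolded K', OF refl]
  note [simp] = ns(6-8)[simplified] nt(6-8)[simplified]
  have t_nat: "t B \<cdot>\<^bsub>E\<^esub> Far G f = Far G' f \<cdot>\<^bsub>E\<^esub> t A" if "f \<in> Arr D" "Dom D f = A" "Cod D f = B"
    for f A B using nt(9)[simplified, of f] that by simp
  have q_nat: "MPhi K (B, B') \<cdot>\<^bsub>E\<^esub> tarr R (Far G f) (Far G g) = Far G (tarr N f g) \<cdot>\<^bsub>E\<^esub> MPhi K (A, A')"
    if "f \<in> Arr D" "g \<in> Arr D" "Dom D f = A" "Cod D f = B" "Dom D g = A'" "Cod D g = B'"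
    for f g A B A' B' using monoidal_functor_laws(1)[OF mf(3) K(1-5)] that by blast
  let ?r = "\<lambda>X \<in> Obj (MCat (MDom H)). t (Fob (MFun H') X) \<cdot>\<^bsub>MCat (MCod K)\<^esub> Far (MFun K) (s X)"
  show ?thesis
  proof (rule monoidal_naturalI[where M = M and N = R and C = C and D = E])
    show "is_natural (MFun (comp_monfunc K H)) (MFun (comp_monfunc K' H')) ?r"
    proof (rule naturalI)
      fix f assume "f \<in> Arr (Fdom (MFun (comp_monfunc K H)))"
      then have [simp]: "f \<in> Arr C" by simp
      have "Far G (s (Cod C f)) \<cdot>\<^bsub>E\<^esub> Far G (Far F f) = Far G (Far F' f) \<cdot>\<^bsub>E\<^esub> Far G (s (Dom C f))"
        using arg_cong[OF ns(9)[simplified], of f "Far G"] by simp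
      then show "?r (Cod (Fdom (MFun (comp_monfunc K H))) f)
          \<cdot>\<^bsub>Fcod (MFun (comp_monfunc K H))\<^esub> Far (MFun (comp_monfunc K H)) f =
        Far (MFun (comp_monfunc K' H')) f \<cdot>\<^bsub>Fcod (MFun (comp_monfunc K H))\<^esub>
          ?r (Dom (Fdom (MFun (comp_monfunc K H))) f)"
        by (simp add: comp_prefix[of E, OF _ _ _ _ _ _ t_nat])
    qed simp_all
  next
    fix X Y assume [simp]: "X \<in> Obj C" "Y \<in> Obj C"
    have 1: "Far G (s (tobj M X Y)) \<cdot>\<^bsub>E\<^esub> Far G (MPhi H (X, Y)) =
      Far G (MPhi H' (X, Y)) \<cdot>\<^bsub>E\<^esub> Far G (tarr N (s X) (s Y))"
      using arg_cong[OF ls(4), of X Y "Far G"] by simp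
    \<comment> \<open>Naturality of \<open>t\<close> at the structure map of \<open>H'\<close>,
      which lets \<open>t\<close> pass from the tensor of images to the image of the tensor.\<close>
    have 2: "t (Fob F' (tobj M X Y)) \<cdot>\<^bsub>E\<^esub> Far G (MPhi H' (X, Y)) =
      Far G' (MPhi H' (X, Y)) \<cdot>\<^bsub>E\<^esub> t (tobj N (Fob F' X) (Fob F' Y))"
      by (simp add: t_nat)
    show "?r (tobj M X Y) \<cdot>\<^bsub>E\<^esub> MPhi (comp_monfunc K H) (X, Y) =
      MPhi (comp_monfunc K' H') (X, Y) \<cdot>\<^bsub>E\<^esub> tarr R (?r X) (?r Y)"
      by (simp add: tarr_comp comp_prefix[of E, OF _ _ _ _ _ _ 1] comp_prefix[of E, OF _ _ _ _ _ _ 2]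
          q_nat[symmetric] comp_prefix[of E, OF _ _ _ _ _ _ lt(4)])
  next
    have 1: "Far G (s (TUnit M)) \<cdot>\<^bsub>E\<^esub> Far G (MPhi0 H) = Far G (MPhi0 H')"
      using arg_cong[OF ls(5), of "Far G"] by simp
    have 2: "t (Fob F' (TUnit M)) \<cdot>\<^bsub>E\<^esub> Far G (MPhi0 H') =
      Far G' (MPhi0 H') \<cdot>\<^bsub>E\<^esub> t (TUnit N)"
      by (simp add: t_nat)
    show "?r (TUnit M) \<cdot>\<^bsub>E\<^esub> MPhi0 (comp_monfunc K H) = MPhi0 (comp_monfunc K' H')"
      by (simp add: comp_prefix[of E, OF _ _ _ _ _ _ 1] comp_prefix[of E, OF _ _ _ _ _ _ 2] lt(5))
  qed simp_all
qed

section \<open>The 2-category of monoidal categories\<close>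

lemma monfunc_eqI:
  fixes H K :: "('o, 'a, 'z) monfunc"
  assumes "monoidal_functor H" "monoidal_functor K" "MDom H = MDom K" "MCod H = MCod K"
    and "MFun H = MFun K" "MPhi0 H = MPhi0 K"
    and "\<And>X Y. \<lbrakk>X \<in> Obj (MCat (MDom H)); Y \<in> Obj (MCat (MDom H))\<rbrakk> \<Longrightarrow> MPhi H (X, Y) = MPhi K (X, Y)"
  shows "H = K"
proof -
  have "MPhi H = MPhi K"
    by (rule extensionalityI[of _ "Obj (MCat (MDom H)) \<times> Obj (MCat (MDom H))"])
      (use assms monoidal_functor_simps(6)[OF assms(2) refl] in auto)
  then show ?thesis using assms(3-6) by (cases H; cases K) simp
qed

lemma comp_monfunc_id [simp]:
  assumes [simp]: "monoidal_functor H" "MDom H = M" "MCod H = N"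
  shows "comp_monfunc H (id_monfunc M) = H" "comp_monfunc (id_monfunc N) H = H"
proof -
  have [simp]: "monoidal_category M" "monoidal_category N"
    using monoidal_functor_simps(1,2)[OF assms(1)] by simp_all
  show "comp_monfunc H (id_monfunc M) = H" "comp_monfunc (id_monfunc N) H = H"
    by (rule monfunc_eqI; simp add: monoidal_functor_comp monoidal_functor_id)+
qed

text \<open>The law is strict: functoriality of \<open>MFun L\<close> distributes over the composite
  structure map of \<open>comp_monfunc K H\<close>, and associativity in the target category does
  the rest.\<close>

lemma comp_monfunc_assoc:
  assumes [simp]: "monoidal_functor H" "monoidal_functor K" "monoidal_functor L"
    and [simp]: "MCod H = MDom K" "MCod K = MDom L"
  shows "comp_monfunc L (comp_monfunc K H) = comp_monfunc (comp_monfunc L K) H"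
  by (rule monfunc_eqI; simp add: monoidal_functor_comp comp_func_assoc)

text \<open>A 2-cell stores its source and target, so these have to agree besides the
  components.\<close>

lemma ntrans_eqI:
  fixes s t :: "('f, 'o, 'a) ntrans"
  assumes "Ndom s = Ndom t" "Ncod s = Ncod t" "Ncmp s \<in> extensional A" "Ncmp t \<in> extensional A"
    and "\<And>X. X \<in> A \<Longrightarrow> Ncmp s X = Ncmp t X"
  shows "s = t"
  using assms(1,2) extensionalityI[OF assms(3-5)] by (cases s; cases t) simp

lemma mon2_sel [simp]:
  "Cells0 (mon2 S Q) = {M. S M}"
  "Cells1 (mon2 S Q) = {H. S (MDom H) \<and> S (MCod H) \<and> Q H}"
  "Cells2 (mon2 S Q) = {t. S (MDom (Ndom t)) \<and> S (MCod (Ndom t)) \<and> Q (Ndom t) \<and> Q (Ncod t) \<and>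
                  monoidal_natural (Ndom t) (Ncod t) (Ncmp t)}"
  "Src1 (mon2 S Q) = MDom" "Tgt1 (mon2 S Q) = MCod" "Id1 (mon2 S Q) = id_monfunc"
  "Comp1 (mon2 S Q) = comp_monfunc" "Src2 (mon2 S Q) = Ndom" "Tgt2 (mon2 S Q) = Ncod"
  "Id2 (mon2 S Q) = id_nt MFun" "VComp (mon2 S Q) = vcomp_nt MFun"
  "HComp (mon2 S Q) = hcomp_nt MFun comp_monfunc"
  by (simp_all add: mon2_def)

lemma cat1_sel [simp]:
  "Obj (cat1 K) = Cells0 K" "Arr (cat1 K) = Cells1 K" "Dom (cat1 K) = Src1 K" "Cod (cat1 K) = Tgt1 K"
  "Idn (cat1 K) = Id1 K" "Cmp (cat1 K) = Comp1 K"
  by (simp_all add: cat1_def)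

lemma vcat_sel [simp]:
  "Obj (vcat K) = Cells1 K" "Arr (vcat K) = Cells2 K" "Dom (vcat K) = Src2 K" "Cod (vcat K) = Tgt2 K"
  "Idn (vcat K) = Id2 K" "Cmp (vcat K) = VComp K"
  by (simp_all add: vcat_def)

lemma hcat_sel [simp]:
  "Obj (hcat K) = Cells0 K" "Arr (hcat K) = Cells2 K"
  "Dom (hcat K) c = Src1 K (Src2 K c)" "Cod (hcat K) c = Tgt1 K (Tgt2 K c)"
  "Idn (hcat K) A = Id2 K (Id1 K A)" "Cmp (hcat K) = HComp K"
  by (simp_all add: hcat_def)

lemma id_nt_sel [simp]:
  "Ndom (id_nt u F) = F" "Ncod (id_nt u F) = F"
  "\<lbrakk>Fdom (u F) = C; X \<in> Obj C\<rbrakk> \<Longrightarrow> Ncmp (id_nt u F) X = Idn (Fcod (u F)) (Fob (u F) X)"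
  "Fdom (u F) = C \<Longrightarrow> Ncmp (id_nt u F) \<in> extensional (Obj C)"
  by (auto simp: id_nt_def)

lemma vcomp_nt_sel [simp]:
  "Ndom (vcomp_nt u t s) = Ndom s" "Ncod (vcomp_nt u t s) = Ncod t"
  "\<lbrakk>Fdom (u (Ndom s)) = C; X \<in> Obj C\<rbrakk> \<Longrightarrow>
    Ncmp (vcomp_nt u t s) X = Ncmp t X \<cdot>\<^bsub>Fcod (u (Ndom s))\<^esub> Ncmp s X"
  "Fdom (u (Ndom s)) = C \<Longrightarrow> Ncmp (vcomp_nt u t s) \<in> extensional (Obj C)"
  by (auto simp: vcomp_nt_def)

lemma hcomp_nt_sel [simp]:
  "Ndom (hcomp_nt u c t s) = c (Ndom t) (Ndom s)" "Ncod (hcomp_nt u c t s) = c (Ncod t) (Ncod s)"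
  "\<lbrakk>Fdom (u (Ndom s)) = C; X \<in> Obj C\<rbrakk> \<Longrightarrow> Ncmp (hcomp_nt u c t s) X =
    Ncmp t (Fob (u (Ncod s)) X) \<cdot>\<^bsub>Fcod (u (Ndom t))\<^esub> Far (u (Ndom t)) (Ncmp s X)"
  "Fdom (u (Ndom s)) = C \<Longrightarrow> Ncmp (hcomp_nt u c t s) \<in> extensional (Obj C)"
  by (auto simp: hcomp_nt_def)

text \<open>Equality of 2-cells is decided by components, so the equations of a 2-category need only
  the typing and naturality collected here. Monoidality matters for closure under the two
  compositions, which is settled separately.\<close>

lemma monoidal_2cell:
  assumes "monoidal_natural H K t" "monoidal_functor H" "monoidal_functor K"
    and "MDom H = M" "MCod H = N" "MCat M = C" "MCat N = D" "MFun H = F" "MFun K = G"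
  shows "MDom K = M" "MCod K = N"
    and "category C" "category D" "is_functor F" "Fdom F = C" "Fcod F = D" 
      "is_functor G" "Fdom G = C" "Fcod G = D"
    and "t \<in> extensional (Obj C)"
    and "X \<in> Obj C \<Longrightarrow> t X \<in> Arr D"
    and "X \<in> Obj C \<Longrightarrow> Dom D (t X) = Fob F X"
    and "X \<in> Obj C \<Longrightarrow> Cod D (t X) = Fob G X"
    and "f \<in> Arr C \<Longrightarrow> t (Cod C f) \<cdot>\<^bsub>D\<^esub> Far F f = Far G f \<cdot>\<^bsub>D\<^esub> t (Dom C f)"
proof -
  note l = monoidal_natural_laws[OF assms(1,4-9)]
  show "MDom K = M" "MCod K = N" using l by blast+
  have F: "Fdom F = C" "Fcod F = D" "is_functor F"
    using monoidal_functor_simps(3-5)[OF assms(2)] assms(4-) by auto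
  then show "Fdom F = C" "Fcod F = D" "is_functor F" by blast+
  then show "category C" "category D" using functor_simps(1,2) by blast+
  note n = natural_simps[OF l(3), unfolded F]
  show "is_functor G" "Fdom G = C" "Fcod G = D" "t \<in> extensional (Obj C)"
    "X \<in> Obj C \<Longrightarrow> t X \<in> Arr D"
    "X \<in> Obj C \<Longrightarrow> Dom D (t X) = Fob F X"
    "X \<in> Obj C \<Longrightarrow> Cod D (t X) = Fob G X"
    "f \<in> Arr C \<Longrightarrow> t (Cod C f) \<cdot>\<^bsub>D\<^esub> Far F f = Far G f \<cdot>\<^bsub>D\<^esub> t (Dom C f)"
    using n by blast+
qed

text \<open>Since all monoidal transformations are taken as 2-cells, closure of \<open>Q\<close>
  under identities and composites is the only condition connecting the predicates with the
  structure. Both target 2-categories are instances.\<close>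

lemma two_category_mon2:
  assumes S: "\<And>M. S M \<Longrightarrow> monoidal_category M"
    and Q: "\<And>H. Q H \<Longrightarrow> monoidal_functor H"
    and Q_id: "\<And>M. S M \<Longrightarrow> Q (id_monfunc M)"
    and Q_comp: "\<And>H K. \<lbrakk>Q H; Q K; MCod H = MDom K\<rbrakk> \<Longrightarrow> Q (comp_monfunc K H)"
  shows "two_category (mon2 S Q)"
proof -
  let ?K = "mon2 S Q"
  have cell: "monoidal_natural (Ndom c) (Ncod c) (Ncmp c)" "monoidal_functor (Ndom c)"
    "monoidal_functor (Ncod c)" "MDom (Ncod c) = MDom (Ndom c)" "MCod (Ncod c) = MCod (Ndom c)"
    "S (MDom (Ndom c))" "S (MCod (Ndom c))" "Q (Ndom c)" "Q (Ncod c)"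
    if "c \<in> Cells2 ?K" for c
    using that Q monoidal_natural_laws(1,2)[OF _ refl refl refl refl refl refl] by auto
  have vc: "vcomp_nt MFun d c \<in> Cells2 ?K"
    if "c \<in> Cells2 ?K" "d \<in> Cells2 ?K" "Ncod c = Ndom d" for c d
  proof -
    have "monoidal_natural (Ndom c) (Ncod d) (Ncmp (vcomp_nt MFun d c))"
      using monoidal_natural_vcomp[OF cell(1)[OF that(1)], of "Ncod d" "Ncmp d"] 
        cell[OF that(1)] cell[OF that(2)] that(3) by (simp add: vcomp_nt_def)
    then show ?thesis using cell[OF that(1)] cell[OF that(2)] that(3) by simp
  qed
  have hc: "hcomp_nt MFun comp_monfunc d c \<in> Cells2 ?K"
    if "c \<in> Cells2 ?K" "d \<in> Cells2 ?K" "MCod (Ncod c) = MDom (Ndom d)" for c d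
  proof -
    have "monoidal_natural (comp_monfunc (Ndom d) (Ndom c)) (comp_monfunc (Ncod d) (Ncod c))
      (Ncmp (hcomp_nt MFun comp_monfunc d c))"
      using monoidal_natural_hcomp[OF cell(1)[OF that(1)] cell(1)[OF that(2)]]
        cell[OF that(1)] cell[OF that(2)] that(3) by (simp add: hcomp_nt_def)
    then show ?thesis using cell[OF that(1)] cell[OF that(2)] that(3) by (simp add: Q_comp)
  qed
  have ident: "id_nt MFun H \<in> Cells2 ?K" if "H \<in> Cells1 ?K" for H
    using that by (auto intro!: monoidal_natural_id Q)
  have cat1: "category (cat1 ?K)"
    by (rule categoryI) (auto simp: S Q Q_id Q_comp comp_monfunc_assoc)
  have vcat: "category (vcat ?K)"
  proof (rule categoryI, goal_cases)
    case (1 f)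
    \<comment> \<open>Membership in \<open>Cells2\<close> is kept folded here and below by
      withholding \<open>mon2_sel(3)\<close> from simp, so that \<open>cell\<close>,
      \<open>vc\<close>, \<open>hc\<close> and \<open>ident\<close> match it.\<close>
    then have "f \<in> Cells2 ?K" by (simp only: vcat_sel)
    then show ?case using cell(4-9)[of f] by (simp del: mon2_sel(3))
  next
    case (2 A) then show ?case using ident[of A] by (simp del: mon2_sel(3))
  next
    case (3 f g) then show ?case using vc[of f g] by (simp del: mon2_sel(3))
  next
    case (4 c)
    then have c: "c \<in> Cells2 ?K" by (simp del: mon2_sel(3))
    note [simp] = monoidal_2cell(1-14)[OF cell(1-3)[OF c] refl refl refl refl refl refl]
    show ?case
      by (simp, intro conjI; rule ntrans_eqI[of _ _ "Obj (MCat (MDom (Ndom c)))"];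
          simp add: cell(2,3)[OF c])
  next
    case (5 c d e)
    then have c: "c \<in> Cells2 ?K" and d: "d \<in> Cells2 ?K" and e: "e \<in> Cells2 ?K"
      and cd: "Ncod c = Ndom d" "Ncod d = Ndom e" by (simp_all del: mon2_sel(3))
    obtain M N C D F G where n: "MDom (Ndom c) = M" "MCod (Ndom c) = N" "MCat M = C" "MCat N = D"
      "MFun (Ndom c) = F" "MFun (Ncod c) = G" by blast
    note lc = monoidal_2cell[OF cell(1-3)[OF c] n]
    \<comment> \<open>The data of \<open>Ndom d\<close> are read off from those of
      \<open>Ncod c\<close>, so that all three cells are described by the same \<open>M\<close>,
      \<open>N\<close>, \<open>C\<close>, \<open>D\<close>.\<close>
    note ld = monoidal_2cell[OF cell(1-3)[OF d] lc(1,2)[unfolded cd] n(3,4) n(6)[unfolded cd] refl]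
    note le = monoidal_2cell[OF cell(1-3)[OF e] ld(1,2)[unfolded cd] n(3,4) refl refl]
    note [simp] = lc(1-14) ld(1-14) le(1-14) n cd n(6)[unfolded cd] lc(1,2)[unfolded cd] ld(1,2)[unfolded cd]
    show ?case
      by (simp, rule ntrans_eqI[of _ _ "Obj C"]; simp add: cell(2,3)[OF c])
  qed
  have hcat: "category (hcat ?K)"
  proof (rule categoryI, goal_cases)
    case (1 f)
    then have "f \<in> Cells2 ?K" by (simp only: hcat_sel)
    then show ?case using cell(4-9)[of f] by (simp del: mon2_sel(3))
  next
    case (2 A) then show ?case using ident[of "id_monfunc A"] Q_id by (simp del: mon2_sel(3))
  next
    case (3 f g) then show ?case using hc[of f g] by (simp del: mon2_sel(3))
  next
    case (4 c)
    then have c: "c \<in> Cells2 ?K" by (simp del: mon2_sel(3))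
    note [simp] = monoidal_2cell(1-14)[OF cell(1-3)[OF c] refl refl refl refl refl refl]
    show ?case
      by (simp, intro conjI; rule ntrans_eqI[of _ _ "Obj (MCat (MDom (Ndom c)))"];
          simp add: cell(2,3)[OF c])
  next
    case (5 c d e)
    then have c: "c \<in> Cells2 ?K" and d: "d \<in> Cells2 ?K" and e: "e \<in> Cells2 ?K"
      and cd: "MCod (Ncod c) = MDom (Ndom d)" "MCod (Ncod d) = MDom (Ndom e)" by (simp_all del: mon2_sel(3))
    obtain M N C D F G where n: "MDom (Ndom c) = M" "MCod (Ndom c) = N" "MCat M = C" "MCat N = D"
      "MFun (Ndom c) = F" "MFun (Ncod c) = G" by blast
    note lc = monoidal_2cell[OF cell(1-3)[OF c] n]
    have n': "MDom (Ndom d) = N" using lc cd by simp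
    note ld = monoidal_2cell[OF cell(1-3)[OF d] n' refl n(4) refl refl refl]
    have n'': "MDom (Ndom e) = MCod (Ndom d)" using ld cd by simp
    note le = monoidal_2cell[OF cell(1-3)[OF e] n'' refl refl refl refl refl]
    note [simp] = lc(1-14) ld(1-14) le(1-14) n n' n''
    show ?case
      by (simp, rule ntrans_eqI[of _ _ "Obj C"];
          simp add: cell(2,3)[OF c] cell(2,3)[OF d] cell(2,3)[OF e] comp_monfunc_assoc)
  qed
  have hid: "hcomp_nt MFun comp_monfunc (id_nt MFun K) (id_nt MFun H) = id_nt MFun (comp_monfunc K H)"
    if "H \<in> Cells1 ?K" "K \<in> Cells1 ?K" "MCod H = MDom K" for H K
  proof -
    have [simp]: "monoidal_functor H" "monoidal_functor K" using that Q by auto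
    show ?thesis
      by (rule ntrans_eqI[of _ _ "Obj (MCat (MDom H))"]) (simp_all add: that(3))
  qed
  have interchange: "hcomp_nt MFun comp_monfunc (vcomp_nt MFun d' d) (vcomp_nt MFun c' c) =
      vcomp_nt MFun (hcomp_nt MFun comp_monfunc d' c') (hcomp_nt MFun comp_monfunc d c)"
    if c: "c \<in> Cells2 ?K" and c': "c' \<in> Cells2 ?K" and d: "d \<in> Cells2 ?K" and d': "d' \<in> Cells2 ?K"
      and cd: "Ncod c = Ndom c'" "Ncod d = Ndom d'" "MCod (Ncod c) = MDom (Ndom d)"
    for c c' d d'
  proof -
    obtain M N C D F G where n: "MDom (Ndom c) = M" "MCod (Ndom c) = N" "MCat M = C" "MCat N = D"
      "MFun (Ndom c) = F" "MFun (Ncod c) = G" by blast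
    note lc = monoidal_2cell[OF cell(1-3)[OF c] n]
    note lc' = monoidal_2cell[OF cell(1-3)[OF c'] lc(1,2)[unfolded cd] n(3,4) n(6)[unfolded cd] refl]
    obtain R E where n': "MDom (Ndom d) = N" "MCod (Ndom d) = R" "MCat R = E" using lc cd by auto
    note ld = monoidal_2cell[OF cell(1-3)[OF d] n'(1,2) n(4) n'(3) refl refl]
    note ld' = monoidal_2cell[OF cell(1-3)[OF d'] ld(1,2)[unfolded cd] n(4) n'(3) refl refl]
    \<comment> \<open>Among the 2-category equations only interchange uses naturality:
      \<open>d\<close> has to move past the image of a component of \<open>c'\<close>.\<close>
    have nat: "Ncmp d B \<cdot>\<^bsub>E\<^esub> Far (MFun (Ndom d)) f = Far (MFun (Ncod d)) f \<cdot>\<^bsub>E\<^esub> Ncmp d A"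
      if "f \<in> Arr D" "Dom D f = A" "Cod D f = B" for f A B
      using ld(15)[of f] that by simp
    note [simp] = lc(1-14) lc'(1-14) ld(1-14) ld'(1-14) n n' cd n(6)[unfolded cd] lc(1,2)[unfolded cd]
      ld(1,2)[unfolded cd]
    show ?thesis
      by (rule ntrans_eqI[of _ _ "Obj C"];
          simp add: comp_prefix[of E, OF _ _ _ _ _ _ nat])
  qed
  show ?thesis
    unfolding two_category_def
    using cat1 vcat hcat cell(4,5) hid interchange
    by (intro conjI ballI impI) (simp_all del: mon2_sel(3))
qed

section \<open>Finite products and internal groups\<close>

lemma finite_products_simps [simp]:
  assumes "finite_products C S"
  shows "One S \<in> Obj C"
    and "\<lbrakk>A \<in> Obj C; B \<in> Obj C\<rbrakk> \<Longrightarrow> Prd S A B \<in> Obj C"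
    and "\<lbrakk>A \<in> Obj C; B \<in> Obj C\<rbrakk> \<Longrightarrow> Pr1 S A B \<in> Arr C"
    and "\<lbrakk>A \<in> Obj C; B \<in> Obj C\<rbrakk> \<Longrightarrow> Dom C (Pr1 S A B) = Prd S A B"
    and "\<lbrakk>A \<in> Obj C; B \<in> Obj C\<rbrakk> \<Longrightarrow> Cod C (Pr1 S A B) = A"
    and "\<lbrakk>A \<in> Obj C; B \<in> Obj C\<rbrakk> \<Longrightarrow> Pr2 S A B \<in> Arr C"
    and "\<lbrakk>A \<in> Obj C; B \<in> Obj C\<rbrakk> \<Longrightarrow> Dom C (Pr2 S A B) = Prd S A B"
    and "\<lbrakk>A \<in> Obj C; B \<in> Obj C\<rbrakk> \<Longrightarrow> Cod C (Pr2 S A B) = B"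
proof -
  show "One S \<in> Obj C" using assms unfolding finite_products_def by (elim conjE)
next
  assume A: "A \<in> Obj C" and B: "B \<in> Obj C"
  note laws = assms[unfolded finite_products_def, THEN conjunct2, THEN conjunct2, THEN conjunct2,
      THEN bspec, OF A, THEN bspec, OF B]
  show "Prd S A B \<in> Obj C" by (rule laws[THEN conjunct1])
  show "Pr1 S A B \<in> Arr C" "Dom C (Pr1 S A B) = Prd S A B" "Cod C (Pr1 S A B) = A"
    using laws[THEN conjunct2, THEN conjunct1] by simp_all
  show "Pr2 S A B \<in> Arr C" "Dom C (Pr2 S A B) = Prd S A B" "Cod C (Pr2 S A B) = B"
    using laws[THEN conjunct2, THEN conjunct2, THEN conjunct1] by simp_all
qed

lemma finite_products_category: "finite_products C S \<Longrightarrow> category C"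
  unfolding finite_products_def by (elim conjE)

lemma prod_arrow_unique:
  assumes "finite_products C S" "A \<in> Obj C" "B \<in> Obj C"
    and "f \<in> Arr C" "Dom C f = Z" "Cod C f = A" "g \<in> Arr C" "Dom C g = Z" "Cod C g = B"
  shows "\<exists>!h. h \<in> hom C Z (Prd S A B) \<and> Pr1 S A B \<cdot>\<^bsub>C\<^esub> h = f \<and> Pr2 S A B \<cdot>\<^bsub>C\<^esub> h = g"
proof -
  have Z: "Z \<in> Obj C" and f: "f \<in> hom C Z A" and g: "g \<in> hom C Z B"
    using assms finite_products_category[OF assms(1)] by auto
  note * = assms(1)[unfolded finite_products_def, THEN conjunct2, THEN conjunct2, THEN conjunct2,
      THEN bspec, OF assms(2), THEN bspec, OF assms(3), THEN conjunct2, THEN conjunct2,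
      THEN conjunct2]
  show ?thesis by (rule *[THEN bspec, OF Z, THEN bspec, OF f, THEN bspec, OF g])
qed

lemma pairing_simps [simp]:
  assumes "finite_products C S" "f \<in> Arr C" "g \<in> Arr C" "Dom C f = Dom C g"
  shows "pairing C S f g \<in> Arr C"
    and "Dom C (pairing C S f g) = Dom C g"
    and "Cod C (pairing C S f g) = Prd S (Cod C f) (Cod C g)"
    and "\<lbrakk>Cod C f = A; Cod C g = B\<rbrakk> \<Longrightarrow> Pr1 S A B \<cdot>\<^bsub>C\<^esub> pairing C S f g = f"
    and "\<lbrakk>Cod C f = A; Cod C g = B\<rbrakk> \<Longrightarrow> Pr2 S A B \<cdot>\<^bsub>C\<^esub> pairing C S f g = g"
proof -
  have [simp]: "category C" using assms(1) by (rule finite_products_category)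
  have "\<exists>!h. h \<in> hom C (Dom C f) (Prd S (Cod C f) (Cod C g)) \<and>
      Pr1 S (Cod C f) (Cod C g) \<cdot>\<^bsub>C\<^esub> h = f \<and> Pr2 S (Cod C f) (Cod C g) \<cdot>\<^bsub>C\<^esub> h = g"
    by (rule prod_arrow_unique[OF assms(1)]) (use assms in simp_all)
  from theI'[OF this, folded pairing_def] show "pairing C S f g \<in> Arr C"
    "Dom C (pairing C S f g) = Dom C g"
    "Cod C (pairing C S f g) = Prd S (Cod C f) (Cod C g)"
    "\<lbrakk>Cod C f = A; Cod C g = B\<rbrakk> \<Longrightarrow> Pr1 S A B \<cdot>\<^bsub>C\<^esub> pairing C S f g = f"
    "\<lbrakk>Cod C f = A; Cod C g = B\<rbrakk> \<Longrightarrow> Pr2 S A B \<cdot>\<^bsub>C\<^esub> pairing C S f g = g"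
    using assms(4) by auto
qed

text \<open>The projections are jointly monic; this is the uniqueness half of the universal
  property.\<close>

lemma pairing_eqI:
  assumes "finite_products C S" "A \<in> Obj C" "B \<in> Obj C"
    and "h \<in> Arr C" "k \<in> Arr C" "Dom C h = Dom C k" "Cod C h = Prd S A B" "Cod C k = Prd S A B"
    and "Pr1 S A B \<cdot>\<^bsub>C\<^esub> h = Pr1 S A B \<cdot>\<^bsub>C\<^esub> k" "Pr2 S A B \<cdot>\<^bsub>C\<^esub> h = Pr2 S A B \<cdot>\<^bsub>C\<^esub> k"
  shows "h = k"
proof -
  have [simp]: "category C" using assms(1) by (rule finite_products_category)
  have "\<exists>!l. l \<in> hom C (Dom C h) (Prd S A B) \<and>
      Pr1 S A B \<cdot>\<^bsub>C\<^esub> l = Pr1 S A B \<cdot>\<^bsub>C\<^esub> h \<and> Pr2 S A B \<cdot>\<^bsub>C\<^esub> l = Pr2 S A B \<cdot>\<^bsub>C\<^esub> h"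
    by (rule prod_arrow_unique[OF assms(1)]) (use assms in simp_all)
  then show ?thesis using assms by auto
qed

lemma pairing_Pr [simp]:
  assumes "finite_products C S" "A \<in> Obj C" "B \<in> Obj C"
  shows "pairing C S (Pr1 S A B) (Pr2 S A B) = Idn C (Prd S A B)"
  by (rule pairing_eqI[of C S A B, OF assms(1-3)])
    (use assms finite_products_category[OF assms(1)] in simp_all)

lemma pairing_comp [simp]:
  assumes "finite_products C S" "f \<in> Arr C" "g \<in> Arr C" "Dom C f = Dom C g"
    and "w \<in> Arr C" "Cod C w = Dom C g"
  shows "pairing C S f g \<cdot>\<^bsub>C\<^esub> w = pairing C S (f \<cdot>\<^bsub>C\<^esub> w) (g \<cdot>\<^bsub>C\<^esub> w)"
proof -
  have [simp]: "category C" using assms(1) by (rule finite_products_category)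
  have "Pr1 S (Cod C f) (Cod C g) \<cdot>\<^bsub>C\<^esub> pairing C S f g \<cdot>\<^bsub>C\<^esub> w = f \<cdot>\<^bsub>C\<^esub> w"
    using comp_prefix[of C w "pairing C S f g" "Pr1 S (Cod C f) (Cod C g)" f] assms by simp
  moreover have "Pr2 S (Cod C f) (Cod C g) \<cdot>\<^bsub>C\<^esub> pairing C S f g \<cdot>\<^bsub>C\<^esub> w = g \<cdot>\<^bsub>C\<^esub> w"
    using comp_prefix[of C w "pairing C S f g" "Pr2 S (Cod C f) (Cod C g)" g] assms by simp
  ultimately show ?thesis
    by - (rule pairing_eqI[of C S "Cod C f" "Cod C g"]; use assms in simp)
qed

text \<open>The last clause evaluates on a pair of generalized elements. Together with the
  corresponding clauses for \<open>prod_assoc\<close> and \<open>prod_swap\<close> it lets simp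
  compute in products as one does with tuples.\<close>

lemma prod_arr_simps [simp]:
  assumes "finite_products C S" "f \<in> Arr C" "g \<in> Arr C"
  shows "prod_arr C S f g \<in> Arr C"
    and "Dom C (prod_arr C S f g) = Prd S (Dom C f) (Dom C g)"
    and "Cod C (prod_arr C S f g) = Prd S (Cod C f) (Cod C g)"
    and "\<lbrakk>x \<in> Arr C; y \<in> Arr C; Dom C x = Dom C y; Cod C x = Dom C f; Cod C y = Dom C g\<rbrakk> \<Longrightarrow>
      prod_arr C S f g \<cdot>\<^bsub>C\<^esub> pairing C S x y = pairing C S (f \<cdot>\<^bsub>C\<^esub> x) (g \<cdot>\<^bsub>C\<^esub> y)"
proof -
  have [simp]: "category C" using assms(1) by (rule finite_products_category)
  show "prod_arr C S f g \<in> Arr C"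
    and "Dom C (prod_arr C S f g) = Prd S (Dom C f) (Dom C g)"
    and "Cod C (prod_arr C S f g) = Prd S (Cod C f) (Cod C g)"
    and "\<lbrakk>x \<in> Arr C; y \<in> Arr C; Dom C x = Dom C y; Cod C x = Dom C f; Cod C y = Dom C g\<rbrakk> \<Longrightarrow>
      prod_arr C S f g \<cdot>\<^bsub>C\<^esub> pairing C S x y = pairing C S (f \<cdot>\<^bsub>C\<^esub> x) (g \<cdot>\<^bsub>C\<^esub> y)"
    using assms by (simp_all add: prod_arr_def)
qed

lemma prod_arr_Idn [simp]:
  assumes "finite_products C S" "A \<in> Obj C" "B \<in> Obj C"
  shows "prod_arr C S (Idn C A) (Idn C B) = Idn C (Prd S A B)"
  using assms finite_products_category[OF assms(1)] by (simp add: prod_arr_def)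

lemma prod_arr_comp:
  assumes "finite_products C S" "f \<in> Arr C" "g \<in> Arr C" "f' \<in> Arr C" "g' \<in> Arr C"
    and "Cod C f = Dom C f'" "Cod C g = Dom C g'"
  shows "prod_arr C S (f' \<cdot>\<^bsub>C\<^esub> f) (g' \<cdot>\<^bsub>C\<^esub> g) = prod_arr C S f' g' \<cdot>\<^bsub>C\<^esub> prod_arr C S f g"
proof -
  have [simp]: "category C" using assms(1) by (rule finite_products_category)
  note [simp] = assms
  let ?p = "Pr1 S (Dom C f) (Dom C g)" and ?q = "Pr2 S (Dom C f) (Dom C g)"
  have "prod_arr C S f' g' \<cdot>\<^bsub>C\<^esub> prod_arr C S f g =
      prod_arr C S f' g' \<cdot>\<^bsub>C\<^esub> pairing C S (f \<cdot>\<^bsub>C\<^esub> ?p) (g \<cdot>\<^bsub>C\<^esub> ?q)"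
    by (simp only: prod_arr_def[of C S f g])
  also have "\<dots> = pairing C S (f' \<cdot>\<^bsub>C\<^esub> f \<cdot>\<^bsub>C\<^esub> ?p) (g' \<cdot>\<^bsub>C\<^esub> g \<cdot>\<^bsub>C\<^esub> ?q)"
    by simp
  also have "\<dots> = prod_arr C S (f' \<cdot>\<^bsub>C\<^esub> f) (g' \<cdot>\<^bsub>C\<^esub> g)"
    by (simp add: prod_arr_def)
  finally show ?thesis by simp
qed

lemma prod_assoc_simps [simp]:
  assumes "finite_products C S" "X \<in> Obj C" "Y \<in> Obj C" "Z \<in> Obj C"
  shows "prod_assoc C S X Y Z \<in> Arr C"
    and "Dom C (prod_assoc C S X Y Z) = Prd S (Prd S X Y) Z"
    and "Cod C (prod_assoc C S X Y Z) = Prd S X (Prd S Y Z)"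
    and "\<lbrakk>x \<in> Arr C; y \<in> Arr C; z \<in> Arr C; Dom C x = Dom C y; Dom C y = Dom C z; Cod C x = X;
        Cod C y = Y; Cod C z = Z\<rbrakk> \<Longrightarrow>
      prod_assoc C S X Y Z \<cdot>\<^bsub>C\<^esub> pairing C S (pairing C S x y) z =
      pairing C S x (pairing C S y z)"
proof -
  have [simp]: "category C" using assms(1) by (rule finite_products_category)
  show "prod_assoc C S X Y Z \<in> Arr C"
    and "Dom C (prod_assoc C S X Y Z) = Prd S (Prd S X Y) Z"
    and "Cod C (prod_assoc C S X Y Z) = Prd S X (Prd S Y Z)"
    and "\<lbrakk>x \<in> Arr C; y \<in> Arr C; z \<in> Arr C; Dom C x = Dom C y; Dom C y = Dom C z; Cod C x = X;
        Cod C y = Y; Cod C z = Z\<rbrakk> \<Longrightarrow>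
      prod_assoc C S X Y Z \<cdot>\<^bsub>C\<^esub> pairing C S (pairing C S x y) z =
      pairing C S x (pairing C S y z)"
    using assms by (simp_all add: prod_assoc_def)
qed

lemma prod_swap_simps [simp]:
  assumes "finite_products C S" "X \<in> Obj C" "Y \<in> Obj C"
  shows "prod_swap C S X Y \<in> Arr C"
    and "Dom C (prod_swap C S X Y) = Prd S X Y"
    and "Cod C (prod_swap C S X Y) = Prd S Y X"
    and "\<lbrakk>x \<in> Arr C; y \<in> Arr C; Dom C x = Dom C y; Cod C x = X; Cod C y = Y\<rbrakk> \<Longrightarrow>
      prod_swap C S X Y \<cdot>\<^bsub>C\<^esub> pairing C S x y = pairing C S y x"
proof -
  have [simp]: "category C" using assms(1) by (rule finite_products_category)
  show "prod_swap C S X Y \<in> Arr C"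
    and "Dom C (prod_swap C S X Y) = Prd S X Y"
    and "Cod C (prod_swap C S X Y) = Prd S Y X"
    and "\<lbrakk>x \<in> Arr C; y \<in> Arr C; Dom C x = Dom C y; Cod C x = X; Cod C y = Y\<rbrakk> \<Longrightarrow>
      prod_swap C S X Y \<cdot>\<^bsub>C\<^esub> pairing C S x y = pairing C S y x"
    using assms by (simp_all add: prod_swap_def)
qed

section \<open>Terminal object and internal groups\<close>

lemma bang_eq:
  assumes "finite_products C S" "f \<in> Arr C" "Cod C f = One S"
  shows "f = bang C S (Dom C f)"
proof -
  have "\<exists>!g. g \<in> hom C (Dom C f) (One S)"
    using assms finite_products_category[OF assms(1)] unfolding finite_products_def by auto
  moreover have "f \<in> hom C (Dom C f) (One S)" using assms by simp
  ultimately show ?thesis unfolding bang_def by (metis theI')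
qed

lemma bang_simps [simp]:
  assumes "finite_products C S"
  shows "A \<in> Obj C \<Longrightarrow> bang C S A \<in> Arr C"
    and "A \<in> Obj C \<Longrightarrow> Dom C (bang C S A) = A"
    and "A \<in> Obj C \<Longrightarrow> Cod C (bang C S A) = One S"
    and "\<lbrakk>w \<in> Arr C; Cod C w = A\<rbrakk> \<Longrightarrow> bang C S A \<cdot>\<^bsub>C\<^esub> w = bang C S (Dom C w)"
proof -
  have [simp]: "category C" using assms(1) by (rule finite_products_category)
  have *: "A \<in> Obj C \<Longrightarrow> bang C S A \<in> hom C A (One S)" for A
    using assms unfolding finite_products_def bang_def by (metis theI')
  then show "A \<in> Obj C \<Longrightarrow> bang C S A \<in> Arr C" "A \<in> Obj C \<Longrightarrow> Dom C (bang C S A) = A"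
    "A \<in> Obj C \<Longrightarrow> Cod C (bang C S A) = One S" by simp_all
  assume "w \<in> Arr C" "Cod C w = A"
  moreover from this have "A \<in> Obj C" by auto
  ultimately show "bang C S A \<cdot>\<^bsub>C\<^esub> w = bang C S (Dom C w)"
    using *[of A] bang_eq[OF assms, of "bang C S A \<cdot>\<^bsub>C\<^esub> w"] by simp
qed

text \<open>The two inverse laws are stated for an arbitrary element \<open>x\<close> of the
  carrier, obtained by precomposing the axioms with it.\<close>

lemma internal_group_simps:
  assumes "internal_group C S G" "finite_products C S"
  shows "Carr G \<in> Obj C"
    and "Mul G \<in> Arr C" "Dom C (Mul G) = Prd S (Carr G) (Carr G)" "Cod C (Mul G) = Carr G"
    and "Neu G \<in> Arr C" "Dom C (Neu G) = One S" "Cod C (Neu G) = Carr G"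
    and "Inv G \<in> Arr C" "Dom C (Inv G) = Carr G" "Cod C (Inv G) = Carr G"
    and "\<lbrakk>x \<in> Arr C; Cod C x = Carr G\<rbrakk> \<Longrightarrow>
      Mul G \<cdot>\<^bsub>C\<^esub> pairing C S (Inv G \<cdot>\<^bsub>C\<^esub> x) x = Neu G \<cdot>\<^bsub>C\<^esub> bang C S (Dom C x)"
    and "\<lbrakk>x \<in> Arr C; Cod C x = Carr G\<rbrakk> \<Longrightarrow>
      Mul G \<cdot>\<^bsub>C\<^esub> pairing C S x (Inv G \<cdot>\<^bsub>C\<^esub> x) = Neu G \<cdot>\<^bsub>C\<^esub> bang C S (Dom C x)"
proof -
  have [simp]: "category C" "finite_products C S"
    using assms(2) finite_products_category[OF assms(2)] by simp_all
  note laws = assms(1)[unfolded internal_group_def Let_def hom_iff]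
  show ty: "Carr G \<in> Obj C" "Mul G \<in> Arr C" "Dom C (Mul G) = Prd S (Carr G) (Carr G)"
    "Cod C (Mul G) = Carr G" "Neu G \<in> Arr C" "Dom C (Neu G) = One S" "Cod C (Neu G) = Carr G"
    "Inv G \<in> Arr C" "Dom C (Inv G) = Carr G" "Cod C (Inv G) = Carr G"
    using laws by blast+
  note [simp] = ty
  { assume x: "x \<in> Arr C" "Cod C x = Carr G"
    have "Mul G \<cdot>\<^bsub>C\<^esub> pairing C S (Inv G) (Idn C (Carr G)) = Neu G \<cdot>\<^bsub>C\<^esub> bang C S (Carr G)"
      using laws by blast
    from arg_cong[OF this, of "\<lambda>f. f \<cdot>\<^bsub>C\<^esub> x"] x
    show "Mul G \<cdot>\<^bsub>C\<^esub> pairing C S (Inv G \<cdot>\<^bsub>C\<^esub> x) x = Neu G \<cdot>\<^bsub>C\<^esub> bang C S (Dom C x)" by simp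
    have "Mul G \<cdot>\<^bsub>C\<^esub> pairing C S (Idn C (Carr G)) (Inv G) = Neu G \<cdot>\<^bsub>C\<^esub> bang C S (Carr G)"
      using laws by blast
    from arg_cong[OF this, of "\<lambda>f. f \<cdot>\<^bsub>C\<^esub> x"] x
    show "Mul G \<cdot>\<^bsub>C\<^esub> pairing C S x (Inv G \<cdot>\<^bsub>C\<^esub> x) = Neu G \<cdot>\<^bsub>C\<^esub> bang C S (Dom C x)" by simp }
qed

lemma internal_group_hom_simps:
  assumes "internal_group_hom C S h"
  shows "internal_group C S (Gdom h)" "internal_group C S (Gcod h)"
    and "Gmap h \<in> Arr C" "Dom C (Gmap h) = Carr (Gdom h)" "Cod C (Gmap h) = Carr (Gcod h)"
    and "Gmap h \<cdot>\<^bsub>C\<^esub> Neu (Gdom h) = Neu (Gcod h)"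
  using assms(1)[unfolded internal_group_hom_def hom_iff] by blast+

section \<open>Opfibrations with groupoid fibres\<close>

text \<open>These remain equations between arrows. They compare the images in the base of the two
  arrows given to \<open>vfact\<close>, where composites of products of arrows occur and not
  elements.\<close>

lemma internal_group_laws:
  assumes "internal_group C S G"
  shows "Mul G \<cdot>\<^bsub>C\<^esub> prod_arr C S (Mul G) (Idn C (Carr G)) =
      Mul G \<cdot>\<^bsub>C\<^esub> prod_arr C S (Idn C (Carr G)) (Mul G) \<cdot>\<^bsub>C\<^esub> prod_assoc C S (Carr G) (Carr G) (Carr G)"
    and "Mul G \<cdot>\<^bsub>C\<^esub> prod_arr C S (Neu G) (Idn C (Carr G)) = Pr2 S (One S) (Carr G)"
    and "Mul G \<cdot>\<^bsub>C\<^esub> prod_arr C S (Idn C (Carr G)) (Neu G) = Pr1 S (Carr G) (One S)"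
  using assms[unfolded internal_group_def Let_def] by blast+

section \<open>The total category, its fibres and cocartesian arrows\<close>

locale groupoid_opfibration =
  fixes E :: "('xo, 'xa, 'bo, 'ba) opfib"
  assumes cmo: "cartesian_monoidal_opfibration E"
    and groupoid_fibre: "A \<in> Obj (Bas E) \<Longrightarrow> groupoid (fibre E A)"
begin

abbreviation "T \<equiv> Tot E"
abbreviation "B \<equiv> Bas E"
abbreviation "S \<equiv> TProd E"
abbreviation "SB \<equiv> BProd E"
abbreviation "pO \<equiv> Fob (Proj E)"
abbreviation "pF \<equiv> Far (Proj E)"

lemma opfib_simps [simp]:
  "is_functor (Proj E)" "finite_products T S" "finite_products B SB"
  "pO (One S) = One SB"
  "\<lbrakk>X \<in> Obj T; Y \<in> Obj T\<rbrakk> \<Longrightarrow> pO (Prd S X Y) = Prd SB (pO X) (pO Y)"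
  "\<lbrakk>X \<in> Obj T; Y \<in> Obj T\<rbrakk> \<Longrightarrow> pF (Pr1 S X Y) = Pr1 SB (pO X) (pO Y)"
  "\<lbrakk>X \<in> Obj T; Y \<in> Obj T\<rbrakk> \<Longrightarrow> pF (Pr2 S X Y) = Pr2 SB (pO X) (pO Y)"
  using cmo unfolding cartesian_monoidal_opfibration_def cloven_opfibration_def by blast+

lemma category_TB [simp]: "category T" "category B"
  using finite_products_category[of T S] finite_products_category[of B SB] by simp_all

text \<open>An arrow into a product is determined by its two projections, and these are preserved
  strictly.\<close>

lemma pF_pairing [simp]:
  assumes [simp]: "f \<in> Arr T" "g \<in> Arr T" "Dom T f = Dom T g"
  shows "pF (pairing T S f g) = pairing B SB (pF f) (pF g)"
proof (rule pairing_eqI[of B SB "pO (Cod T f)" "pO (Cod T g)"])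
  have "pF (Pr1 S (Cod T f) (Cod T g) \<cdot>\<^bsub>T\<^esub> pairing T S f g) = pF f" by simp
  then show "Pr1 SB (pO (Cod T f)) (pO (Cod T g)) \<cdot>\<^bsub>B\<^esub> pF (pairing T S f g) =
    Pr1 SB (pO (Cod T f)) (pO (Cod T g)) \<cdot>\<^bsub>B\<^esub> pairing B SB (pF f) (pF g)"
    \<comment> \<open>Functoriality is applied by hand: simp alone would first contract the
      projection of the pairing and lose the composite.\<close>
    by (subst (asm) functor_simps(10)) simp_all
  have "pF (Pr2 S (Cod T f) (Cod T g) \<cdot>\<^bsub>T\<^esub> pairing T S f g) = pF g" by simp
  then show "Pr2 SB (pO (Cod T f)) (pO (Cod T g)) \<cdot>\<^bsub>B\<^esub> pF (pairing T S f g) =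
    Pr2 SB (pO (Cod T f)) (pO (Cod T g)) \<cdot>\<^bsub>B\<^esub> pairing B SB (pF f) (pF g)"
    by (subst (asm) functor_simps(10)) simp_all
qed simp_all

lemma pF_prod_arr [simp]:
  "\<lbrakk>f \<in> Arr T; g \<in> Arr T\<rbrakk> \<Longrightarrow> pF (prod_arr T S f g) = prod_arr B SB (pF f) (pF g)"
  by (simp add: prod_arr_def)

lemma pF_prod_assoc [simp]:
  "\<lbrakk>X \<in> Obj T; Y \<in> Obj T; Z \<in> Obj T\<rbrakk> \<Longrightarrow>
    pF (prod_assoc T S X Y Z) = prod_assoc B SB (pO X) (pO Y) (pO Z)"
  by (simp add: prod_assoc_def)

lemma pF_prod_swap [simp]:
  "\<lbrakk>X \<in> Obj T; Y \<in> Obj T\<rbrakk> \<Longrightarrow> pF (prod_swap T S X Y) = prod_swap B SB (pO X) (pO Y)"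
  by (simp add: prod_swap_def)

lemma pF_bang [simp]: "X \<in> Obj T \<Longrightarrow> pF (bang T S X) = bang B SB (pO X)"
  using bang_eq[of B SB "pF (bang T S X)"] by simp

lemma fibre_sel [simp]:
  "Obj (fibre E A) = {X \<in> Obj T. pO X = A}"
  "Arr (fibre E A) = {x \<in> Arr T. pF x = Idn B A}"
  "Dom (fibre E A) = Dom T" "Cod (fibre E A) = Cod T"
  "Idn (fibre E A) = Idn T" "Cmp (fibre E A) = Cmp T"
  by (simp_all add: fibre_def)

text \<open>Arrows of \<open>fibre\<close> are singled out by their image alone, so that their end
  points lie in the same fibre has to be read off from the end points of that image.\<close>

lemma vertical_ends:
  assumes "x \<in> Arr T" "pF x = Idn B A" "A \<in> Obj B"
  shows "pO (Dom T x) = A" "pO (Cod T x) = A"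
  using functor_simps(7,8)[of "Proj E" B x] assms by auto

lemma category_fibre [simp]:
  assumes "A \<in> Obj B"
  shows "category (fibre E A)"
  by (rule categoryI) (use assms vertical_ends in auto)

lemma iso_fibre:
  assumes "A \<in> Obj B" "x \<in> Arr T" "pF x = Idn B A"
  shows "iso (fibre E A) x"
  using groupoid_fibre[OF assms(1)] assms(2,3) by (simp add: groupoid_def)

text \<open>Codomains of liftings are normalized to \<open>Fob (push E f) X\<close>, the form in
  which objects occur in the tensor and the unit of a fibre.\<close>

lemma lift_simps [simp]:
  assumes "f \<in> Arr B" "X \<in> Obj T" "pO X = Dom B f"
  shows "Lift E f X \<in> Arr T" "Dom T (Lift E f X) = X" "pF (Lift E f X) = f"
    and "Cod T (Lift E f X) = Fob (push E f) X"
    and "Fob (push E f) X \<in> Obj T" "pO (Fob (push E f) X) = Cod B f"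
proof -
  have l: "cocartesian (Proj E) (Lift E f X)" "Dom T (Lift E f X) = X" "pF (Lift E f X) = f"
    using cmo assms unfolding cartesian_monoidal_opfibration_def cloven_opfibration_def by blast+
  then show l': "Lift E f X \<in> Arr T" "Dom T (Lift E f X) = X" "pF (Lift E f X) = f"
    by (auto simp: cocartesian_def)
  show c: "Cod T (Lift E f X) = Fob (push E f) X"
    using assms by (simp add: push_def)
  show "Fob (push E f) X \<in> Obj T" "pO (Fob (push E f) X) = Cod B f"
    using category_simps(2)[of T, OF _ l'(1)] functor_simps(8)[of "Proj E" B, OF _ _ l'(1)] l'
    by (simp_all add: c)
qed

lemma cocartesianD:
  assumes "cocartesian (Proj E) \<phi>" "\<psi> \<in> Arr T" "h \<in> Arr B" "Dom T \<psi> = Dom T \<phi>"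
    "Dom B h = pO (Cod T \<phi>)" "Cod B h = pO (Cod T \<psi>)" "h \<cdot>\<^bsub>B\<^esub> pF \<phi> = pF \<psi>"
  shows "\<exists>!\<chi>. \<chi> \<in> hom T (Cod T \<phi>) (Cod T \<psi>) \<and> pF \<chi> = h \<and> \<chi> \<cdot>\<^bsub>T\<^esub> \<phi> = \<psi>"
  using assms unfolding cocartesian_def by blast

lemma cocartesian_unique:
  assumes "cocartesian (Proj E) \<phi>" "\<chi> \<in> Arr T" "\<chi>' \<in> Arr T" "Dom T \<chi> = Cod T \<phi>"
    "Dom T \<chi>' = Cod T \<phi>" "Cod T \<chi> = Cod T \<chi>'" "pF \<chi> = pF \<chi>'" "\<chi> \<cdot>\<^bsub>T\<^esub> \<phi> = \<chi>' \<cdot>\<^bsub>T\<^esub> \<phi>"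
  shows "\<chi> = \<chi>'"
proof -
  have "\<phi> \<in> Arr T" using assms(1) by (simp add: cocartesian_def)
  then have "\<exists>!\<xi>. \<xi> \<in> hom T (Cod T \<phi>) (Cod T (\<chi>' \<cdot>\<^bsub>T\<^esub> \<phi>)) \<and> pF \<xi> = pF \<chi>' \<and> \<xi> \<cdot>\<^bsub>T\<^esub> \<phi> = \<chi>' \<cdot>\<^bsub>T\<^esub> \<phi>"
    by (intro cocartesianD[OF assms(1)]) (use assms in simp_all)
  moreover have "\<chi> \<in> hom T (Cod T \<phi>) (Cod T (\<chi>' \<cdot>\<^bsub>T\<^esub> \<phi>))" "\<chi>' \<in> hom T (Cod T \<phi>) (Cod T (\<chi>' \<cdot>\<^bsub>T\<^esub> \<phi>))"
    using assms(2-6) \<open>\<phi> \<in> Arr T\<close> by simp_all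
  ultimately show ?thesis using assms(7,8) by (blast dest: ex1_implies_ex)
qed

lemma cocartesian_all:
  assumes \<phi>: "\<phi> \<in> Arr T"
  shows "cocartesian (Proj E) \<phi>"
proof -
  let ?A = "pO (Cod T \<phi>)"
  obtain l where l: "l \<in> Arr T" "Dom T l = Dom T \<phi>" "pF l = pF \<phi>" "pO (Cod T l) = ?A"
    "cocartesian (Proj E) l"
  proof
    show "cocartesian (Proj E) (Lift E (pF \<phi>) (Dom T \<phi>))"
      using cmo \<phi> unfolding cartesian_monoidal_opfibration_def cloven_opfibration_def by simp
  qed (use \<phi> in simp_all)
  have "\<exists>!\<chi>. \<chi> \<in> hom T (Cod T l) (Cod T \<phi>) \<and> pF \<chi> = Idn B ?A \<and> \<chi> \<cdot>\<^bsub>T\<^esub> l = \<phi>"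
    by (rule cocartesianD[OF l(5)]) (use \<phi> l in simp_all)
  then obtain v where v: "v \<in> Arr T" "Dom T v = Cod T l" "Cod T v = Cod T \<phi>" "pF v = Idn B ?A"
    "v \<cdot>\<^bsub>T\<^esub> l = \<phi>" by auto
  \<comment> \<open>The groupoid hypothesis on the fibres enters here.\<close>
  have "iso (fibre E ?A) v" using v \<phi> by (intro iso_fibre) auto
  then obtain w where w: "w \<in> Arr T" "Dom T w = Cod T \<phi>" "Cod T w = Cod T l" "pF w = Idn B ?A"
    "w \<cdot>\<^bsub>T\<^esub> v = Idn T (Cod T l)" "v \<cdot>\<^bsub>T\<^esub> w = Idn T (Cod T \<phi>)"
    using v by (auto simp: iso_def)
  \<comment> \<open>The inverse \<open>w\<close> of the vertical part turns \<open>\<phi>\<close>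
    back into the chosen lifting \<open>l\<close>, so factorizations through \<open>l\<close> and
    through \<open>\<phi>\<close> correspond.\<close>
  have w\<phi>: "w \<cdot>\<^bsub>T\<^esub> \<phi> = l"
    using comp_prefix[of T l v w, OF _ _ _ _ _ _ w(5)] v(1-3) w(1-4) l(1) by (simp add: v(5))
  show ?thesis
    unfolding cocartesian_def
  proof (intro conjI ballI impI \<phi>)
    fix \<psi> h assume \<psi>: "\<psi> \<in> Arr T" "h \<in> Arr B" "Dom T \<psi> = Dom T \<phi>" "Dom B h = ?A"
      "Cod B h = pO (Cod T \<psi>)" "h \<cdot>\<^bsub>B\<^esub> pF \<phi> = pF \<psi>"
    have "\<exists>!\<chi>. \<chi> \<in> hom T (Cod T l) (Cod T \<psi>) \<and> pF \<chi> = h \<and> \<chi> \<cdot>\<^bsub>T\<^esub> l = \<psi>"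
      by (rule cocartesianD[OF l(5)]) (use \<psi> l in simp_all)
    then obtain \<chi> where \<chi>: "\<chi> \<in> Arr T" "Dom T \<chi> = Cod T l" "Cod T \<chi> = Cod T \<psi>" "pF \<chi> = h"
      "\<chi> \<cdot>\<^bsub>T\<^esub> l = \<psi>" unfolding hom_iff by (elim ex1E conjE)
    show "\<exists>!\<chi>. \<chi> \<in> hom T (Cod T \<phi>) (Cod T \<psi>) \<and> pF \<chi> = h \<and> \<chi> \<cdot>\<^bsub>T\<^esub> \<phi> = \<psi>"
    \<comment> \<open>The factorization through \<open>l\<close>, transported along
      \<open>w\<close>.\<close>
    proof (rule ex1I[of _ "\<chi> \<cdot>\<^bsub>T\<^esub> w"])
      have "(\<chi> \<cdot>\<^bsub>T\<^esub> w) \<cdot>\<^bsub>T\<^esub> \<phi> = \<psi>"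
        using \<chi>(1,2) w(1-3) \<phi> by (simp add: w\<phi> \<chi>(5))
      moreover have "pF (\<chi> \<cdot>\<^bsub>T\<^esub> w) = h"
        using \<chi>(1,2,4) w(1-4) \<psi>(2,4) by simp
      ultimately show "\<chi> \<cdot>\<^bsub>T\<^esub> w \<in> hom T (Cod T \<phi>) (Cod T \<psi>) \<and> pF (\<chi> \<cdot>\<^bsub>T\<^esub> w) = h \<and>
          (\<chi> \<cdot>\<^bsub>T\<^esub> w) \<cdot>\<^bsub>T\<^esub> \<phi> = \<psi>"
        using \<chi>(1-3) w(1-3) by simp
    next
      fix \<xi> assume "\<xi> \<in> hom T (Cod T \<phi>) (Cod T \<psi>) \<and> pF \<xi> = h \<and> \<xi> \<cdot>\<^bsub>T\<^esub> \<phi> = \<psi>"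
      then have \<xi>: "\<xi> \<in> Arr T" "Dom T \<xi> = Cod T \<phi>" "Cod T \<xi> = Cod T \<psi>" "pF \<xi> = h" "\<xi> \<cdot>\<^bsub>T\<^esub> \<phi> = \<psi>"
        by auto
      \<comment> \<open>Transport in the other direction, along \<open>v\<close>, reduces uniqueness
        to that for the lifting \<open>l\<close>.\<close>
      have "\<xi> \<cdot>\<^bsub>T\<^esub> v = \<chi>"
      proof (rule cocartesian_unique[OF l(5)])
        show "pF (\<xi> \<cdot>\<^bsub>T\<^esub> v) = pF \<chi>" using \<chi>(4) \<xi>(1,2,4) v(1-4) \<psi>(2,4) by simp
        show "(\<xi> \<cdot>\<^bsub>T\<^esub> v) \<cdot>\<^bsub>T\<^esub> l = \<chi> \<cdot>\<^bsub>T\<^esub> l" using \<xi>(1,2) v(1-3) l(1) by (simp add: v(5) \<xi>(5) \<chi>(5))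
      qed (use \<xi>(1-3) v(1-3) \<chi>(1-3) in simp_all)
      then have "\<chi> \<cdot>\<^bsub>T\<^esub> w = (\<xi> \<cdot>\<^bsub>T\<^esub> v) \<cdot>\<^bsub>T\<^esub> w" by simp
      also have "\<dots> = \<xi>" using \<xi>(1,2) v(1-3) w(1-3) by (simp add: w(6))
      finally show "\<xi> = \<chi> \<cdot>\<^bsub>T\<^esub> w" by (rule sym)
    qed
  qed
qed

text \<open>The uniqueness clause of cocartesianness, now available for an arbitrary
  \<open>w\<close>. Below, \<open>f\<close> and \<open>g\<close> are always vertical over the same
  object, so their images agree at once and \<open>w\<close> can be chosen as the element on which
  both sides are easiest to evaluate.\<close>

lemma cancel:
  assumes "f \<in> Arr T" "g \<in> Arr T" "w \<in> Arr T" "Dom T f = Cod T w" "Dom T g = Cod T w"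
    "Cod T f = Cod T g" "pF f = pF g" "f \<cdot>\<^bsub>T\<^esub> w = g \<cdot>\<^bsub>T\<^esub> w"
  shows "f = g"
  using cocartesian_unique[OF cocartesian_all] assms by blast

text \<open>Because every arrow is cocartesian, any two arrows out of one object over the same base
  arrow are connected by a vertical one. The constraints of the fibres, the monoidal structure of
  change of base and the comparison of composites are all of this form.\<close>

lemma vfact_simps:
  assumes "\<phi> \<in> Arr T" "\<psi> \<in> Arr T" "Dom T \<phi> = Dom T \<psi>" "pF \<phi> = pF \<psi>"
  shows "vfact E \<phi> \<psi> \<in> Arr T" "Dom T (vfact E \<phi> \<psi>) = Cod T \<phi>" "Cod T (vfact E \<phi> \<psi>) = Cod T \<psi>"
    and "pF (vfact E \<phi> \<psi>) = Idn B (pO (Cod T \<phi>))" "vfact E \<phi> \<psi> \<cdot>\<^bsub>T\<^esub> \<phi> = \<psi>"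
proof -
  have "pO (Cod T \<phi>) = pO (Cod T \<psi>)"
    using functor_simps(8)[of "Proj E" B \<phi>] functor_simps(8)[of "Proj E" B \<psi>] assms by simp
  then have "\<exists>!\<chi>. \<chi> \<in> hom T (Cod T \<phi>) (Cod T \<psi>) \<and> pF \<chi> = Idn B (pO (Cod T \<phi>)) \<and> \<chi> \<cdot>\<^bsub>T\<^esub> \<phi> = \<psi>"
    by (intro cocartesianD cocartesian_all) (use assms in simp_all)
  from theI'[OF this, folded vfact_def]
  show "vfact E \<phi> \<psi> \<in> Arr T" "Dom T (vfact E \<phi> \<psi>) = Cod T \<phi>" "Cod T (vfact E \<phi> \<psi>) = Cod T \<psi>"
    "pF (vfact E \<phi> \<psi>) = Idn B (pO (Cod T \<phi>))" "vfact E \<phi> \<psi> \<cdot>\<^bsub>T\<^esub> \<phi> = \<psi>" by auto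
qed

section \<open>Generalized elements and change of base\<close>

definition act :: "'ba \<Rightarrow> 'xa \<Rightarrow> 'xa" where
  "act f x = Lift E f (Cod T x) \<cdot>\<^bsub>T\<^esub> x"

text \<open>The last clause is naturality in the stage of definition: precomposition passes inside
  \<open>act\<close>, as it does for \<open>pairing\<close>, until it reaches the innermost
  elements.\<close>

lemma act_simps [simp]:
  assumes "f \<in> Arr B" "x \<in> Arr T" "pO (Cod T x) = Dom B f"
  shows "act f x \<in> Arr T" "Dom T (act f x) = Dom T x" "Cod T (act f x) = Fob (push E f) (Cod T x)"
    and "pF (act f x) = f \<cdot>\<^bsub>B\<^esub> pF x"
    and "\<lbrakk>w \<in> Arr T; Cod T w = Dom T x\<rbrakk> \<Longrightarrow> act f x \<cdot>\<^bsub>T\<^esub> w = act f (x \<cdot>\<^bsub>T\<^esub> w)"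
  using assms by (simp_all add: act_def)

lemma push_sel [simp]:
  "Fdom (push E f) = fibre E (Dom B f)" "Fcod (push E f) = fibre E (Cod B f)"
  by (simp_all add: push_def)

text \<open>By \<open>cancel\<close> the last clause determines the arrow
  \<open>Far (push E f) v\<close>, so later proofs evaluate with it instead of returning to
  \<open>vfact\<close>.\<close>

lemma push_arr_simps [simp]:
  assumes "f \<in> Arr B" "v \<in> Arr T" "pF v = Idn B (Dom B f)"
  shows "Far (push E f) v \<in> Arr T" "Dom T (Far (push E f) v) = Fob (push E f) (Dom T v)"
    and "Cod T (Far (push E f) v) = Fob (push E f) (Cod T v)"
    and "pF (Far (push E f) v) = Idn B (Cod B f)"
    and "\<lbrakk>x \<in> Arr T; Cod T x = Dom T v\<rbrakk> \<Longrightarrow> Far (push E f) v \<cdot>\<^bsub>T\<^esub> act f x = act f (v \<cdot>\<^bsub>T\<^esub> x)"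
proof -
  note [simp] = assms vertical_ends[OF assms(2,3)]
  have eq: "Far (push E f) v = vfact E (Lift E f (Dom T v)) (Lift E f (Cod T v) \<cdot>\<^bsub>T\<^esub> v)"
    by (simp add: push_def)
  note l = vfact_simps[of "Lift E f (Dom T v)" "Lift E f (Cod T v) \<cdot>\<^bsub>T\<^esub> v", folded eq]
  show "Far (push E f) v \<in> Arr T" and "Dom T (Far (push E f) v) = Fob (push E f) (Dom T v)"
    and "Cod T (Far (push E f) v) = Fob (push E f) (Cod T v)"
    and "pF (Far (push E f) v) = Idn B (Cod B f)"
    and "\<lbrakk>x \<in> Arr T; Cod T x = Dom T v\<rbrakk> \<Longrightarrow> Far (push E f) v \<cdot>\<^bsub>T\<^esub> act f x = act f (v \<cdot>\<^bsub>T\<^esub> x)"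
    using l by (simp_all add: act_def comp_prefix[of T, OF _ _ _ _ _ _ l(5)])
qed

lemma push_Idn [simp]:
  "\<lbrakk>f \<in> Arr B; X \<in> Obj T; pO X = Dom B f\<rbrakk> \<Longrightarrow> Far (push E f) (Idn T X) = Idn T (Fob (push E f) X)"
  \<comment> \<open>Any arrow into \<open>X\<close> can serve as test element; the projection
    \<open>Pr1 S X X\<close> always exists and behaves like a generic one.\<close>
  by (rule cancel[where w = "act f (Pr1 S X X)"]) simp_all

lemma functor_push [simp]:
  assumes [simp]: "f \<in> Arr B"
  shows "is_functor (push E f)"
proof (rule functorI)
  show "Fob (push E f) \<in> extensional (Obj (Fdom (push E f)))"
    "Far (push E f) \<in> extensional (Arr (Fdom (push E f)))"
    by (simp_all add: push_def)
next
  fix A assume "A \<in> Obj (Fdom (push E f))"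
  then have [simp]: "A \<in> Obj T" "pO A = Dom B f" by simp_all
  show "Far (push E f) (Idn (Fdom (push E f)) A) =
    Idn (Fcod (push E f)) (Fob (push E f) A)" by simp
next
  fix x y assume "x \<in> Arr (Fdom (push E f))" "y \<in> Arr (Fdom (push E f))"
    "Cod (Fdom (push E f)) x = Dom (Fdom (push E f)) y"
  then have x [simp]: "x \<in> Arr T" "pF x = Idn B (Dom B f)" "y \<in> Arr T" "pF y = Idn B (Dom B f)"
    "Cod T x = Dom T y" by simp_all
  note [simp] = vertical_ends[OF x(1,2)] vertical_ends[OF x(3,4)]
  have "Far (push E f) (y \<cdot>\<^bsub>T\<^esub> x) = Far (push E f) y \<cdot>\<^bsub>T\<^esub> Far (push E f) x"
    by (rule cancel[where w = "act f (Idn T (Dom T x))"]) simp_all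
  then show "Far (push E f) (y \<cdot>\<^bsub>Fdom (push E f)\<^esub> x) =
    Far (push E f) y \<cdot>\<^bsub>Fcod (push E f)\<^esub> Far (push E f) x" by simp
qed simp_all

text \<open>Together with the rule for \<open>push_unit\<close>, the last clause carries the
  coherence of the pseudofunctor: in each law both sides take the same value on an iterated
  \<open>act\<close>.\<close>

lemma push_comp_simps [simp]:
  assumes [simp]: "f \<in> Arr B" "g \<in> Arr B" "Cod B f = Dom B g" "X \<in> Obj T" "pO X = Dom B f"
  shows "push_comp E g f X \<in> Arr T"
    and "Dom T (push_comp E g f X) = Fob (push E g) (Fob (push E f) X)"
    and "Cod T (push_comp E g f X) = Fob (push E (g \<cdot>\<^bsub>B\<^esub> f)) X"
    and "pF (push_comp E g f X) = Idn B (Cod B g)"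
    and "\<lbrakk>x \<in> Arr T; Cod T x = X\<rbrakk> \<Longrightarrow>
      push_comp E g f X \<cdot>\<^bsub>T\<^esub> act g (act f x) = act (g \<cdot>\<^bsub>B\<^esub> f) x"
proof -
  have eq: "push_comp E g f X =
      vfact E (Lift E g (Fob (push E f) X) \<cdot>\<^bsub>T\<^esub> Lift E f X) (Lift E (g \<cdot>\<^bsub>B\<^esub> f) X)"
    by (simp add: push_comp_def)
  note l = vfact_simps[of "Lift E g (Fob (push E f) X) \<cdot>\<^bsub>T\<^esub> Lift E f X" "Lift E (g \<cdot>\<^bsub>B\<^esub> f) X",
      folded eq, simplified]
  show "push_comp E g f X \<in> Arr T"
    and "Dom T (push_comp E g f X) = Fob (push E g) (Fob (push E f) X)"
    and "Cod T (push_comp E g f X) = Fob (push E (g \<cdot>\<^bsub>B\<^esub> f)) X"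
    and "pF (push_comp E g f X) = Idn B (Cod B g)"
    and "\<lbrakk>x \<in> Arr T; Cod T x = X\<rbrakk> \<Longrightarrow>
      push_comp E g f X \<cdot>\<^bsub>T\<^esub> act g (act f x) = act (g \<cdot>\<^bsub>B\<^esub> f) x"
    using l by (simp_all add: act_def comp_prefix3[of T, OF _ _ _ _ _ _ _ _ l(5)])
qed

text \<open>A lifting of an identity is already vertical, so the unit comparison is the lifting
  itself and involves no \<open>vfact\<close>.\<close>

lemma push_unit_simps [simp]:
  assumes [simp]: "A \<in> Obj B" "X \<in> Obj T" "pO X = A"
  shows "push_unit E A X \<in> Arr T"
    and "Dom T (push_unit E A X) = X"
    and "Cod T (push_unit E A X) = Fob (push E (Idn B A)) X"
    and "pF (push_unit E A X) = Idn B A"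
    and "\<lbrakk>x \<in> Arr T; Cod T x = X\<rbrakk> \<Longrightarrow> push_unit E A X \<cdot>\<^bsub>T\<^esub> x = act (Idn B A) x"
  by (simp_all add: push_unit_def act_def)

end

section \<open>The fibre over an internal group\<close>

lemma monoidal_categoryI:
  assumes "MCat M = C" "category C" "is_functor (Tensor M)" "Fdom (Tensor M) = prod_cat C C"
    and "Fcod (Tensor M) = C" "TUnit M \<in> Obj C"
    and "\<And>X Y Z. \<lbrakk>X \<in> Obj C; Y \<in> Obj C; Z \<in> Obj C\<rbrakk> \<Longrightarrow>
      Assoc M X Y Z \<in> hom C (tobj M (tobj M X Y) Z) (tobj M X (tobj M Y Z)) \<and> iso C (Assoc M X Y Z)"
    and "\<And>X. X \<in> Obj C \<Longrightarrow> Lunit M X \<in> hom C (tobj M (TUnit M) X) X \<and> iso C (Lunit M X)"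
    and "\<And>X. X \<in> Obj C \<Longrightarrow> Runit M X \<in> hom C (tobj M X (TUnit M)) X \<and> iso C (Runit M X)"
    and "\<And>f g h. \<lbrakk>f \<in> Arr C; g \<in> Arr C; h \<in> Arr C\<rbrakk> \<Longrightarrow>
      Assoc M (Cod C f) (Cod C g) (Cod C h) \<cdot>\<^bsub>C\<^esub> tarr M (tarr M f g) h =
      tarr M f (tarr M g h) \<cdot>\<^bsub>C\<^esub> Assoc M (Dom C f) (Dom C g) (Dom C h)"
    and "\<And>f. f \<in> Arr C \<Longrightarrow>
      Lunit M (Cod C f) \<cdot>\<^bsub>C\<^esub> tarr M (Idn C (TUnit M)) f = f \<cdot>\<^bsub>C\<^esub> Lunit M (Dom C f)"
    and "\<And>f. f \<in> Arr C \<Longrightarrow>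
      Runit M (Cod C f) \<cdot>\<^bsub>C\<^esub> tarr M f (Idn C (TUnit M)) = f \<cdot>\<^bsub>C\<^esub> Runit M (Dom C f)"
    and "\<And>W X Y Z. \<lbrakk>W \<in> Obj C; X \<in> Obj C; Y \<in> Obj C; Z \<in> Obj C\<rbrakk> \<Longrightarrow>
      Assoc M W X (tobj M Y Z) \<cdot>\<^bsub>C\<^esub> Assoc M (tobj M W X) Y Z =
      tarr M (Idn C W) (Assoc M X Y Z) \<cdot>\<^bsub>C\<^esub>
        Assoc M W (tobj M X Y) Z \<cdot>\<^bsub>C\<^esub> tarr M (Assoc M W X Y) (Idn C Z)"
    and "\<And>X Y. \<lbrakk>X \<in> Obj C; Y \<in> Obj C\<rbrakk> \<Longrightarrow>
      tarr M (Idn C X) (Lunit M Y) \<cdot>\<^bsub>C\<^esub> Assoc M X (TUnit M) Y = tarr M (Runit M X) (Idn C Y)"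
  shows "monoidal_category M"
  unfolding monoidal_category_def Let_def assms(1)
  by (intro conjI ballI) (use assms(2-) in blast)+

lemma symmetric_monoidal_categoryI:
  assumes "monoidal_category M" "MCat M = C"
    and "\<And>X Y. \<lbrakk>X \<in> Obj C; Y \<in> Obj C\<rbrakk> \<Longrightarrow> Braid M X Y \<in> hom C (tobj M X Y) (tobj M Y X)"
    and "\<And>f g. \<lbrakk>f \<in> Arr C; g \<in> Arr C\<rbrakk> \<Longrightarrow>
      Braid M (Cod C f) (Cod C g) \<cdot>\<^bsub>C\<^esub> tarr M f g = tarr M g f \<cdot>\<^bsub>C\<^esub> Braid M (Dom C f) (Dom C g)"
    and "\<And>X Y. \<lbrakk>X \<in> Obj C; Y \<in> Obj C\<rbrakk> \<Longrightarrow> Braid M Y X \<cdot>\<^bsub>C\<^esub> Braid M X Y = Idn C (tobj M X Y)"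
    and "\<And>X. X \<in> Obj C \<Longrightarrow> Lunit M X \<cdot>\<^bsub>C\<^esub> Braid M X (TUnit M) = Runit M X"
    and "\<And>X Y Z. \<lbrakk>X \<in> Obj C; Y \<in> Obj C; Z \<in> Obj C\<rbrakk> \<Longrightarrow>
      Assoc M Y Z X \<cdot>\<^bsub>C\<^esub> Braid M X (tobj M Y Z) \<cdot>\<^bsub>C\<^esub> Assoc M X Y Z =
      tarr M (Idn C Y) (Braid M X Z) \<cdot>\<^bsub>C\<^esub> Assoc M Y X Z \<cdot>\<^bsub>C\<^esub> tarr M (Braid M X Y) (Idn C Z)"
  shows "symmetric_monoidal_category M"
  unfolding symmetric_monoidal_category_def Let_def assms(2)
  by (intro conjI ballI) (use assms(1,3-) in blast)+

context groupoid_opfibration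
begin

text \<open>The projections of an iterated product are elements of four prescribed objects at one
  stage. Where fewer objects are involved, one of them is repeated.\<close>

lemma common_domain:
  assumes [simp]: "W \<in> Obj T" "X \<in> Obj T" "Y \<in> Obj T" "Z \<in> Obj T"
  obtains w x y z where "w \<in> Arr T" "x \<in> Arr T" "y \<in> Arr T" "z \<in> Arr T"
    "Cod T w = W" "Cod T x = X" "Cod T y = Y" "Cod T z = Z"
    "Dom T w = Dom T z" "Dom T x = Dom T z" "Dom T y = Dom T z"
proof
  let ?w = "Pr1 S W (Prd S X (Prd S Y Z))" and ?x = "Pr2 S W (Prd S X (Prd S Y Z))"
  let ?p = "Pr2 S X (Prd S Y Z) \<cdot>\<^bsub>T\<^esub> ?x"
  show "?w \<in> Arr T" "Pr1 S X (Prd S Y Z) \<cdot>\<^bsub>T\<^esub> ?x \<in> Arr T" "Pr1 S Y Z \<cdot>\<^bsub>T\<^esub> ?p \<in> Arr T"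
    "Pr2 S Y Z \<cdot>\<^bsub>T\<^esub> ?p \<in> Arr T" by simp_all
qed simp_all

lemmas group_simps [simp] = internal_group_simps(1-10)[OF _ opfib_simps(3)]

text \<open>Strict preservation of products by \<open>Proj E\<close> is what places the product of
  two objects, and of two vertical arrows, in the fibre over the product.\<close>

lemma functor_lax_R:
  assumes "A \<in> Obj B" "A' \<in> Obj B"
  shows "is_functor (lax_R E A A')"
proof (rule functorI)
  fix P assume "P \<in> Obj (Fdom (lax_R E A A'))"
  then show "Fob (lax_R E A A') P \<in> Obj (Fcod (lax_R E A A'))"
    "Far (lax_R E A A') (Idn (Fdom (lax_R E A A')) P) =
      Idn (Fcod (lax_R E A A')) (Fob (lax_R E A A') P)"
    using assms by (auto simp: lax_R_def)
next
  fix P assume "P \<in> Arr (Fdom (lax_R E A A'))"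
  then obtain f g where [simp]: "P = (f, g)" and
    fg: "f \<in> Arr T" "pF f = Idn B A" "g \<in> Arr T" "pF g = Idn B A'" by (auto simp: lax_R_def)
  show "Far (lax_R E A A') P \<in> Arr (Fcod (lax_R E A A')) \<and>
     Dom (Fcod (lax_R E A A')) (Far (lax_R E A A') P) =
       Fob (lax_R E A A') (Dom (Fdom (lax_R E A A')) P) \<and>
     Cod (Fcod (lax_R E A A')) (Far (lax_R E A A') P) =
       Fob (lax_R E A A') (Cod (Fdom (lax_R E A A')) P)"
    using fg assms vertical_ends[OF fg(1,2)] vertical_ends[OF fg(3,4)] by (simp add: lax_R_def)
next
  fix P Q assume "P \<in> Arr (Fdom (lax_R E A A'))" "Q \<in> Arr (Fdom (lax_R E A A'))"
    "Cod (Fdom (lax_R E A A')) P = Dom (Fdom (lax_R E A A')) Q"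
  then show "Far (lax_R E A A') (Q \<cdot>\<^bsub>Fdom (lax_R E A A')\<^esub> P) =
      Far (lax_R E A A') Q \<cdot>\<^bsub>Fcod (lax_R E A A')\<^esub> Far (lax_R E A A') P"
    using assms vertical_ends by (auto simp: lax_R_def prod_arr_comp)
qed (use assms in \<open>simp_all add: lax_R_def\<close>)

section \<open>The monoidal structure on one fibre\<close>

context
  fixes G assumes G [simp]: "internal_group B SB G"
begin

lemma fib_tensor_simps [simp]:
  "is_functor (fib_tensor E G)"
  "Fdom (fib_tensor E G) = prod_cat (fibre E (Carr G)) (fibre E (Carr G))"
  "Fcod (fib_tensor E G) = fibre E (Carr G)"
  "\<lbrakk>X \<in> Obj T; Y \<in> Obj T; pO X = Carr G; pO Y = Carr G\<rbrakk> \<Longrightarrow>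
    Fob (fib_tensor E G) (X, Y) = Fob (push E (Mul G)) (Prd S X Y)"
  "\<lbrakk>f \<in> Arr T; g \<in> Arr T; pF f = Idn B (Carr G); pF g = Idn B (Carr G)\<rbrakk> \<Longrightarrow>
    Far (fib_tensor E G) (f, g) = Far (push E (Mul G)) (prod_arr T S f g)"
proof -
  have "is_functor (lax_R E (Carr G) (Carr G))" by (simp add: functor_lax_R)
  then show "is_functor (fib_tensor E G)"
    unfolding fib_tensor_def by (rule functor_comp) (simp_all add: lax_R_def)
qed (simp_all add: fib_tensor_def lax_R_def)

lemma fib_unit_eq [simp]: "fib_unit E G = Fob (push E (Neu G)) (One S)"
  by (simp add: fib_unit_def comp_func_def lax_R1_def terminal_cat_def)

lemma fib_assoc_simps [simp]:
  assumes [simp]: "X \<in> Obj T" "Y \<in> Obj T" "Z \<in> Obj T" "pO X = Carr G" "pO Y = Carr G"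
    "pO Z = Carr G"
  shows "fib_assoc E G X Y Z \<in> Arr T"
    and "Dom T (fib_assoc E G X Y Z) =
      Fob (push E (Mul G)) (Prd S (Fob (push E (Mul G)) (Prd S X Y)) Z)"
    and "Cod T (fib_assoc E G X Y Z) =
      Fob (push E (Mul G)) (Prd S X (Fob (push E (Mul G)) (Prd S Y Z)))"
    and "pF (fib_assoc E G X Y Z) = Idn B (Carr G)"
    and "\<lbrakk>x \<in> Arr T; y \<in> Arr T; z \<in> Arr T; Dom T x = Dom T z; Dom T y = Dom T z;
        Cod T x = X; Cod T y = Y; Cod T z = Z\<rbrakk> \<Longrightarrow>
      fib_assoc E G X Y Z \<cdot>\<^bsub>T\<^esub>
        act (Mul G) (pairing T S (act (Mul G) (pairing T S x y)) z) =
        act (Mul G) (pairing T S x (act (Mul G) (pairing T S y z)))"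
proof -
  let ?ten = "\<lambda>X Y. Fob (push E (Mul G)) (Prd S X Y)"
  let ?\<phi> = "fib_c E G (?ten X Y) Z \<cdot>\<^bsub>T\<^esub> prod_arr T S (fib_c E G X Y) (Idn T Z)"
  let ?\<psi> = "(fib_c E G X (?ten Y Z) \<cdot>\<^bsub>T\<^esub> prod_arr T S (Idn T X) (fib_c E G Y Z)) \<cdot>\<^bsub>T\<^esub>
    prod_assoc T S X Y Z"
  have eq: "fib_assoc E G X Y Z = vfact E ?\<phi> ?\<psi>"
    by (simp add: fib_assoc_def Let_def)
  note l = vfact_simps[of ?\<phi> ?\<psi>, folded eq]
  \<comment> \<open>Associativity of the internal group is used here: \<open>?\<phi>\<close> and
    \<open>?\<psi>\<close> lie over the two ways of multiplying three factors.\<close>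
  have ty: "?\<phi> \<in> Arr T" "?\<psi> \<in> Arr T" "Dom T ?\<phi> = Dom T ?\<psi>" "pF ?\<phi> = pF ?\<psi>"
    by (simp_all add: fib_c_def internal_group_laws[OF G])
  show "fib_assoc E G X Y Z \<in> Arr T"
    and "Dom T (fib_assoc E G X Y Z) = ?ten (?ten X Y) Z"
    and "Cod T (fib_assoc E G X Y Z) = ?ten X (?ten Y Z)"
    and "pF (fib_assoc E G X Y Z) = Idn B (Carr G)"
    using l(1-4)[OF ty] by (simp_all add: fib_c_def)
  then show "fib_assoc E G X Y Z \<cdot>\<^bsub>T\<^esub>
        act (Mul G) (pairing T S (act (Mul G) (pairing T S x y)) z) =
        act (Mul G) (pairing T S x (act (Mul G) (pairing T S y z)))"
    if "x \<in> Arr T" "y \<in> Arr T" "z \<in> Arr T" "Dom T x = Dom T z" "Dom T y = Dom T z"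
        "Cod T x = X" "Cod T y = Y" "Cod T z = Z"
    \<comment> \<open>The defining equation of the constraint, precomposed with the triple of
      elements; simp carries the triple through both sides.\<close>
    using arg_cong[OF l(5)[OF ty], of "\<lambda>f. f \<cdot>\<^bsub>T\<^esub> pairing T S (pairing T S x y) z"] that
    by (simp add: fib_c_def act_def)
qed

text \<open>The separate variable \<open>W\<close> lets the evaluation rule match whatever form the
  domain of \<open>x\<close> has after simplification. At stage \<open>W\<close> the terminal object
  has the single element \<open>bang T S W\<close>.\<close>

lemma fib_lunit_simps [simp]:
  assumes [simp]: "X \<in> Obj T" "pO X = Carr G"
  shows "fib_lunit E G X \<in> Arr T"
    and "Dom T (fib_lunit E G X) = Fob (push E (Mul G)) (Prd S (Fob (push E (Neu G)) (One S)) X)"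
    and "Cod T (fib_lunit E G X) = X"
    and "pF (fib_lunit E G X) = Idn B (Carr G)"
    and "\<lbrakk>x \<in> Arr T; Cod T x = X; Dom T x = W\<rbrakk> \<Longrightarrow>
      fib_lunit E G X \<cdot>\<^bsub>T\<^esub> act (Mul G) (pairing T S (act (Neu G) (bang T S W)) x) = x"
proof -
  let ?\<phi> = "fib_c E G (fib_unit E G) X \<cdot>\<^bsub>T\<^esub> prod_arr T S (fib_u E G) (Idn T X)"
  let ?\<psi> = "Pr2 S (One S) X"
  have eq: "fib_lunit E G X = vfact E ?\<phi> ?\<psi>"
    by (simp add: fib_lunit_def)
  note l = vfact_simps[of ?\<phi> ?\<psi>, folded eq]
  \<comment> \<open>The left unit law of the group puts \<open>?\<phi>\<close> over the projection,
    which is also the image of \<open>?\<psi>\<close>.\<close>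
  have ty: "?\<phi> \<in> Arr T" "?\<psi> \<in> Arr T" "Dom T ?\<phi> = Dom T ?\<psi>" "pF ?\<phi> = pF ?\<psi>"
    by (simp_all add: fib_c_def fib_u_def internal_group_laws[OF G])
  show "fib_lunit E G X \<in> Arr T"
    and "Dom T (fib_lunit E G X) = Fob (push E (Mul G)) (Prd S (Fob (push E (Neu G)) (One S)) X)"
    and "Cod T (fib_lunit E G X) = X"
    and "pF (fib_lunit E G X) = Idn B (Carr G)"
    using l(1-4)[OF ty] by (simp_all add: fib_c_def fib_u_def)
  then show "fib_lunit E G X \<cdot>\<^bsub>T\<^esub> act (Mul G) (pairing T S (act (Neu G) (bang T S W)) x) = x"
    if "x \<in> Arr T" "Cod T x = X" "Dom T x = W"
    using arg_cong[OF l(5)[OF ty], of "\<lambda>f. f \<cdot>\<^bsub>T\<^esub> pairing T S (bang T S (Dom T x)) x"] that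
      category_simps(1)[of T x]
    by (auto simp: fib_c_def fib_u_def act_def)
qed

lemma fib_runit_simps [simp]:
  assumes [simp]: "X \<in> Obj T" "pO X = Carr G"
  shows "fib_runit E G X \<in> Arr T"
    and "Dom T (fib_runit E G X) = Fob (push E (Mul G)) (Prd S X (Fob (push E (Neu G)) (One S)))"
    and "Cod T (fib_runit E G X) = X"
    and "pF (fib_runit E G X) = Idn B (Carr G)"
    and "\<lbrakk>x \<in> Arr T; Cod T x = X; Dom T x = W\<rbrakk> \<Longrightarrow>
      fib_runit E G X \<cdot>\<^bsub>T\<^esub> act (Mul G) (pairing T S x (act (Neu G) (bang T S W))) = x"
proof -
  let ?\<phi> = "fib_c E G X (fib_unit E G) \<cdot>\<^bsub>T\<^esub> prod_arr T S (Idn T X) (fib_u E G)"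
  let ?\<psi> = "Pr1 S X (One S)"
  have eq: "fib_runit E G X = vfact E ?\<phi> ?\<psi>"
    by (simp add: fib_runit_def)
  note l = vfact_simps[of ?\<phi> ?\<psi>, folded eq]
  have ty: "?\<phi> \<in> Arr T" "?\<psi> \<in> Arr T" "Dom T ?\<phi> = Dom T ?\<psi>" "pF ?\<phi> = pF ?\<psi>"
    by (simp_all add: fib_c_def fib_u_def internal_group_laws[OF G])
  show "fib_runit E G X \<in> Arr T"
    and "Dom T (fib_runit E G X) = Fob (push E (Mul G)) (Prd S X (Fob (push E (Neu G)) (One S)))"
    and "Cod T (fib_runit E G X) = X"
    and "pF (fib_runit E G X) = Idn B (Carr G)"
    using l(1-4)[OF ty] by (simp_all add: fib_c_def fib_u_def)
  then show "fib_runit E G X \<cdot>\<^bsub>T\<^esub> act (Mul G) (pairing T S x (act (Neu G) (bang T S W))) = x"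
    if "x \<in> Arr T" "Cod T x = X" "Dom T x = W"
    using arg_cong[OF l(5)[OF ty], of "\<lambda>f. f \<cdot>\<^bsub>T\<^esub> pairing T S x (bang T S (Dom T x))"] that
      category_simps(1)[of T x]
    by (auto simp: fib_c_def fib_u_def act_def)
qed

text \<open>Only the fields of \<open>M\<close> are prescribed, not the record itself, so that the
  result covers both the plain and the braided structure.\<close>

lemma monoidal_category_fib:
  assumes M [simp]: "MCat M = fibre E (Carr G)" "Tensor M = fib_tensor E G" "TUnit M = fib_unit E G"
    "Assoc M = fib_assoc E G" "Lunit M = fib_lunit E G" "Runit M = fib_runit E G"
  shows "monoidal_category M"
proof (rule monoidal_categoryI[of _ "fibre E (Carr G)"])
  fix f g h assume "f \<in> Arr (fibre E (Carr G))" "g \<in> Arr (fibre E (Carr G))"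
    "h \<in> Arr (fibre E (Carr G))"
  then have f [simp]: "f \<in> Arr T" "pF f = Idn B (Carr G)" "g \<in> Arr T" "pF g = Idn B (Carr G)"
    "h \<in> Arr T" "pF h = Idn B (Carr G)" by simp_all
  note [simp] = vertical_ends[OF f(1,2)] vertical_ends[OF f(3,4)] vertical_ends[OF f(5,6)]
  obtain w x y z where [simp]: "w \<in> Arr T" "x \<in> Arr T" "y \<in> Arr T" "z \<in> Arr T"
    "Cod T w = Dom T f" "Cod T x = Dom T f" "Cod T y = Dom T g" "Cod T z = Dom T h"
    "Dom T w = Dom T z" "Dom T x = Dom T z" "Dom T y = Dom T z"
    by (rule common_domain[of "Dom T f" "Dom T f" "Dom T g" "Dom T h"]) simp_all
  show "Assoc M (Cod (fibre E (Carr G)) f) (Cod (fibre E (Carr G)) g) (Cod (fibre E (Carr G)) h)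
      \<cdot>\<^bsub>fibre E (Carr G)\<^esub> tarr M (tarr M f g) h =
    tarr M f (tarr M g h) \<cdot>\<^bsub>fibre E (Carr G)\<^esub>
      Assoc M (Dom (fibre E (Carr G)) f) (Dom (fibre E (Carr G)) g) (Dom (fibre E (Carr G)) h)"
    \<comment> \<open>Both sides send \<open>(x * y) * z\<close> to
      \<open>f x * (g y * h z)\<close>.\<close>
    by (rule cancel[where w =
          "act (Mul G) (pairing T S (act (Mul G) (pairing T S x y)) z)"]) simp_all
next
  fix f assume "f \<in> Arr (fibre E (Carr G))"
  then have f [simp]: "f \<in> Arr T" "pF f = Idn B (Carr G)" by simp_all
  note [simp] = vertical_ends[OF f(1,2)]
  \<comment> \<open>The neutral element at the stage \<open>Dom T f\<close>.\<close>
  let ?u = "act (Neu G) (bang T S (Dom T f))"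
  show "Lunit M (Cod (fibre E (Carr G)) f) \<cdot>\<^bsub>fibre E (Carr G)\<^esub>
      tarr M (Idn (fibre E (Carr G)) (TUnit M)) f =
    f \<cdot>\<^bsub>fibre E (Carr G)\<^esub> Lunit M (Dom (fibre E (Carr G)) f)"
    by (rule cancel[where w = "act (Mul G) (pairing T S ?u (Idn T (Dom T f)))"]) simp_all
  show "Runit M (Cod (fibre E (Carr G)) f) \<cdot>\<^bsub>fibre E (Carr G)\<^esub>
      tarr M f (Idn (fibre E (Carr G)) (TUnit M)) =
    f \<cdot>\<^bsub>fibre E (Carr G)\<^esub> Runit M (Dom (fibre E (Carr G)) f)"
    by (rule cancel[where w = "act (Mul G) (pairing T S (Idn T (Dom T f)) ?u)"]) simp_all
next
  fix W X Y Z assume "W \<in> Obj (fibre E (Carr G))" "X \<in> Obj (fibre E (Carr G))"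
    "Y \<in> Obj (fibre E (Carr G))" "Z \<in> Obj (fibre E (Carr G))"
  then have [simp]: "W \<in> Obj T" "pO W = Carr G" "X \<in> Obj T" "pO X = Carr G"
    "Y \<in> Obj T" "pO Y = Carr G" "Z \<in> Obj T" "pO Z = Carr G" by simp_all
  obtain w x y z where [simp]: "w \<in> Arr T" "x \<in> Arr T" "y \<in> Arr T" "z \<in> Arr T"
    "Cod T w = W" "Cod T x = X" "Cod T y = Y" "Cod T z = Z"
    "Dom T w = Dom T z" "Dom T x = Dom T z" "Dom T y = Dom T z"
    by (rule common_domain[of W X Y Z]) simp_all
  show "Assoc M W X (tobj M Y Z) \<cdot>\<^bsub>fibre E (Carr G)\<^esub> Assoc M (tobj M W X) Y Z =
      tarr M (Idn (fibre E (Carr G)) W) (Assoc M X Y Z) \<cdot>\<^bsub>fibre E (Carr G)\<^esub>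
        Assoc M W (tobj M X Y) Z \<cdot>\<^bsub>fibre E (Carr G)\<^esub>
        tarr M (Assoc M W X Y) (Idn (fibre E (Carr G)) Z)"
    \<comment> \<open>Both sides of the pentagon send \<open>((w * x) * y) * z\<close> to
      \<open>w * (x * (y * z))\<close>.\<close>
    by (rule cancel[where w = "act (Mul G) (pairing T S (act (Mul G) (pairing T S
        (act (Mul G) (pairing T S w x)) y)) z)"]) simp_all
next
  fix X Y assume "X \<in> Obj (fibre E (Carr G))" "Y \<in> Obj (fibre E (Carr G))"
  then have [simp]: "X \<in> Obj T" "pO X = Carr G" "Y \<in> Obj T" "pO Y = Carr G" by simp_all
  obtain w x y z where [simp]: "w \<in> Arr T" "x \<in> Arr T" "y \<in> Arr T" "z \<in> Arr T"
    "Cod T w = X" "Cod T x = X" "Cod T y = X" "Cod T z = Y"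
    "Dom T w = Dom T z" "Dom T x = Dom T z" "Dom T y = Dom T z"
    by (rule common_domain[of X X X Y]) simp_all
  show "tarr M (Idn (fibre E (Carr G)) X) (Lunit M Y) \<cdot>\<^bsub>fibre E (Carr G)\<^esub>
      Assoc M X (TUnit M) Y = tarr M (Runit M X) (Idn (fibre E (Carr G)) Y)"
    \<comment> \<open>Both sides of the triangle send \<open>(x * e) * z\<close> to
      \<open>x * z\<close>.\<close>
    by (rule cancel[where w = "act (Mul G) (pairing T S (act (Mul G) (pairing T S x
        (act (Neu G) (bang T S (Dom T z))))) z)"]) simp_all
\<comment> \<open>The constraints are vertical, hence invertible by
  \<open>iso_fibre\<close>.\<close>
qed (simp_all add: iso_fibre)

lemma two_group_fib:
  assumes "MCat M = fibre E (Carr G)" "Tensor M = fib_tensor E G" "TUnit M = fib_unit E G"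
    "Assoc M = fib_assoc E G" "Lunit M = fib_lunit E G" "Runit M = fib_runit E G"
  shows "two_group M"
  unfolding two_group_def assms(1)
proof (intro conjI ballI)
  show "monoidal_category M" by (rule monoidal_category_fib) fact+
  show "groupoid (fibre E (Carr G))" by (rule groupoid_fibre) simp
next
  fix X assume "X \<in> Obj (fibre E (Carr G))"
  then have [simp]: "X \<in> Obj T" "pO X = Carr G" by simp_all
  let ?i = "act (Inv G) (Idn T X)"
  let ?I = "Fob (push E (Inv G)) X"
  let ?u = "act (Neu G) (bang T S X)"
  have iso: "isomorphic (fibre E (Carr G)) Y (TUnit M)"
    if "a \<in> Arr T" "Cod T a = Y" "Dom T a = X" "pF a = Neu G \<cdot>\<^bsub>B\<^esub> bang B SB (Carr G)" for a Y
    using vfact_simps[of a ?u] that assms(3) iso_fibre[of "Carr G" "vfact E a ?u"]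
      functor_simps(8)[of "Proj E" B a]
    by (auto simp: isomorphic_def)
  \<comment> \<open>The inverse laws are used in the base only: they show that
    \<open>x * i x\<close> and \<open>i x * x\<close> lie over the constant map at the neutral
    element, the last premise of \<open>iso\<close>.\<close>
  note inv = internal_group_simps(11,12)[OF G opfib_simps(3)]
  show "\<exists>Y \<in> Obj (fibre E (Carr G)).
      isomorphic (fibre E (Carr G)) (tobj M X Y) (TUnit M) \<and>
      isomorphic (fibre E (Carr G)) (tobj M Y X) (TUnit M)"
  proof (intro bexI conjI)
    show "isomorphic (fibre E (Carr G)) (tobj M X ?I) (TUnit M)"
      by (rule iso[of "act (Mul G) (pairing T S (Idn T X) ?i)"])
        (use inv(2)[of "Idn B (Carr G)"] in \<open>simp_all add: assms(2)\<close>)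
    show "isomorphic (fibre E (Carr G)) (tobj M ?I X) (TUnit M)"
      by (rule iso[of "act (Mul G) (pairing T S ?i (Idn T X))"])
        (use inv(1)[of "Idn B (Carr G)"] in \<open>simp_all add: assms(2)\<close>)
  qed simp
qed

end

end

section \<open>Invertible 2-cells and categories of internal groups\<close>

text \<open>Pointwise inverses of a monoidal transformation are again natural and monoidal, since
  the squares can be inverted along their sides. This reduces invertibility of the comparison cells
  to the fibres.\<close>

lemma iso_2cell:
  assumes c: "c \<in> Cells2 (mon2 S Q)"
    and Q: "\<And>H. Q H \<Longrightarrow> monoidal_functor H"
    and iso: "\<And>X. X \<in> Obj (MCat (MDom (Ndom c))) \<Longrightarrow> iso (MCat (MCod (Ndom c))) (Ncmp c X)"
  shows "iso (vcat (mon2 S Q)) c"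
proof -
  define H K t where "H = Ndom c" "K = Ncod c" "t = Ncmp c"
  note defs = this
  have cell: "monoidal_natural H K t" "monoidal_functor H" "monoidal_functor K" "S (MDom H)"
    "S (MCod H)" "Q H" "Q K"
    using c Q by (simp_all add: defs)
  obtain M N C D F G where n: "MDom H = M" "MCod H = N" "MCat M = C" "MCat N = D" "MFun H = F"
    "MFun K = G" by blast
  note mc = monoidal_2cell[OF cell(1-3) n] and ml = monoidal_natural_laws(4,5)[OF cell(1) n]
  note K' = mc(1,2) n(3,4,6)
  have [simp]: "monoidal_category M" "monoidal_category N"
    using monoidal_functor_simps(1,2)[OF cell(2)] n by simp_all
  note [simp] = mc(1-14) n monoidal_functor_simps(7-14)[OF cell(2), unfolded n, OF refl]
    monoidal_functor_simps(7-14)[OF cell(3), unfolded K', OF refl]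
  have "\<exists>s. s \<in> Arr D \<and> Dom D s = Fob G X \<and> Cod D s = Fob F X \<and>
      s \<cdot>\<^bsub>D\<^esub> t X = Idn D (Fob F X) \<and> t X \<cdot>\<^bsub>D\<^esub> s = Idn D (Fob G X)" if "X \<in> Obj C" for X
    using iso[of X] that unfolding iso_def by (auto simp: defs[symmetric])
  then obtain s where s: "s X \<in> Arr D" "Dom D (s X) = Fob G X" "Cod D (s X) = Fob F X"
      "s X \<cdot>\<^bsub>D\<^esub> t X = Idn D (Fob F X)" "t X \<cdot>\<^bsub>D\<^esub> s X = Idn D (Fob G X)" if "X \<in> Obj C" for X
    by metis
  note [simp] = s
  \<comment> \<open>The restriction makes the chosen inverses extensional, as 2-cells have to
    be.\<close>
  define d where "d = \<lparr>Ndom = K, Ncod = H, Ncmp = restrict s (Obj C)\<rparr>"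
  have "monoidal_natural K H (restrict s (Obj C))"
  proof (rule monoidal_naturalI[OF K'(1,2) n(1-4)])
    show "is_natural (MFun K) (MFun H) (restrict s (Obj C))"
    proof (rule naturalI)
      fix f assume "f \<in> Arr (Fdom (MFun K))"
      then have [simp]: "f \<in> Arr C" by simp
      \<comment> \<open>The square of \<open>t\<close> is inverted by inserting \<open>t\<close>
        after \<open>s\<close> on the right, moving \<open>t\<close> across, and cancelling it
        against \<open>s\<close> on the left. The tensor square is treated in the same way.\<close>
      have "s (Cod C f) \<cdot>\<^bsub>D\<^esub> Far G f = s (Cod C f) \<cdot>\<^bsub>D\<^esub> Far G f \<cdot>\<^bsub>D\<^esub> t (Dom C f) \<cdot>\<^bsub>D\<^esub> s (Dom C f)"
        by simp
      also have "\<dots> = s (Cod C f) \<cdot>\<^bsub>D\<^esub> t (Cod C f) \<cdot>\<^bsub>D\<^esub> Far F f \<cdot>\<^bsub>D\<^esub> s (Dom C f)"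
        by (simp add: comp_prefix[of D, OF _ _ _ _ _ _ mc(15)[symmetric]] del: s(5))
      also have "\<dots> = Far F f \<cdot>\<^bsub>D\<^esub> s (Dom C f)"
        by (simp add: comp_prefix[of D, OF _ _ _ _ _ _ s(4)])
      finally show "restrict s (Obj C) (Cod (Fdom (MFun K)) f) \<cdot>\<^bsub>Fcod (MFun K)\<^esub> Far (MFun K) f =
        Far (MFun H) f \<cdot>\<^bsub>Fcod (MFun K)\<^esub> restrict s (Obj C) (Dom (Fdom (MFun K)) f)" by simp
    qed simp_all
  next
    fix X Y assume [simp]: "X \<in> Obj C" "Y \<in> Obj C"
    \<comment> \<open>Bifunctoriality: the tensor of the inverses is a right inverse of the tensor
      of the components.\<close>
    have ts: "tarr N (t X) (t Y) \<cdot>\<^bsub>D\<^esub> tarr N (s X) (s Y) = Idn D (tobj N (Fob G X) (Fob G Y))"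
      by (simp add: tarr_comp[symmetric])
    have "s (tobj M X Y) \<cdot>\<^bsub>D\<^esub> MPhi K (X, Y) =
      s (tobj M X Y) \<cdot>\<^bsub>D\<^esub> MPhi K (X, Y) \<cdot>\<^bsub>D\<^esub> tarr N (t X) (t Y) \<cdot>\<^bsub>D\<^esub> tarr N (s X) (s Y)"
      by (simp add: ts)
    also have "\<dots> = s (tobj M X Y) \<cdot>\<^bsub>D\<^esub> t (tobj M X Y) \<cdot>\<^bsub>D\<^esub> MPhi H (X, Y) \<cdot>\<^bsub>D\<^esub> tarr N (s X) (s Y)"
      by (simp add: comp_prefix[of D, OF _ _ _ _ _ _ ml(1)[symmetric]])
    also have "\<dots> = MPhi H (X, Y) \<cdot>\<^bsub>D\<^esub> tarr N (s X) (s Y)"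
      by (simp add: comp_prefix[of D, OF _ _ _ _ _ _ s(4)])
    finally show "restrict s (Obj C) (tobj M X Y) \<cdot>\<^bsub>D\<^esub> MPhi K (X, Y) =
      MPhi H (X, Y) \<cdot>\<^bsub>D\<^esub> tarr N (restrict s (Obj C) X) (restrict s (Obj C) Y)" by simp
  next
    have "s (TUnit M) \<cdot>\<^bsub>D\<^esub> t (TUnit M) \<cdot>\<^bsub>D\<^esub> MPhi0 H = MPhi0 H"
      by (simp add: comp_prefix[of D, OF _ _ _ _ _ _ s(4)])
    then show "restrict s (Obj C) (TUnit M) \<cdot>\<^bsub>D\<^esub> MPhi0 K = MPhi0 H"
      by (simp add: ml(2))
  qed
  then have d: "d \<in> Cells2 (mon2 S Q)"
    using cell by (simp add: d_def)
  have "vcomp_nt MFun d c = id_nt MFun H" "vcomp_nt MFun c d = id_nt MFun K"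
    by (rule ntrans_eqI[of _ _ "Obj C"]; simp add: d_def defs[symmetric])+
  then show ?thesis
    using c d unfolding iso_def vcat_sel by (auto simp: d_def defs intro!: bexI[of _ d])
qed

section \<open>The categories of internal groups and internal abelian groups\<close>

lemma Gp_sel [simp]:
  "Obj (Gp C S) = {G. internal_group C S G}" "Arr (Gp C S) = {h. internal_group_hom C S h}"
  "Dom (Gp C S) = Gdom" "Cod (Gp C S) = Gcod"
  "Idn (Gp C S) G = \<lparr>Gdom = G, Gcod = G, Gmap = Idn C (Carr G)\<rparr>"
  "k \<cdot>\<^bsub>Gp C S\<^esub> h = \<lparr>Gdom = Gdom h, Gcod = Gcod k, Gmap = Gmap k \<cdot>\<^bsub>C\<^esub> Gmap h\<rparr>"
  by (simp_all add: Gp_def)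

lemma Ab_sel [simp]:
  "Obj (Ab C S) = {G. internal_abelian_group C S G}"
  "Arr (Ab C S) = {h. internal_group_hom C S h \<and> internal_abelian_group C S (Gdom h) \<and>
     internal_abelian_group C S (Gcod h)}"
  "Dom (Ab C S) = Gdom" "Cod (Ab C S) = Gcod" "Idn (Ab C S) = Idn (Gp C S)"
  "Cmp (Ab C S) = Cmp (Gp C S)"
  by (simp_all add: Ab_def Gp_def)

lemma internal_group_hom_Idn:
  assumes [simp]: "finite_products C S" and G: "internal_group C S G"
  shows "internal_group_hom C S \<lparr>Gdom = G, Gcod = G, Gmap = Idn C (Carr G)\<rparr>"
proof -
  have [simp]: "category C" by (rule finite_products_category) fact
  show ?thesis
    using internal_group_simps(1-10)[OF G assms(1)] G by (simp add: internal_group_hom_def)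
qed

lemma internal_group_hom_comp:
  assumes [simp]: "finite_products C S"
    and h: "internal_group_hom C S h" and k: "internal_group_hom C S k" and hk: "Gcod h = Gdom k"
  shows "internal_group_hom C S \<lparr>Gdom = Gdom h, Gcod = Gcod k, Gmap = Gmap k \<cdot>\<^bsub>C\<^esub> Gmap h\<rparr>"
proof -
  have C [simp]: "category C" by (rule finite_products_category) fact
  note hs = internal_group_hom_simps[OF h] and ks = internal_group_hom_simps[OF k]
  note [simp] = internal_group_simps(1-10)[OF hs(1) assms(1)] hk
    internal_group_simps(1-10)[OF ks(1) assms(1)] internal_group_simps(1-10)[OF ks(2) assms(1)]
    hs(3-5) ks(3-5)
  have hm: "Gmap h \<cdot>\<^bsub>C\<^esub> Mul (Gdom h) = Mul (Gdom k) \<cdot>\<^bsub>C\<^esub> prod_arr C S (Gmap h) (Gmap h)"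
    and km: "Gmap k \<cdot>\<^bsub>C\<^esub> Mul (Gdom k) = Mul (Gcod k) \<cdot>\<^bsub>C\<^esub> prod_arr C S (Gmap k) (Gmap k)"
    using h k hk by (simp_all add: internal_group_hom_def)
  have "(Gmap k \<cdot>\<^bsub>C\<^esub> Gmap h) \<cdot>\<^bsub>C\<^esub> Mul (Gdom h) =
    Mul (Gcod k) \<cdot>\<^bsub>C\<^esub> prod_arr C S (Gmap k \<cdot>\<^bsub>C\<^esub> Gmap h) (Gmap k \<cdot>\<^bsub>C\<^esub> Gmap h)"
    by (simp add: hm comp_prefix[of C, OF _ _ _ _ _ _ km] prod_arr_comp)
  moreover have "(Gmap k \<cdot>\<^bsub>C\<^esub> Gmap h) \<cdot>\<^bsub>C\<^esub> Neu (Gdom h) = Neu (Gcod k)"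
    using hs(6) ks(6) by simp
  ultimately show ?thesis
    using hs(1) ks(2) by (simp add: internal_group_hom_def)
qed

lemma category_Gp:
  assumes "finite_products C S"
  shows "category (Gp C S)"
proof (rule categoryI, goal_cases)
  case (5 f g h)
  then show ?case
    using finite_products_category[OF assms] by (simp add: internal_group_hom_simps)
qed (use finite_products_category[OF assms] in
    \<open>auto simp: internal_group_hom_simps assms internal_group_hom_Idn internal_group_hom_comp\<close>)

text \<open>A full subcategory of \<open>Gp C S\<close> with the same operations, so every law is
  inherited.\<close>

lemma category_Ab:
  assumes "finite_products C S"
  shows "category (Ab C S)"
proof -
  have "category (Gp C S)" by (rule category_Gp) fact
  from category_simps[OF this] show ?thesis
    by (intro categoryI) (auto simp: internal_abelian_group_def)
qed

section \<open>Change of base along a group morphism\<close>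

context groupoid_opfibration
begin

section \<open>The symmetry over an internal abelian group\<close>

lemma fib_braid_simps [simp]:
  assumes G: "internal_abelian_group B SB G"
    and [simp]: "X \<in> Obj T" "Y \<in> Obj T" "pO X = Carr G" "pO Y = Carr G"
  shows "fib_braid E G X Y \<in> Arr T"
    and "Dom T (fib_braid E G X Y) = Fob (push E (Mul G)) (Prd S X Y)"
    and "Cod T (fib_braid E G X Y) = Fob (push E (Mul G)) (Prd S Y X)"
    and "pF (fib_braid E G X Y) = Idn B (Carr G)"
    and "\<lbrakk>x \<in> Arr T; y \<in> Arr T; Dom T x = Dom T y; Cod T x = X; Cod T y = Y\<rbrakk> \<Longrightarrow>
      fib_braid E G X Y \<cdot>\<^bsub>T\<^esub> act (Mul G) (pairing T S x y) = act (Mul G) (pairing T S y x)"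
proof -
  have [simp]: "internal_group B SB G" "Mul G \<cdot>\<^bsub>B\<^esub> prod_swap B SB (Carr G) (Carr G) = Mul G"
    using G by (simp_all add: internal_abelian_group_def)
  let ?\<phi> = "fib_c E G X Y" and ?\<psi> = "fib_c E G Y X \<cdot>\<^bsub>T\<^esub> prod_swap T S X Y"
  have eq: "fib_braid E G X Y = vfact E ?\<phi> ?\<psi>"
    by (simp add: fib_braid_def)
  note l = vfact_simps[of ?\<phi> ?\<psi>, folded eq]
  \<comment> \<open>Commutativity is used here: multiplication after the swap equals multiplication,
    so both arrows lie over \<open>Mul G\<close>.\<close>
  have ty: "?\<phi> \<in> Arr T" "?\<psi> \<in> Arr T" "Dom T ?\<phi> = Dom T ?\<psi>" "pF ?\<phi> = pF ?\<psi>"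
    by (simp_all add: fib_c_def)
  show "fib_braid E G X Y \<in> Arr T"
    and "Dom T (fib_braid E G X Y) = Fob (push E (Mul G)) (Prd S X Y)"
    and "Cod T (fib_braid E G X Y) = Fob (push E (Mul G)) (Prd S Y X)"
    and "pF (fib_braid E G X Y) = Idn B (Carr G)"
    using l(1-4)[OF ty] by (simp_all add: fib_c_def)
  then show "fib_braid E G X Y \<cdot>\<^bsub>T\<^esub> act (Mul G) (pairing T S x y) = act (Mul G) (pairing T S y x)"
    if "x \<in> Arr T" "y \<in> Arr T" "Dom T x = Dom T y" "Cod T x = X" "Cod T y = Y"
    using arg_cong[OF l(5)[OF ty], of "\<lambda>f. f \<cdot>\<^bsub>T\<^esub> pairing T S x y"] that
    by (simp add: fib_c_def act_def)
qed

lemma symmetric_two_group_fib: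
  assumes G: "internal_abelian_group B SB G"
    and M [simp]: "MCat M = fibre E (Carr G)" "Tensor M = fib_tensor E G" "TUnit M = fib_unit E G"
    "Assoc M = fib_assoc E G" "Lunit M = fib_lunit E G" "Runit M = fib_runit E G"
    "Braid M = fib_braid E G"
  shows "symmetric_two_group M"
  unfolding symmetric_two_group_def
proof
  have [simp]: "internal_group B SB G" using G by (simp add: internal_abelian_group_def)
  note [simp] = G
  show "two_group M" by (rule two_group_fib) simp_all
  show "symmetric_monoidal_category M"
  proof (rule symmetric_monoidal_categoryI[of _ "fibre E (Carr G)"])
    show "monoidal_category M" by (rule monoidal_category_fib) simp_all
  next
    fix f g assume "f \<in> Arr (fibre E (Carr G))" "g \<in> Arr (fibre E (Carr G))"
    then have f [simp]: "f \<in> Arr T" "pF f = Idn B (Carr G)" "g \<in> Arr T" "pF g = Idn B (Carr G)"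
      by simp_all
    note [simp] = vertical_ends[OF f(1,2)] vertical_ends[OF f(3,4)]
    obtain w x y z where [simp]: "w \<in> Arr T" "x \<in> Arr T" "y \<in> Arr T" "z \<in> Arr T"
      "Cod T w = Dom T f" "Cod T x = Dom T f" "Cod T y = Dom T f" "Cod T z = Dom T g"
      "Dom T w = Dom T z" "Dom T x = Dom T z" "Dom T y = Dom T z"
      by (rule common_domain[of "Dom T f" "Dom T f" "Dom T f" "Dom T g"]) simp_all
    show "Braid M (Cod (fibre E (Carr G)) f) (Cod (fibre E (Carr G)) g) \<cdot>\<^bsub>fibre E (Carr G)\<^esub>
        tarr M f g =
      tarr M g f \<cdot>\<^bsub>fibre E (Carr G)\<^esub> Braid M (Dom (fibre E (Carr G)) f) (Dom (fibre E (Carr G)) g)"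
      by (rule cancel[where w = "act (Mul G) (pairing T S y z)"]) simp_all
  next
    fix X Y Z assume "X \<in> Obj (fibre E (Carr G))" "Y \<in> Obj (fibre E (Carr G))"
      "Z \<in> Obj (fibre E (Carr G))"
    then have [simp]: "X \<in> Obj T" "pO X = Carr G" "Y \<in> Obj T" "pO Y = Carr G"
      "Z \<in> Obj T" "pO Z = Carr G" by simp_all
    obtain w x y z where [simp]: "w \<in> Arr T" "x \<in> Arr T" "y \<in> Arr T" "z \<in> Arr T"
      "Cod T w = X" "Cod T x = X" "Cod T y = Y" "Cod T z = Z"
      "Dom T w = Dom T z" "Dom T x = Dom T z" "Dom T y = Dom T z"
      by (rule common_domain[of X X Y Z]) simp_all
    show "Assoc M Y Z X \<cdot>\<^bsub>fibre E (Carr G)\<^esub> Braid M X (tobj M Y Z) \<cdot>\<^bsub>fibre E (Carr G)\<^esub>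
        Assoc M X Y Z =
      tarr M (Idn (fibre E (Carr G)) Y) (Braid M X Z) \<cdot>\<^bsub>fibre E (Carr G)\<^esub>
        Assoc M Y X Z \<cdot>\<^bsub>fibre E (Carr G)\<^esub> tarr M (Braid M X Y) (Idn (fibre E (Carr G)) Z)"
      \<comment> \<open>Both sides of the hexagon send \<open>(x * y) * z\<close> to
        \<open>y * (z * x)\<close>.\<close>
      by (rule cancel[where w =
            "act (Mul G) (pairing T S (act (Mul G) (pairing T S x y)) z)"]) simp_all
  next
    fix X Y assume "X \<in> Obj (fibre E (Carr G))" "Y \<in> Obj (fibre E (Carr G))"
    then have [simp]: "X \<in> Obj T" "pO X = Carr G" "Y \<in> Obj T" "pO Y = Carr G" by simp_all
    show "Braid M Y X \<cdot>\<^bsub>fibre E (Carr G)\<^esub> Braid M X Y = Idn (fibre E (Carr G)) (tobj M X Y)"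
      \<comment> \<open>The test pair consists of the two projections. The rule
        \<open>pairing_Pr\<close> is removed because it would contract the pair to an identity and
        hide the form on which the symmetry is evaluated.\<close>
      by (rule cancel[where w = "act (Mul G) (pairing T S (Pr1 S X Y) (Pr2 S X Y))"];
          simp del: pairing_Pr)
  next
    fix X assume "X \<in> Obj (fibre E (Carr G))"
    then have [simp]: "X \<in> Obj T" "pO X = Carr G" by simp_all
    show "Lunit M X \<cdot>\<^bsub>fibre E (Carr G)\<^esub> Braid M X (TUnit M) = Runit M X"
      by (rule cancel[where w =
            "act (Mul G) (pairing T S (Idn T X) (act (Neu G) (bang T S X)))"]) simp_all
  qed simp_all
qed

section \<open>The strong monoidal structure of change of base\<close>

lemmas group_hom_simps [simp] = internal_group_hom_simps(1-5)[of B SB]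

lemma fib_phi_simps [simp]:
  assumes h [simp]: "internal_group_hom B SB h"
    and [simp]: "X \<in> Obj T" "Y \<in> Obj T" "pO X = Carr (Gdom h)" "pO Y = Carr (Gdom h)"
  shows "fib_phi E h (X, Y) \<in> Arr T"
    and "Dom T (fib_phi E h (X, Y)) =
      Fob (push E (Mul (Gcod h))) (Prd S (Fob (push E (Gmap h)) X) (Fob (push E (Gmap h)) Y))"
    and "Cod T (fib_phi E h (X, Y)) = Fob (push E (Gmap h)) (Fob (push E (Mul (Gdom h))) (Prd S X Y))"
    and "pF (fib_phi E h (X, Y)) = Idn B (Carr (Gcod h))"
    and "\<lbrakk>x \<in> Arr T; y \<in> Arr T; Dom T x = Dom T y; Cod T x = X; Cod T y = Y\<rbrakk> \<Longrightarrow>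
      fib_phi E h (X, Y) \<cdot>\<^bsub>T\<^esub>
        act (Mul (Gcod h)) (pairing T S (act (Gmap h) x) (act (Gmap h) y)) =
        act (Gmap h) (act (Mul (Gdom h)) (pairing T S x y))"
proof -
  let ?\<phi> = "fib_c E (Gcod h) (Fob (push E (Gmap h)) X) (Fob (push E (Gmap h)) Y) \<cdot>\<^bsub>T\<^esub>
    prod_arr T S (Lift E (Gmap h) X) (Lift E (Gmap h) Y)"
  let ?\<psi> = "Lift E (Gmap h) (Fob (fib_tensor E (Gdom h)) (X, Y)) \<cdot>\<^bsub>T\<^esub> fib_c E (Gdom h) X Y"
  \<comment> \<open>Compatibility with multiplication says exactly that \<open>?\<phi>\<close> and
    \<open>?\<psi>\<close> lie over the same arrow.\<close>
  have hm: "Gmap h \<cdot>\<^bsub>B\<^esub> Mul (Gdom h) = Mul (Gcod h) \<cdot>\<^bsub>B\<^esub> prod_arr B SB (Gmap h) (Gmap h)"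
    using h unfolding internal_group_hom_def by blast
  have eq: "fib_phi E h (X, Y) = vfact E ?\<phi> ?\<psi>"
    by (simp add: fib_phi_def)
  note l = vfact_simps[of ?\<phi> ?\<psi>, folded eq]
  have ty: "?\<phi> \<in> Arr T" "?\<psi> \<in> Arr T" "Dom T ?\<phi> = Dom T ?\<psi>" "pF ?\<phi> = pF ?\<psi>"
    by (simp_all add: fib_c_def hm)
  show "fib_phi E h (X, Y) \<in> Arr T"
    and "Dom T (fib_phi E h (X, Y)) =
      Fob (push E (Mul (Gcod h))) (Prd S (Fob (push E (Gmap h)) X) (Fob (push E (Gmap h)) Y))"
    and "Cod T (fib_phi E h (X, Y)) = Fob (push E (Gmap h)) (Fob (push E (Mul (Gdom h))) (Prd S X Y))"
    and "pF (fib_phi E h (X, Y)) = Idn B (Carr (Gcod h))"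
    using l(1-4)[OF ty] by (simp_all add: fib_c_def)
  then show "fib_phi E h (X, Y) \<cdot>\<^bsub>T\<^esub>
        act (Mul (Gcod h)) (pairing T S (act (Gmap h) x) (act (Gmap h) y)) =
        act (Gmap h) (act (Mul (Gdom h)) (pairing T S x y))"
    if "x \<in> Arr T" "y \<in> Arr T" "Dom T x = Dom T y" "Cod T x = X" "Cod T y = Y"
    using arg_cong[OF l(5)[OF ty], of "\<lambda>f. f \<cdot>\<^bsub>T\<^esub> pairing T S x y"] that
    by (simp add: fib_c_def act_def)
qed

lemma fib_phi0_simps [simp]:
  assumes h [simp]: "internal_group_hom B SB h"
  shows "fib_phi0 E h \<in> Arr T"
    and "Dom T (fib_phi0 E h) = Fob (push E (Neu (Gcod h))) (One S)"
    and "Cod T (fib_phi0 E h) = Fob (push E (Gmap h)) (Fob (push E (Neu (Gdom h))) (One S))"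
    and "pF (fib_phi0 E h) = Idn B (Carr (Gcod h))"
    and "W \<in> Obj T \<Longrightarrow> fib_phi0 E h \<cdot>\<^bsub>T\<^esub> act (Neu (Gcod h)) (bang T S W) =
      act (Gmap h) (act (Neu (Gdom h)) (bang T S W))"
proof -
  let ?\<phi> = "fib_u E (Gcod h)"
  let ?\<psi> = "Lift E (Gmap h) (fib_unit E (Gdom h)) \<cdot>\<^bsub>T\<^esub> fib_u E (Gdom h)"
  \<comment> \<open>Likewise for the neutral elements, which makes the unit comparison
    available.\<close>
  have he: "Gmap h \<cdot>\<^bsub>B\<^esub> Neu (Gdom h) = Neu (Gcod h)"
    using h unfolding internal_group_hom_def by blast
  have eq: "fib_phi0 E h = vfact E ?\<phi> ?\<psi>"
    by (simp add: fib_phi0_def)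
  note l = vfact_simps[of ?\<phi> ?\<psi>, folded eq]
  have ty: "?\<phi> \<in> Arr T" "?\<psi> \<in> Arr T" "Dom T ?\<phi> = Dom T ?\<psi>" "pF ?\<phi> = pF ?\<psi>"
    by (simp_all add: fib_u_def he)
  show "fib_phi0 E h \<in> Arr T"
    and "Dom T (fib_phi0 E h) = Fob (push E (Neu (Gcod h))) (One S)"
    and "Cod T (fib_phi0 E h) = Fob (push E (Gmap h)) (Fob (push E (Neu (Gdom h))) (One S))"
    and "pF (fib_phi0 E h) = Idn B (Carr (Gcod h))"
    using l(1-4)[OF ty] by (simp_all add: fib_u_def)
  then show "fib_phi0 E h \<cdot>\<^bsub>T\<^esub> act (Neu (Gcod h)) (bang T S W) =
      act (Gmap h) (act (Neu (Gdom h)) (bang T S W))" if "W \<in> Obj T"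
    using arg_cong[OF l(5)[OF ty], of "\<lambda>f. f \<cdot>\<^bsub>T\<^esub> bang T S W"] that
    by (simp add: fib_u_def act_def)
qed

end

text \<open>With \<open>M\<close> abstract and only its monoidal fields fixed,
  \<open>fib_moncat\<close> and \<open>fib_smoncat\<close> are both instances, although they are
  records of different types.\<close>

locale fibrewise_tensor = groupoid_opfibration E
  for E :: "('xo, 'xa, 'bo, 'ba) opfib" +
  fixes M :: "('bo, 'ba) igroup \<Rightarrow> ('xo, 'xa, 'z) moncat_scheme"
  assumes M_sel [simp]: "MCat (M G) = fibre E (Carr G)" "Tensor (M G) = fib_tensor E G"
    "TUnit (M G) = fib_unit E G" "Assoc (M G) = fib_assoc E G" "Lunit (M G) = fib_lunit E G"
    "Runit (M G) = fib_runit E G"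
begin

lemma monoidal_category_M [simp]: "internal_group B SB G \<Longrightarrow> monoidal_category (M G)"
  by (rule monoidal_category_fib) simp_all

lemma fib_monfunc_sel [simp]:
  "MDom (fib_monfunc E M h) = M (Gdom h)" "MCod (fib_monfunc E M h) = M (Gcod h)"
  "MFun (fib_monfunc E M h) = push E (Gmap h)" "MPhi (fib_monfunc E M h) = fib_phi E h"
  "MPhi0 (fib_monfunc E M h) = fib_phi0 E h"
  by (simp_all add: fib_monfunc_def)

lemma monoidal_functor_fib_monfunc:
  assumes h [simp]: "internal_group_hom B SB h"
  shows "monoidal_functor (fib_monfunc E M h)"
proof (rule monoidal_functorI[where C = "fibre E (Carr (Gdom h))" and D = "fibre E (Carr (Gcod h))"
      and M = "M (Gdom h)" and N = "M (Gcod h)" and F = "push E (Gmap h)"])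
  show "MPhi (fib_monfunc E M h) \<in> extensional (Obj (MCat (MDom (fib_monfunc E M h))) \<times>
    Obj (MCat (MDom (fib_monfunc E M h))))"
    by (simp add: fib_phi_def)
next
  fix f g assume "f \<in> Arr (fibre E (Carr (Gdom h)))" "g \<in> Arr (fibre E (Carr (Gdom h)))"
  then have f [simp]: "f \<in> Arr T" "pF f = Idn B (Carr (Gdom h))"
    "g \<in> Arr T" "pF g = Idn B (Carr (Gdom h))" by simp_all
  note [simp] = vertical_ends[OF f(1,2)] vertical_ends[OF f(3,4)]
  obtain w x y z where [simp]: "w \<in> Arr T" "x \<in> Arr T" "y \<in> Arr T" "z \<in> Arr T"
    "Cod T w = Dom T f" "Cod T x = Dom T f" "Cod T y = Dom T f" "Cod T z = Dom T g"
    "Dom T w = Dom T z" "Dom T x = Dom T z" "Dom T y = Dom T z"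
    by (rule common_domain[of "Dom T f" "Dom T f" "Dom T f" "Dom T g"]) simp_all
  show "MPhi (fib_monfunc E M h) (Cod (fibre E (Carr (Gdom h))) f, Cod (fibre E (Carr (Gdom h))) g)
      \<cdot>\<^bsub>fibre E (Carr (Gcod h))\<^esub>
      tarr (M (Gcod h)) (Far (push E (Gmap h)) f) (Far (push E (Gmap h)) g) =
    Far (push E (Gmap h)) (tarr (M (Gdom h)) f g) \<cdot>\<^bsub>fibre E (Carr (Gcod h))\<^esub>
      MPhi (fib_monfunc E M h) (Dom (fibre E (Carr (Gdom h))) f, Dom (fibre E (Carr (Gdom h))) g)"
    \<comment> \<open>Both sides send \<open>h y * h z\<close> to
      \<open>h (f y * g z)\<close>.\<close>
    by (rule cancel[where w =
          "act (Mul (Gcod h)) (pairing T S (act (Gmap h) y) (act (Gmap h) z))"]) simp_all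
next
  fix X Y Z assume "X \<in> Obj (fibre E (Carr (Gdom h)))" "Y \<in> Obj (fibre E (Carr (Gdom h)))"
    "Z \<in> Obj (fibre E (Carr (Gdom h)))"
  then have [simp]: "X \<in> Obj T" "pO X = Carr (Gdom h)" "Y \<in> Obj T" "pO Y = Carr (Gdom h)"
    "Z \<in> Obj T" "pO Z = Carr (Gdom h)" by simp_all
  obtain w x y z where [simp]: "w \<in> Arr T" "x \<in> Arr T" "y \<in> Arr T" "z \<in> Arr T"
    "Cod T w = X" "Cod T x = X" "Cod T y = Y" "Cod T z = Z"
    "Dom T w = Dom T z" "Dom T x = Dom T z" "Dom T y = Dom T z"
    by (rule common_domain[of X X Y Z]) simp_all
  show "Far (push E (Gmap h)) (Assoc (M (Gdom h)) X Y Z) \<cdot>\<^bsub>fibre E (Carr (Gcod h))\<^esub>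
      MPhi (fib_monfunc E M h) (tobj (M (Gdom h)) X Y, Z) \<cdot>\<^bsub>fibre E (Carr (Gcod h))\<^esub>
      tarr (M (Gcod h)) (MPhi (fib_monfunc E M h) (X, Y))
        (Idn (fibre E (Carr (Gcod h))) (Fob (push E (Gmap h)) Z)) =
    MPhi (fib_monfunc E M h) (X, tobj (M (Gdom h)) Y Z) \<cdot>\<^bsub>fibre E (Carr (Gcod h))\<^esub>
      tarr (M (Gcod h)) (Idn (fibre E (Carr (Gcod h))) (Fob (push E (Gmap h)) X))
        (MPhi (fib_monfunc E M h) (Y, Z)) \<cdot>\<^bsub>fibre E (Carr (Gcod h))\<^esub>
      Assoc (M (Gcod h)) (Fob (push E (Gmap h)) X) (Fob (push E (Gmap h)) Y)
        (Fob (push E (Gmap h)) Z)"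
    \<comment> \<open>Both sides send \<open>(h x * h y) * h z\<close> to
      \<open>h (x * (y * z))\<close>.\<close>
    by (rule cancel[where w = "act (Mul (Gcod h)) (pairing T S (act (Mul (Gcod h)) (pairing T S
          (act (Gmap h) x) (act (Gmap h) y))) (act (Gmap h) z))"]) simp_all
next
  fix X assume "X \<in> Obj (fibre E (Carr (Gdom h)))"
  then have [simp]: "X \<in> Obj T" "pO X = Carr (Gdom h)" by simp_all
  \<comment> \<open>The unit laws are tested on \<open>e * h x\<close> and \<open>h x * e\<close>,
    with \<open>e\<close> the neutral element of the codomain and \<open>x\<close> the identity of
    \<open>X\<close>; every side yields \<open>h x\<close>.\<close>
  let ?u = "act (Neu (Gcod h)) (bang T S X)" and ?x = "act (Gmap h) (Idn T X)"
  show "Far (push E (Gmap h)) (Lunit (M (Gdom h)) X) \<cdot>\<^bsub>fibre E (Carr (Gcod h))\<^esub>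
      MPhi (fib_monfunc E M h) (TUnit (M (Gdom h)), X) \<cdot>\<^bsub>fibre E (Carr (Gcod h))\<^esub>
      tarr (M (Gcod h)) (MPhi0 (fib_monfunc E M h))
        (Idn (fibre E (Carr (Gcod h))) (Fob (push E (Gmap h)) X)) =
    Lunit (M (Gcod h)) (Fob (push E (Gmap h)) X)"
    by (rule cancel[where w = "act (Mul (Gcod h)) (pairing T S ?u ?x)"]) simp_all
  show "Far (push E (Gmap h)) (Runit (M (Gdom h)) X) \<cdot>\<^bsub>fibre E (Carr (Gcod h))\<^esub>
      MPhi (fib_monfunc E M h) (X, TUnit (M (Gdom h))) \<cdot>\<^bsub>fibre E (Carr (Gcod h))\<^esub>
      tarr (M (Gcod h)) (Idn (fibre E (Carr (Gcod h))) (Fob (push E (Gmap h)) X))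
        (MPhi0 (fib_monfunc E M h)) =
    Runit (M (Gcod h)) (Fob (push E (Gmap h)) X)"
    by (rule cancel[where w = "act (Mul (Gcod h)) (pairing T S ?x ?u)"]) simp_all
qed (simp_all add: iso_fibre)

end

section \<open>Pseudofunctoriality\<close>

lemma symmetric_monoidal_functor_id:
  assumes "symmetric_monoidal_category M"
  shows "symmetric_monoidal_functor (id_monfunc M)"
proof -
  have [simp]: "monoidal_category M" using assms by (simp add: symmetric_monoidal_category_def)
  have "Braid M X Y \<in> hom (MCat M) (tobj M X Y) (tobj M Y X)"
    if "X \<in> Obj (MCat M)" "Y \<in> Obj (MCat M)" for X Y
    using that assms unfolding symmetric_monoidal_category_def Let_def by blast
  then show ?thesis
    using assms by (simp add: symmetric_monoidal_functor_def monoidal_functor_id)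
qed

lemma symmetric_monoidal_functor_comp:
  assumes H: "symmetric_monoidal_functor H" and K: "symmetric_monoidal_functor K"
    and HK: "MCod H = MDom K"
  shows "symmetric_monoidal_functor (comp_monfunc K H)"
proof -
  obtain M N R C D E F G p q where
    H': "MDom H = M" "MCod H = N" "MCat M = C" "MCat N = D" "MFun H = F" and
    K': "MDom K = N" "MCod K = R" "MCat N = D" "MCat R = E" "MFun K = G" and
    pq [simp]: "MPhi H = p" "MPhi K = q"
    using HK by blast
  have mf [simp]: "monoidal_functor H" "monoidal_functor K"
    using H K by (simp_all add: symmetric_monoidal_functor_def)
  note [simp] = H' K'
  have [simp]: "monoidal_category M" "monoidal_category N" "monoidal_category R"
    "is_functor F" "is_functor G" "Fdom F = C" "Fcod F = D" "Fdom G = D" "Fcod G = E"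
    using monoidal_functor_simps(1-5)[OF mf(1)] monoidal_functor_simps(1-5)[OF mf(2)] by simp_all
  then have [simp]: "category C" "category D" "category E"
    by (metis H'(3) K'(3,4) monoidal_category_simps(1))+
  note [simp] = monoidal_functor_simps(7-14)[OF mf(1), unfolded H' pq, OF refl]
    monoidal_functor_simps(7-14)[OF mf(2), unfolded K' pq, OF refl]
  have sm: "symmetric_monoidal_category M" "symmetric_monoidal_category N"
    "symmetric_monoidal_category R"
    using H K by (simp_all add: symmetric_monoidal_functor_def)
  have [simp]: "Braid M X Y \<in> Arr C \<and> Dom C (Braid M X Y) = tobj M X Y \<and>
      Cod C (Braid M X Y) = tobj M Y X" if "X \<in> Obj C" "Y \<in> Obj C" for X Y
    using that sm(1) unfolding symmetric_monoidal_category_def Let_def hom_iff H' by blast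
  have [simp]: "Braid N X Y \<in> Arr D \<and> Dom D (Braid N X Y) = tobj N X Y \<and>
      Cod D (Braid N X Y) = tobj N Y X" if "X \<in> Obj D" "Y \<in> Obj D" for X Y
    using that sm(2) unfolding symmetric_monoidal_category_def Let_def hom_iff H' by blast
  have [simp]: "Braid R X Y \<in> Arr E \<and> Dom E (Braid R X Y) = tobj R X Y \<and>
      Cod E (Braid R X Y) = tobj R Y X" if "X \<in> Obj E" "Y \<in> Obj E" for X Y
    using that sm(3) unfolding symmetric_monoidal_category_def Let_def hom_iff K' by blast
  have bH: "Far F (Braid M X Y) \<cdot>\<^bsub>D\<^esub> p (X, Y) = p (Y, X) \<cdot>\<^bsub>D\<^esub> Braid N (Fob F X) (Fob F Y)"
    if "X \<in> Obj C" "Y \<in> Obj C" for X Y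
    using H that unfolding symmetric_monoidal_functor_def H' pq by blast
  have bK: "Far G (Braid N X Y) \<cdot>\<^bsub>E\<^esub> q (X, Y) = q (Y, X) \<cdot>\<^bsub>E\<^esub> Braid R (Fob G X) (Fob G Y)"
    if "X \<in> Obj D" "Y \<in> Obj D" for X Y
    using K that unfolding symmetric_monoidal_functor_def K' pq by blast
  \<comment> \<open>The \<open>G\<close>-image of the braiding square of \<open>H\<close>, pasted
    with the braiding square of \<open>K\<close> at the images under \<open>F\<close>.\<close>
  have b: "Far G (Far F (Braid M X Y)) \<cdot>\<^bsub>E\<^esub> Far G (p (X, Y)) \<cdot>\<^bsub>E\<^esub> q (Fob F X, Fob F Y) =
      (Far G (p (Y, X)) \<cdot>\<^bsub>E\<^esub> q (Fob F Y, Fob F X)) \<cdot>\<^bsub>E\<^esub> Braid R (Fob G (Fob F X)) (Fob G (Fob F Y))"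
    if [simp]: "X \<in> Obj C" "Y \<in> Obj C" for X Y
  proof -
    have "Far G (Far F (Braid M X Y)) \<cdot>\<^bsub>E\<^esub> Far G (p (X, Y)) =
      Far G (p (Y, X)) \<cdot>\<^bsub>E\<^esub> Far G (Braid N (Fob F X) (Fob F Y))"
      using arg_cong[OF bH, of X Y "Far G"] by simp
    from comp_prefix[of E, OF _ _ _ _ _ _ this] show ?thesis by (simp add: bK)
  qed
  show ?thesis
    unfolding symmetric_monoidal_functor_def
    using sm by (simp add: monoidal_functor_comp b)
qed

lemma two_category_TwoGp: "two_category TwoGp"
  unfolding TwoGp_def
  by (rule two_category_mon2)
    (auto simp: two_group_def monoidal_functor_id monoidal_functor_comp)

lemma two_category_SymTwoGp: "two_category SymTwoGp"
  unfolding SymTwoGp_def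
proof (rule two_category_mon2, goal_cases)
  case (1 M)
  then show ?case by (simp add: symmetric_two_group_def two_group_def)
next
  case (2 H)
  then show ?case by (simp add: symmetric_monoidal_functor_def)
next
  case (3 M)
  then show ?case by (simp add: symmetric_two_group_def symmetric_monoidal_functor_id)
next
  case (4 H K)
  then show ?case by (rule symmetric_monoidal_functor_comp)
qed

text \<open>Composition with an identity of \<open>Gp\<close> repacks the fields of \<open>h\<close>
  into a new record; this rule recognizes the result as \<open>h\<close> in the unit laws of the
  pseudofunctor.\<close>

lemma ghom_surjective [simp]:
  fixes h :: "('o, 'a) ghom"
  shows "\<lparr>Gdom = Gdom h, Gcod = Gcod h, Gmap = Gmap h\<rparr> = h"
  by simp

section \<open>The comparison cells as monoidal transformations\<close>

context groupoid_opfibration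
begin

lemma is_natural_push_comp:
  assumes [simp]: "f \<in> Arr B" "g \<in> Arr B" "Cod B f = Dom B g"
  shows "is_natural (comp_func (push E g) (push E f)) (push E (g \<cdot>\<^bsub>B\<^esub> f)) (push_comp E g f)"
proof (rule naturalI)
  show "push_comp E g f \<in> extensional (Obj (Fdom (comp_func (push E g) (push E f))))"
    by (simp add: push_comp_def)
next
  fix x assume "x \<in> Arr (Fdom (comp_func (push E g) (push E f)))"
  then have x [simp]: "x \<in> Arr T" "pF x = Idn B (Dom B f)" by simp_all
  note [simp] = vertical_ends[OF x]
  have "push_comp E g f (Cod T x) \<cdot>\<^bsub>T\<^esub> Far (push E g) (Far (push E f) x) =
      Far (push E (g \<cdot>\<^bsub>B\<^esub> f)) x \<cdot>\<^bsub>T\<^esub> push_comp E g f (Dom T x)"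
    by (rule cancel[where w = "act g (act f (Idn T (Dom T x)))"]) simp_all
  then show "push_comp E g f (Cod (Fdom (comp_func (push E g) (push E f))) x)
      \<cdot>\<^bsub>Fcod (comp_func (push E g) (push E f))\<^esub> Far (comp_func (push E g) (push E f)) x =
    Far (push E (g \<cdot>\<^bsub>B\<^esub> f)) x \<cdot>\<^bsub>Fcod (comp_func (push E g) (push E f))\<^esub>
      push_comp E g f (Dom (Fdom (comp_func (push E g) (push E f))) x)"
    by simp
qed simp_all

lemma is_natural_push_unit:
  assumes [simp]: "A \<in> Obj B"
  shows "is_natural (id_func (fibre E A)) (push E (Idn B A)) (push_unit E A)"
proof (rule naturalI)
  show "push_unit E A \<in> extensional (Obj (Fdom (id_func (fibre E A))))"
    by (simp add: push_unit_def)
next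
  fix x assume "x \<in> Arr (Fdom (id_func (fibre E A)))"
  then have x [simp]: "x \<in> Arr T" "pF x = Idn B A" by simp_all
  note [simp] = vertical_ends[OF x]
  have "push_unit E A (Cod T x) \<cdot>\<^bsub>T\<^esub> x = Far (push E (Idn B A)) x \<cdot>\<^bsub>T\<^esub> push_unit E A (Dom T x)"
    by (rule cancel[where w = "Pr1 S (Dom T x) (Dom T x)"]) simp_all
  then show "push_unit E A (Cod (Fdom (id_func (fibre E A))) x)
      \<cdot>\<^bsub>Fcod (id_func (fibre E A))\<^esub> Far (id_func (fibre E A)) x =
    Far (push E (Idn B A)) x \<cdot>\<^bsub>Fcod (id_func (fibre E A))\<^esub>
      push_unit E A (Dom (Fdom (id_func (fibre E A))) x)"
    by simp
qed simp_all

end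

context fibrewise_tensor
begin

lemma monoidal_natural_push_comp:
  assumes h [simp]: "internal_group_hom B SB h" and k [simp]: "internal_group_hom B SB k"
    and hk [simp]: "Gcod h = Gdom k"
  shows "monoidal_natural (comp_monfunc (fib_monfunc E M k) (fib_monfunc E M h))
    (fib_monfunc E M (k \<cdot>\<^bsub>Gp B SB\<^esub> h)) (push_comp E (Gmap k) (Gmap h))"
proof -
  have c [simp]: "internal_group_hom B SB
      \<lparr>Gdom = Gdom h, Gcod = Gcod k, Gmap = Gmap k \<cdot>\<^bsub>B\<^esub> Gmap h\<rparr>"
    by (rule internal_group_hom_comp) simp_all
  \<comment> \<open>As a simp rule, \<open>hk\<close> replaces \<open>Gcod h\<close> by
    \<open>Gdom k\<close>, and selectors of the composite record are evaluated. The facts on both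
    structure maps are restated in these normal forms so that they still match.\<close>
  note phi = fib_phi_simps[OF c, simplified] fib_phi0_simps[OF c, simplified]
    fib_phi_simps[OF h, unfolded hk] fib_phi0_simps[OF h, unfolded hk]
  show ?thesis
  proof (rule monoidal_naturalI[where M = "M (Gdom h)" and N = "M (Gcod k)" and
        C = "fibre E (Carr (Gdom h))" and D = "fibre E (Carr (Gcod k))"])
    show "is_natural (MFun (comp_monfunc (fib_monfunc E M k) (fib_monfunc E M h)))
      (MFun (fib_monfunc E M (k \<cdot>\<^bsub>Gp B SB\<^esub> h))) (push_comp E (Gmap k) (Gmap h))"
      by (simp add: is_natural_push_comp)
  next
    fix X Y assume "X \<in> Obj (fibre E (Carr (Gdom h)))" "Y \<in> Obj (fibre E (Carr (Gdom h)))"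
    then have [simp]: "X \<in> Obj T" "pO X = Carr (Gdom h)" "Y \<in> Obj T" "pO Y = Carr (Gdom h)"
      by simp_all
    obtain w x y z where [simp]: "w \<in> Arr T" "x \<in> Arr T" "y \<in> Arr T" "z \<in> Arr T"
      "Cod T w = X" "Cod T x = X" "Cod T y = X" "Cod T z = Y"
      "Dom T w = Dom T z" "Dom T x = Dom T z" "Dom T y = Dom T z"
      by (rule common_domain[of X X X Y]) simp_all
    show "push_comp E (Gmap k) (Gmap h) (tobj (M (Gdom h)) X Y) \<cdot>\<^bsub>fibre E (Carr (Gcod k))\<^esub>
        MPhi (comp_monfunc (fib_monfunc E M k) (fib_monfunc E M h)) (X, Y) =
      MPhi (fib_monfunc E M (k \<cdot>\<^bsub>Gp B SB\<^esub> h)) (X, Y) \<cdot>\<^bsub>fibre E (Carr (Gcod k))\<^esub>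
        tarr (M (Gcod k)) (push_comp E (Gmap k) (Gmap h) X) (push_comp E (Gmap k) (Gmap h) Y)"
      \<comment> \<open>Both sides send \<open>k (h x) * k (h z)\<close> to
        \<open>(k h) (x * z)\<close>.\<close>
      by (rule cancel[where w = "act (Mul (Gcod k)) (pairing T S
            (act (Gmap k) (act (Gmap h) x)) (act (Gmap k) (act (Gmap h) z)))"])
        (simp_all add: phi)
  next
    show "push_comp E (Gmap k) (Gmap h) (TUnit (M (Gdom h))) \<cdot>\<^bsub>fibre E (Carr (Gcod k))\<^esub>
        MPhi0 (comp_monfunc (fib_monfunc E M k) (fib_monfunc E M h)) =
      MPhi0 (fib_monfunc E M (k \<cdot>\<^bsub>Gp B SB\<^esub> h))"
      \<comment> \<open>Both sides send the neutral element \<open>e\<close> of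
        \<open>Gcod k\<close> to \<open>(k h) e\<close>, where the second \<open>e\<close> is that
        of \<open>Gdom h\<close>.\<close>
      by (rule cancel[where w = "act (Neu (Gcod k)) (bang T S (One S))"]) (simp_all add: phi)
  qed simp_all
qed

lemma monoidal_natural_push_unit:
  assumes G [simp]: "internal_group B SB G"
  shows "monoidal_natural (id_monfunc (M G)) (fib_monfunc E M (Idn (Gp B SB) G))
    (push_unit E (Carr G))"
proof -
  have c [simp]: "internal_group_hom B SB \<lparr>Gdom = G, Gcod = G, Gmap = Idn B (Carr G)\<rparr>"
    by (rule internal_group_hom_Idn) simp_all
  note phi = fib_phi_simps[OF c, simplified] fib_phi0_simps[OF c, simplified]
  show ?thesis
  proof (rule monoidal_naturalI[where M = "M G" and N = "M G" and
        C = "fibre E (Carr G)" and D = "fibre E (Carr G)"])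
    show "is_natural (MFun (id_monfunc (M G))) (MFun (fib_monfunc E M (Idn (Gp B SB) G)))
      (push_unit E (Carr G))"
      by (simp add: is_natural_push_unit)
  next
    fix X Y assume "X \<in> Obj (fibre E (Carr G))" "Y \<in> Obj (fibre E (Carr G))"
    then have [simp]: "X \<in> Obj T" "pO X = Carr G" "Y \<in> Obj T" "pO Y = Carr G" by simp_all
    obtain w x y z where [simp]: "w \<in> Arr T" "x \<in> Arr T" "y \<in> Arr T" "z \<in> Arr T"
      "Cod T w = X" "Cod T x = X" "Cod T y = X" "Cod T z = Y"
      "Dom T w = Dom T z" "Dom T x = Dom T z" "Dom T y = Dom T z"
      by (rule common_domain[of X X X Y]) simp_all
    show "push_unit E (Carr G) (tobj (M G) X Y) \<cdot>\<^bsub>fibre E (Carr G)\<^esub> MPhi (id_monfunc (M G)) (X, Y) =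
      MPhi (fib_monfunc E M (Idn (Gp B SB) G)) (X, Y) \<cdot>\<^bsub>fibre E (Carr G)\<^esub>
        tarr (M G) (push_unit E (Carr G) X) (push_unit E (Carr G) Y)"
      \<comment> \<open>Both sides send \<open>x * z\<close> to \<open>1 (x * z)\<close>, with
        \<open>1\<close> the identity of the carrier.\<close>
      by (rule cancel[where w = "act (Mul G) (pairing T S x z)"]) (simp_all add: phi)
  next
    show "push_unit E (Carr G) (TUnit (M G)) \<cdot>\<^bsub>fibre E (Carr G)\<^esub> MPhi0 (id_monfunc (M G)) =
      MPhi0 (fib_monfunc E M (Idn (Gp B SB) G))"
      by (rule cancel[where w = "act (Neu G) (bang T S (One S))"]) (simp_all add: phi)
  qed simp_all
qed

section \<open>The lifted pseudofunctor\<close>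

lemma lifted_pseudofunctor_sel [simp]:
  "PObj (lifted_pseudofunctor E M) = M" "PArr (lifted_pseudofunctor E M) = fib_monfunc E M"
  "PComp (lifted_pseudofunctor E M) k h =
    \<lparr>Ndom = comp_monfunc (fib_monfunc E M k) (fib_monfunc E M h),
     Ncod = fib_monfunc E M (k \<cdot>\<^bsub>Gp B SB\<^esub> h), Ncmp = push_comp E (Gmap k) (Gmap h)\<rparr>"
  "PUnit (lifted_pseudofunctor E M) G =
    \<lparr>Ndom = id_monfunc (M G), Ncod = fib_monfunc E M (Idn (Gp B SB) G),
     Ncmp = push_unit E (Carr G)\<rparr>"
  by (simp_all add: lifted_pseudofunctor_def)

text \<open>A substitute for \<open>fibre_sel(1)\<close> that unfolds membership but leaves the set
  \<open>Obj (fibre E A)\<close> intact, since it also occurs as the carrier of extensional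
  families.\<close>

lemma fibre_obj: "X \<in> Obj (fibre E A) \<longleftrightarrow> X \<in> Obj T \<and> pO X = A"
  by simp

text \<open>Stated for any category \<open>C\<close> of internal groups with the operations of
  \<open>Gp\<close>, and for any predicates \<open>P\<close>, \<open>Q\<close>, so that one argument
  serves groups with 2-groups and abelian groups with symmetric 2-groups.\<close>

lemma lifts_lifted_pseudofunctor:
  assumes C: "category C" "Dom C = Gdom" "Cod C = Gcod" "Idn C = Idn (Gp B SB)"
      "Cmp C = Cmp (Gp B SB)"
    and C_obj: "\<And>G. G \<in> Obj C \<Longrightarrow> internal_group B SB G \<and> P (M G)"
    and C_arr: "\<And>h. h \<in> Arr C \<Longrightarrow> internal_group_hom B SB h \<and> Q (fib_monfunc E M h)"
    and K: "two_category (mon2 P Q)"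
    and Q: "\<And>H. Q H \<Longrightarrow> monoidal_functor H"
    and Q_id: "\<And>N. P N \<Longrightarrow> Q (id_monfunc N)"
    and Q_comp: "\<And>H K. \<lbrakk>Q H; Q K; MCod H = MDom K\<rbrakk> \<Longrightarrow> Q (comp_monfunc K H)"
  shows "lifts (assoc_pseudofunctor E) C Carr Gmap (mon2 P Q) MCat MFun forget_ntrans
    (lifted_pseudofunctor E M)"
proof -
  let ?L = "lifted_pseudofunctor E M"
  have arr: "internal_group_hom B SB h" "Q (fib_monfunc E M h)" "Gdom h \<in> Obj C" "Gcod h \<in> Obj C"
    "P (M (Gdom h))" "P (M (Gcod h))" "monoidal_functor (fib_monfunc E M h)"
    if "h \<in> Arr C" for h
    using C_arr[OF that] C_obj category_simps(1,2)[OF C(1) that] C(2,3) Q by auto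
  have comp_arr: "k \<cdot>\<^bsub>Gp B SB\<^esub> h \<in> Arr C" if "h \<in> Arr C" "k \<in> Arr C" "Gcod h = Gdom k" for h k
    using category_simps(6)[OF C(1) that(1,2)] that(3) C by metis
  have id_arr: "Idn (Gp B SB) G \<in> Arr C" if "G \<in> Obj C" for G
    using category_simps(3)[OF C(1) that] C(4) by metis
  have pcomp: "PComp ?L k h \<in> Cells2 (mon2 P Q)" "iso (vcat (mon2 P Q)) (PComp ?L k h)"
    if hk: "h \<in> Arr C" "k \<in> Arr C" "Gcod h = Gdom k" for h k
  proof -
    note h = arr[OF hk(1)] and k = arr[OF hk(2)]
    have "Q (comp_monfunc (fib_monfunc E M k) (fib_monfunc E M h))"
      by (rule Q_comp) (use h k hk in simp_all)
    then show c: "PComp ?L k h \<in> Cells2 (mon2 P Q)"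
      using h k arr(2)[OF comp_arr[OF hk]] hk(3) monoidal_natural_push_comp[OF h(1) k(1)] by simp
    show "iso (vcat (mon2 P Q)) (PComp ?L k h)"
    \<comment> \<open>Components of the comparison are vertical, so the groupoid fibres make them
      invertible.\<close>
    proof (rule iso_2cell[OF c Q])
      fix X assume "X \<in> Obj (MCat (MDom (Ndom (PComp ?L k h))))"
      then show "iso (MCat (MCod (Ndom (PComp ?L k h)))) (Ncmp (PComp ?L k h) X)"
        using h(1) k(1) hk(3) by (simp add: iso_fibre)
    qed
  qed
  have punit: "PUnit ?L G \<in> Cells2 (mon2 P Q)" "iso (vcat (mon2 P Q)) (PUnit ?L G)"
    if G: "G \<in> Obj C" for G
  proof -
    note G' = C_obj[OF G]
    show c: "PUnit ?L G \<in> Cells2 (mon2 P Q)"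
      using G' arr(2)[OF id_arr[OF G]] monoidal_natural_push_unit[of G] Q_id by simp
    show "iso (vcat (mon2 P Q)) (PUnit ?L G)"
    proof (rule iso_2cell[OF c Q])
      fix X assume "X \<in> Obj (MCat (MDom (Ndom (PUnit ?L G))))"
      then show "iso (MCat (MCod (Ndom (PUnit ?L G)))) (Ncmp (PUnit ?L G) X)"
        using G' by (simp add: iso_fibre)
    qed
  qed
  have "pseudofunctor C (mon2 P Q) ?L"
    unfolding pseudofunctor_def
  proof (intro conjI ballI impI C(1) K)
    fix G assume "G \<in> Obj C"
    then show "PObj ?L G \<in> Cells0 (mon2 P Q)" using C_obj by simp
    show "PUnit ?L G \<in> hom (vcat (mon2 P Q)) (Id1 (mon2 P Q) (PObj ?L G)) (PArr ?L (Idn C G))"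
      using punit(1)[OF \<open>G \<in> Obj C\<close>] by (simp add: C(4) del: mon2_sel(3))
    show "iso (vcat (mon2 P Q)) (PUnit ?L G)" by (rule punit) fact
  next
    fix h assume "h \<in> Arr C"
    note h = arr[OF this]
    show "PArr ?L h \<in> hom (cat1 (mon2 P Q)) (PObj ?L (Dom C h)) (PObj ?L (Cod C h))"
      using h by (simp add: C(2,3))
    note [simp] = h(1) group_hom_simps[OF h(1)] group_simps[OF group_hom_simps(1)[OF h(1)]]
      group_simps[OF group_hom_simps(2)[OF h(1)]]
    have unit: "monoidal_functor (fib_monfunc E M (Idn (Gp B SB) (Gdom h)))"
      "monoidal_functor (fib_monfunc E M (Idn (Gp B SB) (Gcod h)))"
      using arr(7)[OF id_arr] h(3,4) by blast+
    \<comment> \<open>The unit law at the component \<open>X\<close>; the middle identity comes from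
      whiskering with \<open>Id2\<close>. The test element is of the form
      \<open>h x\<close>.\<close>
    have "push_comp E (Gmap h) (Idn B (Carr (Gdom h))) X \<cdot>\<^bsub>T\<^esub>
        Idn T (Fob (push E (Gmap h)) (Fob (push E (Idn B (Carr (Gdom h)))) X)) \<cdot>\<^bsub>T\<^esub>
        Far (push E (Gmap h)) (push_unit E (Carr (Gdom h)) X) = Idn T (Fob (push E (Gmap h)) X)"
      if [simp]: "X \<in> Obj T" "pO X = Carr (Gdom h)" for X
      by (rule cancel[where w = "act (Gmap h) (Pr1 S X X)"]) simp_all
    then show "VComp (mon2 P Q) (PComp ?L h (Idn C (Dom C h)))
        (HComp (mon2 P Q) (Id2 (mon2 P Q) (PArr ?L h)) (PUnit ?L (Dom C h))) =
      Id2 (mon2 P Q) (PArr ?L h)"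
      using h(7) by (intro ntrans_eqI[of _ _ "Obj (fibre E (Carr (Gdom h)))"])
        (simp_all add: C fibre_obj del: fibre_sel(1))
    have "push_comp E (Idn B (Carr (Gcod h))) (Gmap h) X \<cdot>\<^bsub>T\<^esub>
        push_unit E (Carr (Gcod h)) (Fob (push E (Gmap h)) X) =
        Idn T (Fob (push E (Gmap h)) X)"
      if [simp]: "X \<in> Obj T" "pO X = Carr (Gdom h)" for X
      by (rule cancel[where w = "act (Gmap h) (Pr1 S X X)"]) simp_all
    then show "VComp (mon2 P Q) (PComp ?L (Idn C (Cod C h)) h)
        (HComp (mon2 P Q) (PUnit ?L (Cod C h)) (Id2 (mon2 P Q) (PArr ?L h))) =
      Id2 (mon2 P Q) (PArr ?L h)"
      using h(7) by (intro ntrans_eqI[of _ _ "Obj (fibre E (Carr (Gdom h)))"])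
        (simp_all add: C fibre_obj del: fibre_sel(1))
  next
    fix h k assume hk: "h \<in> Arr C" "k \<in> Arr C" "Cod C h = Dom C k"
    then have hk': "Gcod h = Gdom k" by (simp add: C)
    show "PComp ?L k h \<in> hom (vcat (mon2 P Q)) (Comp1 (mon2 P Q) (PArr ?L k) (PArr ?L h))
      (PArr ?L (k \<cdot>\<^bsub>C\<^esub> h))"
      using pcomp(1)[OF hk(1,2) hk'] by (simp add: C(5) del: mon2_sel(3))
    show "iso (vcat (mon2 P Q)) (PComp ?L k h)" using pcomp(2)[OF hk(1,2) hk'] .
  next
    fix f g h assume fgh: "f \<in> Arr C" "g \<in> Arr C" "h \<in> Arr C" "Cod C f = Dom C g"
      "Cod C g = Dom C h"
    note f = arr[OF fgh(1)] and g = arr[OF fgh(2)] and h = arr[OF fgh(3)]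
    have [simp]: "Gcod f = Gdom g" "Gcod g = Gdom h" using fgh by (simp_all add: C)
    note [simp] = f(1,7) g(1,7) h(1,7)
    show "VComp (mon2 P Q) (PComp ?L h (g \<cdot>\<^bsub>C\<^esub> f))
        (HComp (mon2 P Q) (Id2 (mon2 P Q) (PArr ?L h)) (PComp ?L g f)) =
      VComp (mon2 P Q) (PComp ?L (h \<cdot>\<^bsub>C\<^esub> g) f)
        (HComp (mon2 P Q) (PComp ?L h g) (Id2 (mon2 P Q) (PArr ?L f)))"
    proof (rule ntrans_eqI[of _ _ "Obj (fibre E (Carr (Gdom f)))"])
      fix X assume "X \<in> Obj (fibre E (Carr (Gdom f)))"
      then have [simp]: "X \<in> Obj T" "pO X = Carr (Gdom f)" by simp_all
      \<comment> \<open>Associativity at the component \<open>X\<close>: both sides send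
        \<open>h (g (f x))\<close> to \<open>(h g f) x\<close>.\<close>
      have "push_comp E (Gmap h) (Gmap g \<cdot>\<^bsub>B\<^esub> Gmap f) X \<cdot>\<^bsub>T\<^esub>
          Idn T (Fob (push E (Gmap h)) (Fob (push E (Gmap g \<cdot>\<^bsub>B\<^esub> Gmap f)) X)) \<cdot>\<^bsub>T\<^esub>
          Far (push E (Gmap h)) (push_comp E (Gmap g) (Gmap f) X) =
        push_comp E (Gmap h \<cdot>\<^bsub>B\<^esub> Gmap g) (Gmap f) X \<cdot>\<^bsub>T\<^esub>
          push_comp E (Gmap h) (Gmap g) (Fob (push E (Gmap f)) X)"
        by (rule cancel[where w = "act (Gmap h) (act (Gmap g) (act (Gmap f) (Pr1 S X X)))"])
          simp_all
      then show "Ncmp (VComp (mon2 P Q) (PComp ?L h (g \<cdot>\<^bsub>C\<^esub> f))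
            (HComp (mon2 P Q) (Id2 (mon2 P Q) (PArr ?L h)) (PComp ?L g f))) X =
        Ncmp (VComp (mon2 P Q) (PComp ?L (h \<cdot>\<^bsub>C\<^esub> g) f)
          (HComp (mon2 P Q) (PComp ?L h g) (Id2 (mon2 P Q) (PArr ?L f)))) X"
        by (simp add: C)
    qed (simp_all add: C comp_monfunc_assoc del: fibre_sel(1))
  qed
  \<comment> \<open>Commutation with the forgetful maps holds on the nose: the lifted data consist
    of the data of \<open>assoc_pseudofunctor\<close> with monoidal structure added.\<close>
  then show ?thesis
    using C(2,3) by (simp add: lifts_def assoc_pseudofunctor_def forget_ntrans_def)
qed

end

theorem corollary5p7:
  fixes E :: "('xo, 'xa, 'bo, 'ba) opfib"
  assumes "cartesian_monoidal_opfibration E"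
    and "\<forall>A \<in> Obj (Bas E). groupoid (fibre E A)"
  shows "lifts (assoc_pseudofunctor E)
           (Gp (Bas E) (BProd E)) Carr Gmap
           TwoGp MCat MFun forget_ntrans
           (lifted_pseudofunctor E (fib_moncat E)) \<and>
         lifts (assoc_pseudofunctor E)
           (Ab (Bas E) (BProd E)) Carr Gmap
           SymTwoGp MCat MFun forget_ntrans
           (lifted_pseudofunctor E (fib_smoncat E))"
proof
  interpret groupoid_opfibration E
    by unfold_locales (use assms in blast)+
  interpret mon: fibrewise_tensor E "fib_moncat E"
    by unfold_locales (simp_all add: fib_moncat_def)
  interpret smon: fibrewise_tensor E "fib_smoncat E"
    by unfold_locales (simp_all add: fib_smoncat_def)
  \<comment> \<open>The braiding is not among the fields fixed by \<open>fibrewise_tensor\<close>,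
    so it is supplied separately.\<close>
  have [simp]: "Braid (fib_smoncat E G) = fib_braid E G" for G
    by (simp add: fib_smoncat_def)
  show "lifts (assoc_pseudofunctor E) (Gp B SB) Carr Gmap TwoGp MCat MFun forget_ntrans
    (lifted_pseudofunctor E (fib_moncat E))"
    unfolding TwoGp_def
  proof (rule mon.lifts_lifted_pseudofunctor, goal_cases)
    \<comment> \<open>Here and in the abelian case, goals 1 to 5 describe the category, 6 and 7 are
      \<open>C_obj\<close> and \<open>C_arr\<close>, 8 is the 2-category, and 9 to 11 are the
      conditions on \<open>Q\<close>.\<close>
    case (6 G)
    then show ?case by (auto intro: two_group_fib)
  qed (auto simp: category_Gp mon.monoidal_functor_fib_monfunc two_category_TwoGp[unfolded TwoGp_def]
      two_group_def intro: monoidal_functor_id monoidal_functor_comp)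
  have sym2: "symmetric_two_group (fib_smoncat E G)" if "internal_abelian_group B SB G" for G
    by (rule symmetric_two_group_fib[OF that]) simp_all
  have smf: "symmetric_monoidal_functor (fib_monfunc E (fib_smoncat E) h)"
    if h [simp]: "internal_group_hom B SB h" and ab [simp]: "internal_abelian_group B SB (Gdom h)"
      "internal_abelian_group B SB (Gcod h)" for h
  proof -
    have "Far (push E (Gmap h)) (fib_braid E (Gdom h) X Y) \<cdot>\<^bsub>T\<^esub> fib_phi E h (X, Y) =
        fib_phi E h (Y, X) \<cdot>\<^bsub>T\<^esub>
          fib_braid E (Gcod h) (Fob (push E (Gmap h)) X) (Fob (push E (Gmap h)) Y)"
      if [simp]: "X \<in> Obj T" "pO X = Carr (Gdom h)" "Y \<in> Obj T" "pO Y = Carr (Gdom h)" for X Y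
    proof -
      obtain w x y z where [simp]: "w \<in> Arr T" "x \<in> Arr T" "y \<in> Arr T" "z \<in> Arr T"
        "Cod T w = X" "Cod T x = X" "Cod T y = X" "Cod T z = Y"
        "Dom T w = Dom T z" "Dom T x = Dom T z" "Dom T y = Dom T z"
        by (rule common_domain[of X X X Y]) simp_all
      show ?thesis
        \<comment> \<open>Both sides send \<open>h x * h z\<close> to
          \<open>h (z * x)\<close>.\<close>
        by (rule cancel[where w =
              "act (Mul (Gcod h)) (pairing T S (act (Gmap h) x) (act (Gmap h) z))"]) simp_all
    qed
    then show ?thesis
      using sym2[OF ab(1)] sym2[OF ab(2)] smon.monoidal_functor_fib_monfunc[OF h]
      by (simp add: symmetric_monoidal_functor_def symmetric_two_group_def)
  qed
  show "lifts (assoc_pseudofunctor E) (Ab B SB) Carr Gmap SymTwoGp MCat MFun forget_ntrans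
    (lifted_pseudofunctor E (fib_smoncat E))"
    unfolding SymTwoGp_def
  proof (rule smon.lifts_lifted_pseudofunctor, goal_cases)
    case (6 G)
    then show ?case using sym2 by (simp add: internal_abelian_group_def)
  next
    case (9 H)
    then show ?case by (simp add: symmetric_monoidal_functor_def)
  next
    case (10 N)
    then show ?case by (simp add: symmetric_two_group_def symmetric_monoidal_functor_id)
  next
    case (11 H K)
    then show ?case by (rule symmetric_monoidal_functor_comp)
  qed (simp_all add: category_Ab smf two_category_SymTwoGp[unfolded SymTwoGp_def])
qed

end
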